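(* Let $\mathcal Q_1=(0,1)^2$, and for each eigenvalue $\lambda$ of the Dirichlet (resp. Neumann) Laplacian on $\mathcal Q_1$ let $\mathcal N_\lambda^{\mathrm D}=\{(m,n)\in\mathbb N^2: m^2+n^2=\lambda/\pi^2\}$ and $\mathcal N_\lambda^{\mathrm N}=\{(m,n)\in(\mathbb N\cup\{0\})^2: m^2+n^2=\lambda/\pi^2\}$, and define $$u^{\mathrm D}_\lambda(z)=\frac{4}{|\mathcal N^{\mathrm D}_\lambda|^{1/2}}\sum_{(m,n)\in\mathcal N^{\mathrm D}_\lambda}\sin(m\pi z_1)\sin(n\pi z_2),\qquad u^{\mathrm N}_\lambda(z)=\frac{4}{|\mathcal N^{\mathrm N}_\lambda|^{1/2}}\sum_{(m,n)\in\mathcal N^{\mathrm N}_\lambda}\cos(m\pi z_1)\cos(n\pi z_2).$$ Let $\lambda_n$ enumerate the distinct eigenvalues and $u_n=u^{\mathrm{BC}}_{\lambda_n}$ for $\mathrm{BC}\in\{\mathrm D,\mathrm N\}$ fixed. Then there is a subsequence $\{n_j\}$ of density one such that for any $\varphi\in\mathrm{MW}$, any $\varepsilon>0$, any ball $B\subset\mathbb R^2$ and any $k\in\mathbb N$ there exist $J\in\mathbb N$ and a set $M\subset\mathcal Q_1$ of positive measure such that for every $z^0\in M$, $$\Big\|u_{n_J}\Big(z^0+\frac{\cdot}{\sqrt{\lambda_{n_J}}}\Big)-\varphi\Big\|_{C^k(B)}<\varepsilon.$$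
   Context: $\mathrm{MW}=\{\varphi\in C^\infty(\mathbb R^2,\mathbb R):\Delta\varphi+\varphi=0\}$. The eigenvalues of the Dirichlet and Neumann Laplacian on $\mathcal Q_1$ are the numbers $\pi^2(m^2+n^2)$ with $(m,n)$ in $\mathbb N^2$, resp. $(\mathbb N\cup\{0\})^2$; the functions $u^{\mathrm{BC}}_\lambda$ are given by their trigonometric formulas on all of $\mathbb R^2$. *)

theory Defs
  imports "HOL-Analysis.Analysis"
begin

datatype BC = Dirichlet | Neumann

definition pd1 :: "(real \<times> real \<Rightarrow> real) \<Rightarrow> real \<times> real \<Rightarrow> real" where
  "pd1 f = (\<lambda>(x, y). deriv (\<lambda>t. f (t, y)) x)"

definition pd2 :: "(real \<times> real \<Rightarrow> real) \<Rightarrow> real \<times> real \<Rightarrow> real" where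
  "pd2 f = (\<lambda>(x, y). deriv (\<lambda>t. f (x, t)) y)"

fun pdl :: "bool list \<Rightarrow> (real \<times> real \<Rightarrow> real) \<Rightarrow> real \<times> real \<Rightarrow> real" where
  "pdl [] f = f"
| "pdl (b # bs) f = (if b then pd2 else pd1) (pdl bs f)"

definition smooth2 :: "(real \<times> real \<Rightarrow> real) \<Rightarrow> bool" where
  "smooth2 f \<longleftrightarrow> (\<forall>bs. continuous_on UNIV (pdl bs f) \<and>
      (\<forall>x y. (\<lambda>t. pdl bs f (t, y)) differentiable (at x) \<and>
             (\<lambda>t. pdl bs f (x, t)) differentiable (at y)))"

definition MW :: "(real \<times> real \<Rightarrow> real) set" where
  "MW = {\<phi>. smooth2 \<phi> \<and> (\<forall>z. pd1 (pd1 \<phi>) z + pd2 (pd2 \<phi>) z + \<phi> z = 0)}"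

definition Ck_norm :: "nat \<Rightarrow> (real \<times> real) set \<Rightarrow> (real \<times> real \<Rightarrow> real) \<Rightarrow> real" where
  "Ck_norm k B g = Sup {\<bar>(pd1 ^^ a) ((pd2 ^^ b) g) z\<bar> | a b z. a + b \<le> k \<and> z \<in> B}"

definition Q1 :: "(real \<times> real) set" where
  "Q1 = {0<..<1} \<times> {0<..<1}"

definition admissible :: "BC \<Rightarrow> nat \<times> nat \<Rightarrow> bool" where
  "admissible bc p = (case bc of Dirichlet \<Rightarrow> fst p \<ge> 1 \<and> snd p \<ge> 1 | Neumann \<Rightarrow> True)"

definition eigenvalues :: "BC \<Rightarrow> real set" where
  "eigenvalues bc = {pi\<^sup>2 * real (m\<^sup>2 + n\<^sup>2) | m n. admissible bc (m, n)}"

definition Nset :: "BC \<Rightarrow> real \<Rightarrow> (nat \<times> nat) set" where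
  "Nset bc lv = {(m, n). admissible bc (m, n) \<and> real (m\<^sup>2 + n\<^sup>2) = lv / pi\<^sup>2}"

definition ufun :: "BC \<Rightarrow> real \<Rightarrow> real \<times> real \<Rightarrow> real" where
  "ufun bc lv z = 4 / sqrt (real (card (Nset bc lv))) *
     (\<Sum>(m, n)\<in>Nset bc lv. (case bc of
         Dirichlet \<Rightarrow> sin (real m * pi * fst z) * sin (real n * pi * snd z)
       | Neumann \<Rightarrow> cos (real m * pi * fst z) * cos (real n * pi * snd z)))"

definition density_one :: "nat set \<Rightarrow> bool" where
  "density_one S \<longleftrightarrow> (\<lambda>N. real (card (S \<inter> {..<N})) / real N) \<longlonglongrightarrow> 1"

end

theory Submission
  imports Defs "HOL-Computational_Algebra.Primes"
begin

text \<open>All of the integers form a subsequence of density one, so it is enough to find, for each datum, one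
  eigenvalue that works. Take \<open>\<lambda> = 4\<pi>\<^sup>2 p\<^sup>e\<close> with \<open>e\<close> odd and \<open>p = A\<^sup>2 + B\<^sup>2\<close> a fixed large prime. The lattice
  points on the circle are \<open>(2m, 2n)\<close> with \<open>m\<^sup>2 + n\<^sup>2 = p\<^sup>e\<close>; their directions come from the powers of
  \<open>A + iB\<close> and, as \<open>e\<close> grows, visit every arc with positive frequency, while descent modulo \<open>p\<close> shows that
  their coordinates satisfy no integer relation with coefficients below \<open>(p/2)\<^sup>1\<^sup>/\<^sup>2\<close>.
  Weighting the base point by a product of Fejer kernels therefore makes the phases of the
  individual waves exactly uncorrelated and concentrated at prescribed values, with a fluctuation
  of the rescaled eigenfunction that depends only on the degree of the kernel, not on the number
  of points. The prescribed phases let a few points near each target direction reproduce a given sum of waves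
  and the remaining ones cancel in adjacent pairs.

  That such sums of waves approximate every \<open>\<phi>\<close> in \<open>MW\<close> is shown by Fejer means over rotations:
  an angular mode of \<open>\<phi>\<close> solves Bessel's equation and is determined by one derivative of \<open>\<phi>\<close> at the origin,
  hence is a superposition of plane waves.\<close>

text \<open>The normalisation is by the square root of the number N of lattice points, so at a
  generic base point the rescaled eigenfunction fluctuates by an amount of order one however large N
  is. A Fejer kernel of large degree D makes the fluctuation small, and this fixes the order of the
  choices: the accuracy determines D, D bounds the relations to be excluded and so determines p, and
  the exponent e is taken large last. About sqrt N of the points suffice to build the target; the
  others must nearly cancel, since their sum is divided by sqrt N only. The factor 4 in \<lambda>
  doubles both coordinates, so that the phases run through full periods while the base point runs
  through the unit square; it creates no further points, because a sum of two squares divisible by 4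
  has even terms. An odd e leaves no point on the axes, so the Dirichlet and Neumann point sets
  coincide. The C^k norm on a ball is reduced to Taylor coefficients at 0. Their number T depends on
  N through the remainder, hence the bounds for the coefficients are uniform in T.\<close>

section \<open>The angular modes of a solution of the Helmholtz equation\<close>

text \<open>In Wirtinger notation, 2 d/dw raises the index and -2 d/d(conj w) lowers it. Hence 4
  d/dw d/d(conj w) maps \<open>g n\<close> to its negative and every \<open>g n\<close> solves the
  Helmholtz equation. The index keeps track of all derivatives in a form that a rotation only
  multiplies by scalars.\<close>

definition helmholtz_ladder :: "(int \<Rightarrow> complex \<Rightarrow> complex) \<Rightarrow> bool" where
  "helmholtz_ladder g \<longleftrightarrow> (\<forall>n w. (g n has_derivative
     (\<lambda>h. (h * g (n + 1) w - cnj h * g (n - 1) w) / 2)) (at w))"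

lemma ladder_derivative:
  assumes "helmholtz_ladder g"
  shows "(g n has_derivative (\<lambda>h. (h * g (n + 1) w - cnj h * g (n - 1) w) / 2)) (at w within S)"
  using assms unfolding helmholtz_ladder_def by (blast intro: has_derivative_at_withinI)

lemma ladder_continuous_on:
  assumes "helmholtz_ladder g"
  shows "continuous_on S (g n)"
  by (rule has_derivative_continuous_on[OF ladder_derivative[OF assms]])

lemma ladder_continuous_on_compose:
  assumes "helmholtz_ladder g" "continuous_on S f"
  shows "continuous_on S (\<lambda>x. g n (f x))"
  by (rule continuous_on_compose2[OF ladder_continuous_on[OF assms(1), of UNIV] assms(2)]) simp

lemma ladder_rotate:
  assumes "helmholtz_ladder g" and e: "cmod e = 1"
  shows "helmholtz_ladder (\<lambda>n w. e powi n * g n (e * w))"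
  unfolding helmholtz_ladder_def
proof (intro allI)
  fix n w
  have e0: "e \<noteq> 0" using e by auto
  have ee: "e * cnj e = 1" using e by (simp add: complex_norm_square[symmetric])
  have "((\<lambda>w. e powi n * g n (e * w)) has_derivative
     (\<lambda>h. e powi n * (((e * h) * g (n + 1) (e * w) - cnj (e * h) * g (n - 1) (e * w)) / 2))) (at w)"
    by (intro has_derivative_mult_right
        has_derivative_compose[OF _ ladder_derivative[OF assms(1)], where f = "\<lambda>w. e * w"])
       (auto intro!: derivative_eq_intros)
  moreover have "e powi (n + 1) = e powi n * e" "e powi (n - 1) = e powi n * cnj e"
    using e0 ee by (simp_all add: power_int_add power_int_diff field_simps)
  ultimately show "((\<lambda>w. e powi n * g n (e * w)) has_derivative
     (\<lambda>h. (h * (e powi (n + 1) * g (n + 1) (e * w)) - cnj h * (e powi (n - 1) * g (n - 1) (e * w))) / 2)) (at w)"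
    by (simp add: algebra_simps)
qed

lemma ladder_diff_scale:
  assumes "helmholtz_ladder g" "helmholtz_ladder h"
  shows "helmholtz_ladder (\<lambda>n w. g n w - c * h n w)"
  unfolding helmholtz_ladder_def
proof (intro allI)
  fix n w
  show "((\<lambda>w. g n w - c * h n w) has_derivative
     (\<lambda>ha. (ha * (g (n + 1) w - c * h (n + 1) w) - cnj ha * (g (n - 1) w - c * h (n - 1) w)) / 2)) (at w)"
    by (rule has_derivative_eq_rhs[OF has_derivative_diff[OF ladder_derivative[OF assms(1)]
          has_derivative_mult_right[OF ladder_derivative[OF assms(2)], of c]]])
       (auto simp: field_simps)
qed

text \<open>The wave exp(i Re(exp(-i \<psi>) w)) times the n-th power of i exp(-i \<psi>), its
  eigenvalue under the raising operator. Writing the power as a phase covers negative n as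
  well.\<close>

definition plane_wave :: "real \<Rightarrow> int \<Rightarrow> complex \<Rightarrow> complex" where
  "plane_wave \<psi> n w = cis (of_int n * (pi / 2 - \<psi>) + Re (cis (- \<psi>) * w))"

lemma cis_has_derivative:
  assumes "(f has_derivative f') (at x within S)"
  shows "((\<lambda>x. cis (f x)) has_derivative (\<lambda>h. \<i> * of_real (f' h) * cis (f x))) (at x within S)"
  unfolding cis_conv_exp
  by (rule has_derivative_eq_rhs[OF has_derivative_compose[OF
        has_derivative_mult_right[OF has_derivative_of_real[OF assms]] DERIV_exp[unfolded has_field_derivative_def]]])
     (simp add: fun_eq_iff algebra_simps)

lemma plane_wave_step:
  "plane_wave \<psi> (n + 1) w = \<i> * cis (- \<psi>) * plane_wave \<psi> n w"
  "plane_wave \<psi> (n - 1) w = - \<i> * cis \<psi> * plane_wave \<psi> n w"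
proof -
  show "plane_wave \<psi> (n + 1) w = \<i> * cis (- \<psi>) * plane_wave \<psi> n w"
    unfolding plane_wave_def cis_pi_half[symmetric] cis_mult by (simp add: algebra_simps add_divide_distrib)
  have "- \<i> = cis (- pi / 2)" by simp
  then show "plane_wave \<psi> (n - 1) w = - \<i> * cis \<psi> * plane_wave \<psi> n w"
    unfolding plane_wave_def by (simp only: cis_mult) (simp add: algebra_simps diff_divide_distrib)
qed

lemma ladder_plane_wave: "helmholtz_ladder (plane_wave \<psi>)"
  unfolding helmholtz_ladder_def
proof (intro allI)
  fix n w
  have D: "(plane_wave \<psi> n has_derivative (\<lambda>h. \<i> * of_real (Re (cis (- \<psi>) * h)) * plane_wave \<psi> n w)) (at w)"
    unfolding plane_wave_def
    by (rule cis_has_derivative) (auto intro!: derivative_eq_intros)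
  show "(plane_wave \<psi> n has_derivative (\<lambda>h. (h * plane_wave \<psi> (n + 1) w - cnj h * plane_wave \<psi> (n - 1) w) / 2)) (at w)"
  proof (rule has_derivative_eq_rhs[OF D], rule ext)
    fix h
    have "cis (- \<psi>) * h + cnj (cis (- \<psi>) * h) = of_real (2 * Re (cis (- \<psi>) * h))"
      by (rule complex_add_cnj)
    then have "of_real (Re (cis (- \<psi>) * h)) = (cis (- \<psi>) * h + cis \<psi> * cnj h) / 2"
      by (simp add: cis_cnj)
    then show "\<i> * of_real (Re (cis (- \<psi>) * h)) * plane_wave \<psi> n w =
      (h * plane_wave \<psi> (n + 1) w - cnj h * plane_wave \<psi> (n - 1) w) / 2"
      unfolding plane_wave_step by (simp only:) (simp add: field_simps)
  qed
qed

text \<open>Raising the index lowers the angular frequency by one, so the factor cis((n - l) t)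
  selects in \<open>g n\<close> the frequency l - n, which comes from the frequency l of
  \<open>g 0\<close>. As a function of r this is a multiple of the Bessel function of order l -
  n.\<close>

definition angular_coeff :: "(int \<Rightarrow> complex \<Rightarrow> complex) \<Rightarrow> int \<Rightarrow> int \<Rightarrow> real \<Rightarrow> complex" where
  "angular_coeff g l n r = integral {0..2 * pi} (\<lambda>t. g n (of_real r * cis t) * cis (of_int (n - l) * t))"

lemma angular_integrable:
  assumes "helmholtz_ladder g"
  shows "(\<lambda>t. g n (of_real r * cis t) * cis (of_int m * t)) integrable_on {0..2 * pi}"
  by (intro integrable_continuous_interval continuous_intros ladder_continuous_on_compose[OF assms])

lemma angular_coeff_deriv:
  assumes g: "helmholtz_ladder g"
  shows "(angular_coeff g l n has_vector_derivative
     (angular_coeff g l (n + 1) r - angular_coeff g l (n - 1) r) / 2) (at r within S)"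
proof -
  let ?f = "\<lambda>r t. g n (of_real r * cis t) * cis (of_int (n - l) * t)"
  let ?f' = "\<lambda>r t. (g (n + 1) (of_real r * cis t) * cis (of_int (n + 1 - l) * t)
                   - g (n - 1) (of_real r * cis t) * cis (of_int (n - 1 - l) * t)) / 2"
  have "((\<lambda>r. integral (cbox 0 (2 * pi)) (?f r)) has_vector_derivative
          integral (cbox 0 (2 * pi)) (?f' r)) (at r within UNIV)"
  proof (rule leibniz_rule_vector_derivative)
    fix r t :: real
    have 1: "((\<lambda>r. g n (of_real r * cis t)) has_derivative
       (\<lambda>h. (of_real h * cis t * g (n + 1) (of_real r * cis t)
           - cnj (of_real h * cis t) * g (n - 1) (of_real r * cis t)) / 2)) (at r)"
      by (rule has_derivative_compose[OF _ ladder_derivative[OF g], where f = "\<lambda>r. of_real r * cis t"])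
         (auto intro!: derivative_eq_intros)
    have cs: "cis (of_int (n + 1 - l) * t) = cis t * cis (of_int (n - l) * t)"
      "cis (of_int (n - 1 - l) * t) = cnj (cis t) * cis (of_int (n - l) * t)"
      by (simp_all add: cis_mult cis_cnj algebra_simps)
    have e: "h *\<^sub>R ?f' r t = (of_real h * cis t * g (n + 1) (of_real r * cis t)
           - cnj (of_real h * cis t) * g (n - 1) (of_real r * cis t)) / 2 * cis (of_int (n - l) * t)" for h
      unfolding cs scaleR_conv_of_real complex_cnj_mult complex_cnj_complex_of_real by algebra
    show "((\<lambda>r. ?f r t) has_vector_derivative ?f' r t) (at r within UNIV)"
      unfolding has_vector_derivative_def e using has_derivative_mult_left[OF 1] by simp
  next
    show "?f r integrable_on cbox 0 (2 * pi)" for r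
      unfolding cbox_interval by (rule angular_integrable[OF g])
    show "continuous_on (UNIV \<times> cbox 0 (2 * pi)) (\<lambda>(r, t). ?f' r t)"
      unfolding split_beta by (intro continuous_intros ladder_continuous_on_compose[OF g]) auto
  qed auto
  moreover have "integral (cbox 0 (2 * pi)) (?f' r) =
      (angular_coeff g l (n + 1) r - angular_coeff g l (n - 1) r) / 2"
    unfolding angular_coeff_def
    using angular_integrable[OF g, of "n+1" r "n+1-l"] angular_integrable[OF g, of "n-1" r "n-1-l"]
    by (simp add: integral_diff)
  ultimately show ?thesis
    unfolding angular_coeff_def[abs_def] by (auto intro: has_vector_derivative_at_within)
qed

text \<open>The integrand of \<open>angular_coeff\<close> is periodic, so its derivative in t has
  integral 0; the product rule turns this into a three-term relation.\<close>

lemma angular_coeff_recurrence: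
  assumes g: "helmholtz_ladder g"
  shows "of_real r * (angular_coeff g l (n + 1) r + angular_coeff g l (n - 1) r) =
         2 * of_int (l - n) * angular_coeff g l n r"
proof -
  let ?A = "\<lambda>k t. g k (of_real r * cis t) * cis (of_int (k - l) * t)"
  let ?h = "\<lambda>t. \<i> * (of_real r / 2 * (?A (n + 1) t + ?A (n - 1) t) + of_int (n - l) * ?A n t)"
  have D: "(?A n has_vector_derivative ?h t) (at t within {0..2 * pi})" for t
  proof -
    have 1: "((\<lambda>t. g n (of_real r * cis t)) has_derivative
       (\<lambda>h. (of_real r * (\<i> * of_real h * cis t) * g (n + 1) (of_real r * cis t)
           - cnj (of_real r * (\<i> * of_real h * cis t)) * g (n - 1) (of_real r * cis t)) / 2)) (at t within {0..2 * pi})"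
      by (rule has_derivative_compose[OF _ ladder_derivative[OF g], where f = "\<lambda>t. of_real r * cis t"])
         (intro has_derivative_mult_right cis_has_derivative has_derivative_ident)
    have 2: "((\<lambda>t. cis (of_int (n - l) * t)) has_derivative
       (\<lambda>h. \<i> * of_real (of_int (n - l) * h) * cis (of_int (n - l) * t))) (at t within {0..2 * pi})"
      by (rule cis_has_derivative) (auto intro!: derivative_eq_intros)
    have cs: "cis (of_int (n + 1 - l) * t) = cis t * cis (of_int (n - l) * t)"
      "cis (of_int (n - 1 - l) * t) = cnj (cis t) * cis (of_int (n - l) * t)"
      by (simp_all add: cis_mult cis_cnj algebra_simps)
    have "h *\<^sub>R ?h t = g n (of_real r * cis t) * (\<i> * of_real (of_int (n - l) * h) * cis (of_int (n - l) * t))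
        + (of_real r * (\<i> * of_real h * cis t) * g (n + 1) (of_real r * cis t)
           - cnj (of_real r * (\<i> * of_real h * cis t)) * g (n - 1) (of_real r * cis t)) / 2 * cis (of_int (n - l) * t)" for h
      unfolding cs scaleR_conv_of_real complex_cnj_mult complex_cnj_complex_of_real complex_cnj_i
        of_real_mult of_real_of_int_eq by algebra
    then show ?thesis
      unfolding has_vector_derivative_def using has_derivative_mult[OF 1 2] by simp
  qed
  have "(?h has_integral (?A n (2 * pi) - ?A n 0)) {0..2 * pi}"
    by (rule fundamental_theorem_of_calculus) (use D in auto)
  moreover have "cis (of_int (n - l) * (2 * pi)) = 1"
    by (metis cis_multiple_2pi Ints_of_int mult.commute)
  ultimately have "(?h has_integral 0) {0..2 * pi}" by simp
  moreover have "(?h has_integral (\<i> * (of_real r / 2 * (angular_coeff g l (n + 1) r + angular_coeff g l (n - 1) r)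
       + of_int (n - l) * angular_coeff g l n r))) {0..2 * pi}"
    unfolding angular_coeff_def
    by (intro has_integral_mult_right has_integral_add integrable_integral angular_integrable[OF g])
  ultimately have "\<i> * (of_real r / 2 * (angular_coeff g l (n + 1) r + angular_coeff g l (n - 1) r)
       + of_int (n - l) * angular_coeff g l n r) = 0"
    by (rule has_integral_unique[symmetric])
  then have "of_real r / 2 * (angular_coeff g l (n + 1) r + angular_coeff g l (n - 1) r)
       + of_int (n - l) * angular_coeff g l n r = 0"
    using complex_i_not_zero mult_eq_0_iff by blast
  then show ?thesis by (simp add: field_simps)
qed

text \<open>The recurrences are those of the Bessel functions; regularity at the origin comes in through
  the energy \<open>|q\<^sub>l|\<^sup>2 + |q\<^sub>l\<^sub>+\<^sub>1|\<^sup>2\<close>, which is nonincreasing in \<open>r\<close>.\<close>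

lemma angular_coeff_eq_0:
  assumes g: "helmholtz_ladder g" and g0: "g l 0 = 0" and r: "0 \<le> r"
  shows "angular_coeff g l n r = 0"
proof -
  let ?q = "angular_coeff g l"
  note rec = angular_coeff_recurrence[OF g, where l = l]
  \<comment> \<open>Only the mode of frequency 0, that is n = l, can survive at the origin, and its
    value there is a multiple of \<open>g l 0\<close>.\<close>
  have at0: "?q n 0 = 0" for n
  proof (cases "n = l")
    case True
    then show ?thesis using g0 by (simp add: angular_coeff_def)
  next
    case False
    then show ?thesis using rec[of 0 n] by simp
  qed
  have low: "?q l r = 0 \<and> ?q (l + 1) r = 0" if "r \<ge> 0" for r
  proof -
    define en where "en = (\<lambda>r. ?q l r \<bullet> ?q l r + ?q (l + 1) r \<bullet> ?q (l + 1) r)"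
    have "en r \<le> en 0"
    proof (rule DERIV_nonpos_imp_nonincreasing[OF that])
      fix x assume x: "0 \<le> x" "x \<le> r"
      let ?d = "\<lambda>n. (?q (n + 1) x - ?q (n - 1) x) / 2"
      have hd: "(?q n has_derivative (\<lambda>h. h *\<^sub>R ?d n)) (at x)" for n
        using angular_coeff_deriv[OF g] unfolding has_vector_derivative_def by blast
      have "(en has_derivative (\<lambda>h. h * (2 * (?q l x \<bullet> ?d l) + 2 * (?q (l + 1) x \<bullet> ?d (l + 1))))) (at x)"
        unfolding en_def
        by (rule has_derivative_eq_rhs[OF has_derivative_add[OF has_derivative_inner[OF hd hd]
              has_derivative_inner[OF hd hd]]])
           (simp add: fun_eq_iff inner_commute algebra_simps)
      then have D: "(en has_real_derivative (2 * (?q l x \<bullet> ?d l) + 2 * (?q (l + 1) x \<bullet> ?d (l + 1)))) (at x)"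
        by (rule has_derivative_imp_has_field_derivative) simp
      \<comment> \<open>For x > 0 the recurrence at l gives q_(l-1) = - q_(l+1), and the one at l +
        1 eliminates q_(l+2). The cross terms cancel and -(2/x) |q_(l+1)|^2 remains.\<close>
      have "2 * (?q l x \<bullet> ?d l) + 2 * (?q (l + 1) x \<bullet> ?d (l + 1)) \<le> 0"
      proof (cases "x = 0")
        case True
        then show ?thesis using at0 by simp
      next
        case False
        then have xp: "x > 0" using x by simp
        have "?q (l - 1) x = - ?q (l + 1) x"
          using rec[of x l] xp by (simp add: add_eq_0_iff)
        then have 1: "?d l = ?q (l + 1) x" by simp
        have "of_real x * (?q (l + 1 + 1) x + ?q l x) = - 2 * ?q (l + 1) x"
          using rec[of x "l + 1"] by simp
        then have "?q (l + 1 + 1) x + ?q l x = (- 2 / x) *\<^sub>R ?q (l + 1) x"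
          using xp by (simp add: scaleR_conv_of_real field_simps)
        then have "?q (l + 1 + 1) x = (- 2 / x) *\<^sub>R ?q (l + 1) x - ?q l x"
          by (simp add: eq_diff_eq)
        then have 2: "?d (l + 1) = (- 1 / x) *\<^sub>R ?q (l + 1) x - ?q l x"
          by (simp add: scaleR_conv_of_real field_simps)
        have "2 * (?q l x \<bullet> ?d l) + 2 * (?q (l + 1) x \<bullet> ?d (l + 1))
            = - 2 / x * (?q (l + 1) x \<bullet> ?q (l + 1) x)"
          unfolding 1 2 by (simp add: inner_diff_right inner_commute)
        also have "\<dots> \<le> 0" using xp by (simp add: mult_nonpos_nonneg divide_nonpos_pos)
        finally show ?thesis .
      qed
      with D show "\<exists>y. (en has_real_derivative y) (at x) \<and> y \<le> 0" by blast
    qed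
    moreover have "en 0 = 0" unfolding en_def using at0 by simp
    ultimately have "en r \<le> 0" by simp
    then have "?q l r \<bullet> ?q l r = 0 \<and> ?q (l + 1) r \<bullet> ?q (l + 1) r = 0"
      unfolding en_def using inner_ge_zero[of "?q l r"] inner_ge_zero[of "?q (l + 1) r"] by linarith
    then show ?thesis by simp
  qed
  show ?thesis
  proof (cases "r = 0")
    case True
    then show ?thesis using at0 by simp
  next
    case False
    then have rp: "r > 0" using r by simp
    \<comment> \<open>Two adjacent modes vanish, and for r > 0 the three-term recurrence propagates
      this in both directions.\<close>
    have up: "?q (l + int k) r = 0 \<and> ?q (l + int k + 1) r = 0" for k
    proof (induction k)
      case 0
      then show ?case using low[OF r] by simp
    next
      case (Suc k)
      then show ?case using rec[of r "l + int k + 1"] rp by (simp add: algebra_simps)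
    qed
    have down: "?q (l - int k) r = 0 \<and> ?q (l - int k + 1) r = 0" for k
    proof (induction k)
      case 0
      then show ?case using low[OF r] by simp
    next
      case (Suc k)
      then show ?case using rec[of r "l - int k"] rp by (simp add: algebra_simps)
    qed
    show ?thesis
    proof (cases "n \<ge> l")
      case True
      then show ?thesis using up[of "nat (n - l)"] by simp
    next
      case False
      then show ?thesis using down[of "nat (l - n)"] by simp
    qed
  qed
qed

section \<open>Fejer means over rotations\<close>

lemma Re_mult_of_real_cis: "Re (of_real r * cis t) = r * cos t"
  by simp

definition fejer :: "nat \<Rightarrow> real \<Rightarrow> real" where
  "fejer D t = (cmod (\<Sum>j\<le>D. cis (real j * t)))\<^sup>2 / real (D + 1)"

lemma fejer_nonneg: "fejer D t \<ge> 0"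
  by (simp add: fejer_def)

text \<open>The sum stays indexed by pairs of exponents and is not collected by frequency: a product
  of such kernels then expands over functions into the set of pairs.\<close>

lemma fejer_expand:
  "complex_of_real (fejer D t) =
     (\<Sum>p\<in>{..D} \<times> {..D}. cis (of_int (int (fst p) - int (snd p)) * t)) / of_nat (D + 1)"
proof -
  have "complex_of_real ((cmod (\<Sum>j\<le>D. cis (real j * t)))\<^sup>2) =
      (\<Sum>j\<le>D. cis (real j * t)) * (\<Sum>j\<le>D. cis (- (real j * t)))"
    by (simp only: complex_norm_square cnj_sum cis_cnj)
  also have "\<dots> = (\<Sum>i\<le>D. \<Sum>j\<le>D. cis (of_int (int i - int j) * t))"
    unfolding sum_product cis_mult by (simp add: algebra_simps)
  finally show ?thesis
    by (simp add: fejer_def sum.cartesian_product split_beta)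
qed

text \<open>The Fourier coefficient max(0, 1 - |m|/(D+1)) of the kernel, as a normalised count of
  pairs with difference m.\<close>

definition fejer_coeff :: "nat \<Rightarrow> int \<Rightarrow> real" where
  "fejer_coeff D m = (\<Sum>p\<in>{..D} \<times> {..D}. of_bool (int (fst p) - int (snd p) = m)) / real (D + 1)"

lemma fejer_coeff_nat: "fejer_coeff D (int m) = real (D + 1 - m) / real (D + 1)"
proof -
  have "(\<Sum>p\<in>{..D} \<times> {..D}. of_bool (int (fst p) - int (snd p) = int m)) =
      (\<Sum>j\<le>D. \<Sum>i\<le>D. of_bool (int i - int j = int m) :: real)"
    by (subst sum.swap) (simp only: sum.cartesian_product case_prod_unfold)
  also have "\<dots> = (\<Sum>j\<le>D. of_bool (j + m \<le> D))"
  proof (rule sum.cong[OF refl])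
    fix j assume "j \<in> {..D}"
    have "(\<Sum>i\<le>D. of_bool (int i - int j = int m) :: real) = (\<Sum>i\<le>D. if i = j + m then 1 else 0)"
      by (rule sum.cong) auto
    then show "(\<Sum>i\<le>D. of_bool (int i - int j = int m)) = (of_bool (j + m \<le> D) :: real)"
      by (simp add: sum.delta)
  qed
  also have "\<dots> = real (card {j. j \<le> D \<and> j + m \<le> D})"
    by (simp add: of_bool_def sum.If_cases Int_def)
  also have "{j. j \<le> D \<and> j + m \<le> D} = {..<D + 1 - m}" by auto
  finally show ?thesis by (simp add: fejer_coeff_def)
qed

lemma fejer_coeff_minus: "fejer_coeff D (- m) = fejer_coeff D m"
  unfolding fejer_coeff_def
  by (rule arg_cong[where f = "\<lambda>x. x / _"], rule sum.reindex_bij_witness[of _ prod.swap prod.swap]) auto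

lemma integral_cis:
  "((\<lambda>t. cis (of_int m * t)) has_integral of_real (2 * pi * of_bool (m = 0))) {0..2 * pi}"
proof (cases "m = 0")
  case True
  have "((\<lambda>t. 1 :: complex) has_integral of_real (2 * pi)) {0..2 * pi}"
    using has_integral_const_real[of "1::complex" 0 "2 * pi"] by (simp add: scaleR_conv_of_real)
  then show ?thesis using True by simp
next
  case False
  have "((\<lambda>t. cis (of_int m * t)) has_integral
      (cis (of_int m * (2 * pi)) / (\<i> * of_int m) - cis (of_int m * 0) / (\<i> * of_int m))) {0..2 * pi}"
  proof (rule fundamental_theorem_of_calculus)
    fix t :: real
    have "((\<lambda>t. cis (of_int m * t)) has_derivative
       (\<lambda>h. \<i> * of_real (of_int m * h) * cis (of_int m * t))) (at t within {0..2 * pi})"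
      by (rule cis_has_derivative) (auto intro!: derivative_eq_intros)
    from has_derivative_divide'[OF this has_derivative_const, of "\<i> * of_int m"]
    show "((\<lambda>t. cis (of_int m * t) / (\<i> * of_int m)) has_vector_derivative cis (of_int m * t)) (at t within {0..2 * pi})"
      using False unfolding has_vector_derivative_def by (simp add: scaleR_conv_of_real field_simps)
  qed simp
  moreover have "cis (of_int m * (2 * pi)) = 1"
    by (metis cis_multiple_2pi Ints_of_int mult.commute)
  ultimately show ?thesis using False by simp
qed

lemma continuous_on_fejer [continuous_intros]:
  assumes "continuous_on S f" shows "continuous_on S (\<lambda>x. fejer D (f x))"
  unfolding fejer_def by (intro continuous_intros assms) auto

lemma fejer_integral_cis:
  "((\<lambda>t. of_real (fejer D t) * cis (of_int m * t)) has_integral of_real (2 * pi * fejer_coeff D (- m))) {0..2 * pi}"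
proof -
  have "((\<lambda>t. (\<Sum>p\<in>{..D} \<times> {..D}. cis (of_int (int (fst p) - int (snd p) + m) * t)) / of_nat (D + 1)) has_integral
     (\<Sum>p\<in>{..D} \<times> {..D}. of_real (2 * pi * of_bool (int (fst p) - int (snd p) + m = 0))) / of_nat (D + 1)) {0..2 * pi}"
    by (intro has_integral_divide has_integral_sum integral_cis) auto
  also have "(\<lambda>t. (\<Sum>p\<in>{..D} \<times> {..D}. cis (of_int (int (fst p) - int (snd p) + m) * t)) / of_nat (D + 1))
     = (\<lambda>t. of_real (fejer D t) * cis (of_int m * t))"
    unfolding fejer_expand
    by (simp only: of_int_add distrib_right cis_mult[symmetric] sum_distrib_right[symmetric] times_divide_eq_left)
  also have "(\<Sum>p\<in>{..D} \<times> {..D}. of_real (2 * pi * of_bool (int (fst p) - int (snd p) + m = 0))) / of_nat (D + 1)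
     = complex_of_real (2 * pi * fejer_coeff D (- m))"
    unfolding fejer_coeff_def eq_neg_iff_add_eq_0
    by (simp only: of_real_mult of_real_divide of_real_sum sum_distrib_left times_divide_eq_right
        of_real_of_nat_eq)
  finally show ?thesis .
qed

text \<open>The second integral measures the concentration at t = 0: 1 - cos t is half of |cis t -
  1|^2, so it takes the place of a tail estimate. It is read off from the coefficients 1 and D/(D+1)
  at the frequencies 0 and 1.\<close>

lemma fejer_integrals:
  "(fejer D has_integral 2 * pi) {0..2 * pi}"
  "((\<lambda>t. fejer D t * (1 - cos t)) has_integral 2 * pi / real (D + 1)) {0..2 * pi}"
proof -
  have 1: "((\<lambda>t. Re (of_real (fejer D t) * cis (of_int m * t))) has_integral
      Re (of_real (2 * pi * fejer_coeff D (- m)))) {0..2 * pi}" for m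
    by (rule has_integral_Re[OF fejer_integral_cis])
  show 2: "(fejer D has_integral 2 * pi) {0..2 * pi}"
    using 1[of 0] fejer_coeff_nat[of D 0] by (simp add: fejer_coeff_minus)
  have "((\<lambda>t. fejer D t * cos t) has_integral 2 * pi * (real D / real (D + 1))) {0..2 * pi}"
    using 1[of 1] fejer_coeff_nat[of D 1] fejer_coeff_minus[of D 1] by simp
  from has_integral_diff[OF 2 this]
  show "((\<lambda>t. fejer D t * (1 - cos t)) has_integral 2 * pi / real (D + 1)) {0..2 * pi}"
    by (rule has_integral_eq_rhs[OF has_integral_eq[rotated]]) (auto simp: field_simps)
qed

lemma plane_wave_rotate: "plane_wave 0 n (cis t * w) * cis (of_int n * t) = plane_wave (- t) n w"
  by (simp add: plane_wave_def cis_mult algebra_simps)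

text \<open>An angular mode is determined by the single number \<open>g l 0\<close>. Subtracting the
  multiple \<open>c\<close> of a plane wave with the same value there leaves a ladder whose mode l
  vanishes throughout. The rotation by \<open>Arg w\<close> brings w to the nonnegative real axis,
  where the circles of \<open>angular_coeff\<close> start.\<close>

lemma ladder_angular_eq_plane_wave:
  fixes l :: int
  assumes g: "helmholtz_ladder g"
  defines "c \<equiv> g l 0 * cis (- (of_int l * pi / 2))"
  shows "integral {0..2 * pi} (\<lambda>t. g n (cis t * w) * cis (of_int (n - l) * t)) =
         integral {0..2 * pi} (\<lambda>t. c * cis (of_int (- l) * t) * plane_wave (- t) n w)"
proof -
  define e where "e = cis (Arg w)"
  have e: "cmod e = 1" "e \<noteq> 0" by (simp_all add: e_def)
  have w: "e * (of_real (cmod w) * cis t) = cis t * w" for t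
    using rcis_cmod_Arg[of w] by (simp add: e_def rcis_def mult_ac)
  let ?h = "\<lambda>n w. g n w - c * plane_wave 0 n w"
  have h: "helmholtz_ladder ?h" by (rule ladder_diff_scale[OF g ladder_plane_wave])
  have "angular_coeff (\<lambda>n w. e powi n * ?h n (e * w)) l n (cmod w) = 0"
  proof (rule angular_coeff_eq_0[OF ladder_rotate[OF h e(1)]])
    have "cis (- (of_int l * pi / 2)) * plane_wave 0 l 0 = 1"
      by (simp add: plane_wave_def cis_mult)
    then show "e powi l * ?h l (e * 0) = 0" by (simp add: c_def mult.assoc)
  qed simp
  then have "integral {0..2 * pi} (\<lambda>t. e powi n * (?h n (cis t * w) * cis (of_int (n - l) * t))) = 0"
    unfolding angular_coeff_def by (simp only: w mult.assoc)
  then have "integral {0..2 * pi} (\<lambda>t. ?h n (cis t * w) * cis (of_int (n - l) * t)) = 0"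
    using e(2) by simp
  also have "(\<lambda>t. ?h n (cis t * w) * cis (of_int (n - l) * t)) =
     (\<lambda>t. g n (cis t * w) * cis (of_int (n - l) * t) - c * cis (of_int (- l) * t) * plane_wave (- t) n w)"
  proof
    fix t
    have "cis (of_int (n - l) * t) = cis (of_int (- l) * t) * cis (of_int n * t)"
      by (simp add: cis_mult algebra_simps)
    then show "?h n (cis t * w) * cis (of_int (n - l) * t) =
       g n (cis t * w) * cis (of_int (n - l) * t) - c * cis (of_int (- l) * t) * plane_wave (- t) n w"
      unfolding plane_wave_rotate[symmetric] by (simp add: algebra_simps)
  qed
  also have "integral {0..2 * pi} \<dots> = integral {0..2 * pi} (\<lambda>t. g n (cis t * w) * cis (of_int (n - l) * t))
      - integral {0..2 * pi} (\<lambda>t. c * cis (of_int (- l) * t) * plane_wave (- t) n w)"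
    unfolding plane_wave_def
    by (intro integral_diff integrable_continuous_interval continuous_intros ladder_continuous_on_compose[OF g])
  finally show ?thesis by simp
qed

text \<open>Formally, \<open>g\<close> is the superposition of plane waves whose density has the
  Fourier coefficients g_l(0) i^(-l). For a general solution this series need not converge, so its
  Fejer mean is taken; collecting the pairs by their difference l produces the weights
  \<open>fejer_coeff\<close>.\<close>

definition fejer_density :: "(int \<Rightarrow> complex \<Rightarrow> complex) \<Rightarrow> nat \<Rightarrow> real \<Rightarrow> complex" where
  "fejer_density g D t = (\<Sum>p\<in>{..D} \<times> {..D}. let l = int (snd p) - int (fst p)
     in g l 0 * cis (- (of_int l * pi / 2)) * cis (of_int (- l) * t)) / of_nat (D + 1)"

text \<open>Each frequency of the kernel selects one angular mode, and each mode may be exchanged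
  for that of a plane wave, on which a rotation merely changes the direction.\<close>

lemma fejer_mean_eq_plane_waves:
  assumes g: "helmholtz_ladder g"
  shows "integral {0..2 * pi} (\<lambda>t. of_real (fejer D t) * (cis (of_int n * t) * g n (cis t * w))) =
         integral {0..2 * pi} (\<lambda>t. fejer_density g D t * plane_wave (- t) n w)"
proof -
  let ?l = "\<lambda>p::nat \<times> nat. int (snd p) - int (fst p)"
  have "(\<lambda>t. of_real (fejer D t) * (cis (of_int n * t) * g n (cis t * w))) =
     (\<lambda>t. (\<Sum>p\<in>{..D} \<times> {..D}. g n (cis t * w) * cis (of_int (n - ?l p) * t)) / of_nat (D + 1))"
  proof
    fix t
    have "cis (of_int (n - ?l p) * t) = cis (of_int (int (fst p) - int (snd p)) * t) * cis (of_int n * t)" for p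
      by (simp add: cis_mult algebra_simps)
    then show "of_real (fejer D t) * (cis (of_int n * t) * g n (cis t * w)) =
       (\<Sum>p\<in>{..D} \<times> {..D}. g n (cis t * w) * cis (of_int (n - ?l p) * t)) / of_nat (D + 1)"
      unfolding fejer_expand by (simp only: times_divide_eq_left times_divide_eq_right sum_distrib_left sum_distrib_right mult_ac)
  qed
  then have "integral {0..2 * pi} (\<lambda>t. of_real (fejer D t) * (cis (of_int n * t) * g n (cis t * w))) =
      (\<Sum>p\<in>{..D} \<times> {..D}. integral {0..2 * pi} (\<lambda>t. g n (cis t * w) * cis (of_int (n - ?l p) * t))) / of_nat (D + 1)"
    by (simp only: integral_divide) (subst integral_sum,
       auto intro!: integrable_continuous_interval continuous_intros ladder_continuous_on_compose[OF g])
  also have "\<dots> = (\<Sum>p\<in>{..D} \<times> {..D}. integral {0..2 * pi}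
       (\<lambda>t. g (?l p) 0 * cis (- (of_int (?l p) * pi / 2)) * cis (of_int (- ?l p) * t) * plane_wave (- t) n w)) / of_nat (D + 1)"
    by (simp only: ladder_angular_eq_plane_wave[OF g])
  also have "\<dots> = integral {0..2 * pi} (\<lambda>t. (\<Sum>p\<in>{..D} \<times> {..D}.
        g (?l p) 0 * cis (- (of_int (?l p) * pi / 2)) * cis (of_int (- ?l p) * t) * plane_wave (- t) n w) / of_nat (D + 1))"
    by (simp only: integral_divide, subst integral_sum)
       (auto simp: plane_wave_def intro!: integrable_continuous_interval continuous_intros)
  finally show ?thesis
    by (simp only: fejer_density_def Let_def sum_distrib_right times_divide_eq_left)
qed

section \<open>Discretisation of the superposition and convergence of the Fejer means\<close>

lemma norm_integral_riemann_sum_le: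
  fixes f :: "real \<Rightarrow> complex"
  assumes cont: "continuous_on {0..T} f" and h: "h > 0" and m: "real m * h \<le> T"
    and e: "\<And>j t. j < m \<Longrightarrow> real j * h \<le> t \<Longrightarrow> t \<le> real (Suc j) * h \<Longrightarrow> cmod (f t - f (real j * h)) \<le> e"
  shows "cmod (integral {0..real m * h} f - h * (\<Sum>j<m. f (real j * h))) \<le> real m * h * e"
  using m e
proof (induction m)
  case 0
  then show ?case by simp
next
  case (Suc m)
  let ?a = "real m * h" and ?b = "real (Suc m) * h"
  have ab: "0 \<le> ?a" "?a \<le> ?b" using h by (auto simp: algebra_simps)
  have int: "f integrable_on {x..y}" if "0 \<le> x" "y \<le> ?b" for x y
    using that Suc.prems(1) by (intro integrable_continuous_interval continuous_on_subset[OF cont]) auto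
  have "integral {0..?b} f = integral {0..?a} f + integral {?a..?b} f"
    using ab int by (intro Henstock_Kurzweil_Integration.integral_combine[symmetric]) auto
  moreover have "integral {?a..?b} f - h * f ?a = integral {?a..?b} (\<lambda>t. f t - f ?a)"
    using ab int[of ?a ?b] h by (subst integral_diff) (auto simp: scaleR_conv_of_real algebra_simps)
  moreover have "cmod (integral {?a..?b} (\<lambda>t. f t - f ?a)) \<le> e * (?b - ?a)"
    using ab Suc.prems by (intro integral_bound continuous_intros continuous_on_subset[OF cont]) auto
  moreover have "cmod (integral {0..?a} f - h * (\<Sum>j<m. f (real j * h))) \<le> ?a * e"
    using Suc.prems ab by (intro Suc.IH) auto
  ultimately have "cmod (integral {0..?b} f - h * (\<Sum>j<Suc m. f (real j * h))) \<le> ?a * e + e * (?b - ?a)"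
    using norm_triangle_ineq[of "integral {0..?a} f - h * (\<Sum>j<m. f (real j * h))" "integral {?a..?b} f - h * f ?a"]
    by (simp add: algebra_simps)
  then show ?case by (simp add: algebra_simps)
qed

lemma uniform_riemann_sum:
  fixes H :: "real \<Rightarrow> complex \<Rightarrow> complex"
  assumes cont: "continuous_on ({0..2 * pi} \<times> C) (\<lambda>(t, w). H t w)" and C: "compact C" and "\<epsilon> > 0"
  shows "\<forall>\<^sub>F Q in sequentially. \<forall>w\<in>C.
     cmod (integral {0..2 * pi} (\<lambda>t. H t w) - (2 * pi / Q) * (\<Sum>j<Q. H (2 * pi * j / Q) w)) \<le> \<epsilon>"
proof -
  have "uniformly_continuous_on ({0..2 * pi} \<times> C) (\<lambda>(t, w). H t w)"
    by (intro compact_uniformly_continuous cont compact_Times C) auto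
  moreover have e: "\<epsilon> / (2 * pi) > 0" using \<open>\<epsilon> > 0\<close> by simp
  ultimately obtain d where d: "d > 0" and
    D: "\<And>t w t' w'. t \<in> {0..2 * pi} \<Longrightarrow> w \<in> C \<Longrightarrow> t' \<in> {0..2 * pi} \<Longrightarrow> w' \<in> C \<Longrightarrow>
        dist (t', w') (t, w) < d \<Longrightarrow> dist (H t' w') (H t w) < \<epsilon> / (2 * pi)"
    unfolding uniformly_continuous_on_def by (metis (no_types, lifting) SigmaI case_prod_conv)
  obtain Q0 where Q0: "real Q0 > 2 * pi / d" "Q0 > 0"
    using reals_Archimedean2[of "2 * pi / d"] d by (metis divide_pos_pos less_trans of_nat_0_less_iff pi_gt_zero zero_less_mult_iff zero_less_numeral)
  show ?thesis
    unfolding eventually_sequentially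
  proof (intro exI[of _ Q0] allI impI ballI)
    fix Q w assume Q: "Q0 \<le> Q" and w: "w \<in> C"
    let ?h = "2 * pi / real Q"
    have Qp: "real Q > 2 * pi / d" "Q > 0" using Q Q0 by linarith+
    have hd: "?h < d" "?h > 0" using Qp d by (auto simp: field_simps)
    have Qh: "real Q * ?h = 2 * pi" using Qp by simp
    have "cmod (integral {0..real Q * ?h} (\<lambda>t. H t w) - ?h * (\<Sum>j<Q. H (real j * ?h) w)) \<le> real Q * ?h * (\<epsilon> / (2 * pi))"
    proof (rule norm_integral_riemann_sum_le[where T = "2 * pi"])
      show "continuous_on {0..2 * pi} (\<lambda>t. H t w)"
      proof -
        have "continuous_on {0..2 * pi} (\<lambda>t. case (t, w) of (t, w) \<Rightarrow> H t w)"
          by (rule continuous_on_compose2[OF cont]) (use w in \<open>auto intro!: continuous_intros\<close>)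
        then show ?thesis by simp
      qed
      show "0 < ?h" by (rule hd)
      show "real Q * ?h \<le> 2 * pi" using Qh by simp
      fix j t assume j: "j < Q" and t: "real j * ?h \<le> t" "t \<le> real (Suc j) * ?h"
      have "real (Suc j) * ?h \<le> real Q * ?h" using j hd by (intro mult_right_mono) auto
      then have "t \<in> {0..2 * pi}" "real j * ?h \<in> {0..2 * pi}"
        using t Qh hd by (auto intro: order_trans[OF _ t(1)])
      moreover have "dist (t, w) (real j * ?h, w) < d"
      proof -
        have "t \<le> real j * ?h + ?h" using t(2) by (simp add: algebra_simps add_divide_distrib)
        then show ?thesis using t(1) hd by (simp add: dist_Pair_Pair dist_real_def)
      qed
      ultimately show "cmod (H t w - H (real j * ?h) w) \<le> \<epsilon> / (2 * pi)"
        using D[of "real j * ?h" w t w] w by (simp add: dist_norm)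
    qed
    then show "cmod (integral {0..2 * pi} (\<lambda>t. H t w) - of_real ?h * (\<Sum>j<Q. H (2 * pi * real j / real Q) w)) \<le> \<epsilon>"
      unfolding Qh by (simp add: mult_ac)
  qed
qed

text \<open>The kernel is an approximate identity on the rotations, and e^(int) g_n(e^(it) w)
  depends continuously on the rotation, with value g_n(w) at t = 0; compactness makes this uniform
  in w.\<close>

lemma fejer_mean_tendsto:
  assumes g: "helmholtz_ladder g" and "\<epsilon> > 0"
  shows "\<forall>\<^sub>F D in sequentially. \<forall>w\<in>cball 0 R.
     cmod (integral {0..2 * pi} (\<lambda>t. of_real (fejer D t) * (cis (of_int n * t) * g n (cis t * w))) / (2 * pi) - g n w) \<le> \<epsilon>"
proof -
  let ?S = "sphere 0 1 \<times> cball 0 R :: (complex \<times> complex) set"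
  let ?G = "\<lambda>p. fst p powi n * g n (fst p * snd p)"
  have cG: "continuous_on ?S ?G"
    by (intro continuous_intros ladder_continuous_on_compose[OF g]) auto
  have "compact ?S" by (intro compact_Times) auto
  then have "uniformly_continuous_on ?S ?G" and "compact (?G ` ?S)"
    using cG by (auto intro: compact_uniformly_continuous compact_continuous_image)
  then obtain d B where d: "d > 0" and B: "\<And>p. p \<in> ?S \<Longrightarrow> cmod (?G p) \<le> B"
    and D: "\<And>p p'. p \<in> ?S \<Longrightarrow> p' \<in> ?S \<Longrightarrow> dist p' p < d \<Longrightarrow> dist (?G p') (?G p) < \<epsilon> / 2"
    using compact_imp_bounded[of "?G ` ?S"] \<open>\<epsilon> > 0\<close>
    unfolding uniformly_continuous_on_def bounded_iff
    by (metis (no_types, lifting) half_gt_zero imageI)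
  \<comment> \<open>Chosen so that M (1 - cos t) \<ge> 2 |B| as soon as |cis t - 1| \<ge> d, because
    |cis t - 1|^2 = 2 (1 - cos t). One bound then holds for all t and can be integrated against the
    kernel.\<close>
  define M where "M = 4 * \<bar>B\<bar> / d\<^sup>2"
  have M0: "M \<ge> 0" by (simp add: M_def)
  obtain D0 where D0: "real D0 > M / (\<epsilon> / 2)" using reals_Archimedean2 by blast
  show ?thesis
    unfolding eventually_sequentially
  proof (intro exI[of _ D0] allI impI ballI)
    fix D w assume DD: "D0 \<le> D" and w: "w \<in> cball (0::complex) R"
    let ?f = "\<lambda>t. cis (of_int n * t) * g n (cis t * w)"
    have fG: "?f t = ?G (cis t, w)" for t by (simp add: Complex.DeMoivre2 cis_power_int)
    have f0: "g n w = ?G (1, w)" by simp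
    have bd: "cmod (?f t - g n w) \<le> \<epsilon> / 2 + M * (1 - cos t)" for t
    proof (cases "cmod (cis t - 1) < d")
      case True
      then have "dist (?G (cis t, w)) (?G (1, w)) < \<epsilon> / 2"
        using w by (intro D) (auto simp: dist_Pair_Pair dist_norm)
      moreover have "M * (1 - cos t) \<ge> 0" using M0 by simp
      ultimately show ?thesis by (simp add: fG dist_norm)
    next
      case False
      have "(cmod (cis t - 1))\<^sup>2 = (cos t - 1)\<^sup>2 + (sin t)\<^sup>2" by (simp add: cmod_power2)
      also have "\<dots> = 2 * (1 - cos t)"
        using sin_cos_squared_add[of t] by (simp add: power2_eq_square algebra_simps)
      finally have "d\<^sup>2 \<le> 2 * (1 - cos t)" using False d by (metis linorder_not_less power_mono less_imp_le)
      then have "2 * \<bar>B\<bar> \<le> M * (1 - cos t)"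
        using d mult_left_mono[of "d\<^sup>2" "2 * (1 - cos t)" "\<bar>B\<bar>"] by (simp add: M_def field_simps)
      moreover have "cmod (?f t - g n w) \<le> 2 * \<bar>B\<bar>"
        unfolding fG using norm_triangle_ineq4[of "?G (cis t, w)" "?G (1, w)"]
          B[of "(cis t, w)"] B[of "(1, w)"] w by simp
      ultimately show ?thesis using \<open>\<epsilon> > 0\<close> by simp
    qed
    have int: "(\<lambda>t. of_real (fejer D t) * ?f t) integrable_on {0..2 * pi}"
      by (intro integrable_continuous_interval continuous_intros ladder_continuous_on_compose[OF g])
    have int2: "((\<lambda>t. of_real (fejer D t) * g n w) has_integral of_real (2 * pi) * g n w) {0..2 * pi}"
      by (intro has_integral_mult_left has_integral_of_real fejer_integrals)
    have int3: "((\<lambda>t. \<epsilon> / 2 * fejer D t + M * (fejer D t * (1 - cos t))) has_integral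
        (\<epsilon> / 2 * (2 * pi) + M * (2 * pi / real (D + 1)))) {0..2 * pi}"
      by (intro has_integral_add has_integral_mult_right fejer_integrals)
    have "cmod (integral {0..2 * pi} (\<lambda>t. of_real (fejer D t) * ?f t) - of_real (2 * pi) * g n w)
        = cmod (integral {0..2 * pi} (\<lambda>t. of_real (fejer D t) * ?f t - of_real (fejer D t) * g n w))"
      by (simp only: integral_diff[OF int has_integral_integrable[OF int2]] integral_unique[OF int2])
    also have "\<dots> \<le> integral {0..2 * pi} (\<lambda>t. \<epsilon> / 2 * fejer D t + M * (fejer D t * (1 - cos t)))"
    proof (rule integral_norm_bound_integral)
      show "(\<lambda>t. of_real (fejer D t) * ?f t - of_real (fejer D t) * g n w) integrable_on {0..2 * pi}"
        by (intro integrable_diff int has_integral_integrable[OF int2])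
      show "(\<lambda>t. \<epsilon> / 2 * fejer D t + M * (fejer D t * (1 - cos t))) integrable_on {0..2 * pi}"
        by (rule has_integral_integrable[OF int3])
      fix t
      have "cmod (of_real (fejer D t) * ?f t - of_real (fejer D t) * g n w) = fejer D t * cmod (?f t - g n w)"
        using fejer_nonneg[of D t] by (metis norm_mult norm_of_real abs_of_nonneg right_diff_distrib)
      also have "\<dots> \<le> fejer D t * (\<epsilon> / 2 + M * (1 - cos t))"
        using bd fejer_nonneg by (intro mult_left_mono)
      finally show "cmod (of_real (fejer D t) * ?f t - of_real (fejer D t) * g n w)
          \<le> \<epsilon> / 2 * fejer D t + M * (fejer D t * (1 - cos t))"
        by (simp add: algebra_simps)
    qed
    also have "\<dots> = 2 * pi * (\<epsilon> / 2 + M / real (D + 1))"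
      using integral_unique[OF int3] by (simp add: algebra_simps)
    also have "M / real (D + 1) \<le> \<epsilon> / 2"
    proof -
      have "M \<le> \<epsilon> / 2 * real D0" using D0 \<open>\<epsilon> > 0\<close> by (simp add: field_simps)
      also have "\<dots> \<le> \<epsilon> / 2 * real (D + 1)" using DD \<open>\<epsilon> > 0\<close> by (intro mult_left_mono) auto
      finally show ?thesis by (simp add: field_simps)
    qed
    finally have "cmod (integral {0..2 * pi} (\<lambda>t. of_real (fejer D t) * ?f t) - of_real (2 * pi) * g n w) \<le> 2 * pi * \<epsilon>"
      by simp
    then have "cmod ((integral {0..2 * pi} (\<lambda>t. of_real (fejer D t) * ?f t) - of_real (2 * pi) * g n w) / of_real (2 * pi)) \<le> \<epsilon>"
      unfolding norm_divide by (simp add: field_simps)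
    then show "cmod (integral {0..2 * pi} (\<lambda>t. of_real (fejer D t) * ?f t) / of_real (2 * pi) - g n w) \<le> \<epsilon>"
      by (simp add: diff_divide_distrib)
  qed
qed

lemma continuous_on_fejer_density:
  assumes "continuous_on S f" shows "continuous_on S (\<lambda>x. fejer_density g D (f x))"
  unfolding fejer_density_def Let_def
  by (intro continuous_on_divide continuous_on_sum continuous_on_mult continuous_on_const
      continuous_on_cis assms) (metis Suc_eq_plus1 of_nat_neq_0)

lemma continuous_on_plane_wave:
  assumes "continuous_on S f" "continuous_on S h"
  shows "continuous_on S (\<lambda>x. plane_wave (f x) n (h x))"
  unfolding plane_wave_def
  by (intro continuous_on_cis continuous_on_add continuous_on_mult continuous_on_const continuous_on_diff
      continuous_on_Re continuous_on_minus assms)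

text \<open>One choice of amplitudes and directions serves all indices up to N. Since the partial
  derivatives of order a + b of \<open>g 0\<close> are combinations of the \<open>g n\<close> with
  |n| \<le> a + b, this is approximation in C^N.\<close>

lemma ladder_approx_plane_waves:
  assumes g: "helmholtz_ladder g" and "\<epsilon> > 0"
  shows "\<exists>Q (f :: nat \<Rightarrow> complex) \<psi>. \<forall>n w. \<bar>n\<bar> \<le> int N \<longrightarrow> cmod w \<le> R \<longrightarrow>
     cmod (g n w - (\<Sum>j<Q. f j * plane_wave (\<psi> j) n w)) \<le> \<epsilon>"
proof -
  have e2: "\<epsilon> / 2 > 0" using \<open>\<epsilon> > 0\<close> by simp
  have fin: "finite {n. \<bar>n\<bar> \<le> int N}"
    by (rule finite_subset[of _ "{- int N..int N}"]) auto
  have "\<forall>\<^sub>F D in sequentially. \<forall>n\<in>{n. \<bar>n\<bar> \<le> int N}. \<forall>w\<in>cball 0 R.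
     cmod (integral {0..2 * pi} (\<lambda>t. of_real (fejer D t) * (cis (of_int n * t) * g n (cis t * w))) / (2 * pi) - g n w) \<le> \<epsilon> / 2"
    by (rule eventually_ball_finite[OF fin ballI]) (rule fejer_mean_tendsto[OF g e2])
  then have ex: "\<exists>D. \<forall>n\<in>{n. \<bar>n\<bar> \<le> int N}. \<forall>w\<in>cball 0 R.
     cmod (integral {0..2 * pi} (\<lambda>t. of_real (fejer D t) * (cis (of_int n * t) * g n (cis t * w))) / (2 * pi) - g n w) \<le> \<epsilon> / 2"
    by (rule eventually_happens'[OF sequentially_bot])
  obtain D where D: "\<forall>n\<in>{n. \<bar>n\<bar> \<le> int N}. \<forall>w\<in>cball 0 R.
     cmod (integral {0..2 * pi} (\<lambda>t. fejer_density g D t * plane_wave (- t) n w) / (2 * pi) - g n w) \<le> \<epsilon> / 2"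
    using ex unfolding fejer_mean_eq_plane_waves[OF g] by (rule exE)
  let ?H = "\<lambda>n t w. fejer_density g D t * plane_wave (- t) n w"
  have cont: "continuous_on ({0..2 * pi} \<times> cball 0 R) (\<lambda>(t, w). ?H n t w)" for n
    unfolding case_prod_unfold
    by (intro continuous_on_mult continuous_on_fejer_density continuous_on_plane_wave continuous_on_minus
        continuous_on_fst continuous_on_snd continuous_on_id)
  have "\<forall>\<^sub>F Q in sequentially. \<forall>n\<in>{n. \<bar>n\<bar> \<le> int N}. \<forall>w\<in>cball 0 R.
     cmod (integral {0..2 * pi} (\<lambda>t. ?H n t w) - (2 * pi / Q) * (\<Sum>j<Q. ?H n (2 * pi * j / Q) w)) \<le> \<epsilon>"
    by (rule eventually_ball_finite[OF fin ballI],
        rule uniform_riemann_sum[OF cont compact_cball \<open>\<epsilon> > 0\<close>])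
  from eventually_happens'[OF sequentially_bot this]
  obtain Q :: nat where Q: "\<forall>n\<in>{n. \<bar>n\<bar> \<le> int N}. \<forall>w\<in>cball 0 R.
     cmod (integral {0..2 * pi} (\<lambda>t. ?H n t w) - (2 * pi / Q) * (\<Sum>j<Q. ?H n (2 * pi * j / Q) w)) \<le> \<epsilon>"
    ..
  show ?thesis
  proof (rule exI[of _ Q], rule exI[of _ "\<lambda>j. fejer_density g D (2 * pi * real j / Q) / Q"],
      rule exI[of _ "\<lambda>j. - (2 * pi * real j / Q)"], intro allI impI)
    fix n w assume n: "\<bar>n\<bar> \<le> int N" and w: "cmod w \<le> R"
    let ?I = "integral {0..2 * pi} (\<lambda>t. ?H n t w)"
    let ?S = "\<Sum>j<Q. ?H n (2 * pi * j / Q) w"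
    have "cmod (?I / (2 * pi) - ?S / Q) = cmod ((?I - (2 * pi / Q) * ?S) / of_real (2 * pi))"
      by (simp add: diff_divide_distrib)
    also have "\<dots> \<le> \<epsilon> / (2 * pi)"
      unfolding norm_divide using Q[rule_format, of n w] n w by (simp add: divide_right_mono)
    also have "\<dots> \<le> \<epsilon> / 2" using \<open>\<epsilon> > 0\<close> pi_gt3 by (intro divide_left_mono) auto
    finally have 1: "cmod (?I / (2 * pi) - ?S / Q) \<le> \<epsilon> / 2" .
    have 2: "cmod (?I / (2 * pi) - g n w) \<le> \<epsilon> / 2" using D[rule_format, of n w] n w by simp
    have "cmod (g n w - ?S / Q) \<le> \<epsilon>"
      using norm_triangle_ineq4[of "?I / (2 * pi) - ?S / Q" "?I / (2 * pi) - g n w"] 1 2 by simp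
    then show "cmod (g n w - (\<Sum>j<Q. fejer_density g D (2 * pi * real j / Q) / Q *
        plane_wave (- (2 * pi * real j / Q)) n w)) \<le> \<epsilon>"
      by (simp add: sum_divide_distrib)
  qed
qed

section \<open>Solutions of the Helmholtz equation as ladders\<close>

text \<open>A function together with all its partial derivatives as one family. By
  \<open>jet_pd\<close> the iterated operators in \<open>Ck_norm\<close> can then be replaced by
  explicit members of the family.\<close>

definition jet :: "(nat \<Rightarrow> nat \<Rightarrow> real \<times> real \<Rightarrow> real) \<Rightarrow> bool" where
  "jet F \<longleftrightarrow> (\<forall>a b x y.
     ((\<lambda>t. F a b (t, y)) has_real_derivative F (Suc a) b (x, y)) (at x) \<and>
     ((\<lambda>t. F a b (x, t)) has_real_derivative F a (Suc b) (x, y)) (at y))"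

lemma jet_pd: "jet F \<Longrightarrow> (pd1 ^^ a) ((pd2 ^^ b) (F 0 0)) = F a b"
proof (induction a)
  case 0
  have "(pd2 ^^ b) (F 0 0) = F 0 b"
  proof (induction b)
    case (Suc b)
    then show ?case
      using 0 unfolding jet_def by (auto simp: pd2_def fun_eq_iff intro!: DERIV_imp_deriv)
  qed simp
  then show ?case by simp
next
  case (Suc a)
  then show ?case
    unfolding jet_def by (auto simp: pd1_def fun_eq_iff intro!: DERIV_imp_deriv)
qed

lemma jet_diff:
  assumes "jet F" "jet G"
  shows "jet (\<lambda>a b w. F a b w - G a b w)"
  using assms unfolding jet_def by (auto intro!: DERIV_diff)

text \<open>A form of Schwarz's theorem in which the existence of the y-derivative of fx is part of
  the conclusion. The function is its value at height y0 plus the integral of fy; differentiating in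
  x under the integral sign gives fx, and the fundamental theorem in the upper limit gives the
  claim.\<close>

lemma mixed_partials_commute:
  fixes f fx fy fyx :: "real \<Rightarrow> real \<Rightarrow> real"
  assumes fx: "\<And>x y. ((\<lambda>t. f t y) has_real_derivative fx x y) (at x)"
    and fy: "\<And>x y. ((\<lambda>t. f x t) has_real_derivative fy x y) (at y)"
    and fyx: "\<And>x y. ((\<lambda>t. fy t y) has_real_derivative fyx x y) (at x)"
    and cY: "continuous_on UNIV (\<lambda>(x, y). fy x y)" and cYX: "continuous_on UNIV (\<lambda>(x, y). fyx x y)"
  shows "((\<lambda>t. fx x t) has_real_derivative fyx x y) (at y)"
proof -
  \<comment> \<open>A base height below y puts y inside the interval from y0 to y + 1, so that the
    one-sided fundamental theorem yields a two-sided derivative.\<close>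
  define y0 where "y0 = y - 1"
  note Pair_cont = continuous_on_Pair[OF continuous_on_const continuous_on_id]
  have ccY: "continuous_on S (\<lambda>t. fy x t)" for x S
    using continuous_on_compose2[OF cY Pair_cont, of x S] by simp
  have ccYX: "continuous_on S (\<lambda>t. fyx x t)" for x S
    using continuous_on_compose2[OF cYX Pair_cont, of x S] by simp
  have fx_eq: "fx x v = fx x y0 + integral {y0..v} (fyx x)" if "y0 \<le> v" for v
  proof -
    have ftc: "f s v = f s y0 + integral {y0..v} (fy s)" for s
    proof -
      have "(fy s has_integral (f s v - f s y0)) {y0..v}"
        using that fy by (intro fundamental_theorem_of_calculus)
          (auto simp: has_real_derivative_iff_has_vector_derivative[symmetric] intro: has_field_derivative_at_within)
      then show ?thesis by (simp add: integral_unique)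
    qed
    have "((\<lambda>s. integral (cbox y0 v) (fy s)) has_real_derivative integral (cbox y0 v) (fyx x)) (at x within UNIV)"
    proof (rule leibniz_rule_field_derivative)
      show "((\<lambda>x. fy x t) has_real_derivative fyx x t) (at x within UNIV)" for x t
        using fyx by simp
      show "fy x integrable_on cbox y0 v" for x
        by (intro integrable_continuous ccY)
      show "continuous_on (UNIV \<times> cbox y0 v) (\<lambda>(x, t). fyx x t)"
        by (rule continuous_on_subset[OF cYX]) simp
    qed auto
    then have "((\<lambda>s. f s y0 + integral {y0..v} (fy s)) has_real_derivative (fx x y0 + integral {y0..v} (fyx x))) (at x)"
      by (intro DERIV_add fx) simp
    then have "((\<lambda>s. f s v) has_real_derivative (fx x y0 + integral {y0..v} (fyx x))) (at x)"
      unfolding ftc[symmetric] .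
    then show ?thesis using fx DERIV_unique by blast
  qed
  have "((\<lambda>v. integral {y0..v} (fyx x)) has_real_derivative fyx x y) (at y within {y0..y + 1})"
    by (rule integral_has_real_derivative[OF ccYX]) (simp add: y0_def)
  then have "((\<lambda>v. integral {y0..v} (fyx x)) has_real_derivative fyx x y) (at y)"
    using at_within_Icc_at[of y0 y "y + 1"] by (simp add: y0_def)
  then have "((\<lambda>v. fx x y0 + integral {y0..v} (fyx x)) has_real_derivative fyx x y) (at y)"
    by (auto intro!: derivative_eq_intros)
  then show ?thesis
  proof (rule DERIV_cong_ev[THEN iffD1, rotated -1])
    have "\<forall>\<^sub>F v in nhds y. v \<in> {y0<..}"
      by (rule eventually_nhds_in_open) (auto simp: y0_def)
    then show "\<forall>\<^sub>F v in nhds y. fx x y0 + integral {y0..v} (fyx x) = fx x v"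
      by eventually_elim (rule fx_eq[symmetric], simp)
  qed auto
qed

lemma smooth2_pdl_deriv:
  assumes "smooth2 f"
  shows "((\<lambda>t. pdl bs f (t, y)) has_real_derivative pd1 (pdl bs f) (x, y)) (at x)"
    and "((\<lambda>t. pdl bs f (x, t)) has_real_derivative pd2 (pdl bs f) (x, y)) (at y)"
  using assms unfolding smooth2_def pd1_def pd2_def
  by (auto simp: DERIV_deriv_iff_real_differentiable)

lemma smooth2_pdl_continuous:
  assumes "smooth2 f"
  shows "continuous_on S (pdl bs f)"
  using assms continuous_on_subset unfolding smooth2_def by blast

lemma smooth2_pd_commute:
  assumes f: "smooth2 f"
  shows "pd2 (pd1 (pdl bs f)) = pd1 (pd2 (pdl bs f))"
proof (rule ext, clarify)
  fix x y
  have "((\<lambda>t. pd1 (pdl bs f) (x, t)) has_real_derivative pd1 (pd2 (pdl bs f)) (x, y)) (at y)"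
  proof (rule mixed_partials_commute[where f = "\<lambda>x y. pdl bs f (x, y)" and fx = "\<lambda>x y. pd1 (pdl bs f) (x, y)"
        and fy = "\<lambda>x y. pd2 (pdl bs f) (x, y)" and fyx = "\<lambda>x y. pd1 (pd2 (pdl bs f)) (x, y)"])
    show "((\<lambda>t. pd2 (pdl bs f) (t, y)) has_real_derivative pd1 (pd2 (pdl bs f)) (x, y)) (at x)" for x y
      using smooth2_pdl_deriv(1)[OF f, of "True # bs"] by simp
    show "continuous_on UNIV (\<lambda>(x, y). pd2 (pdl bs f) (x, y))"
      using smooth2_pdl_continuous[OF f, of UNIV "True # bs"] by (simp add: case_prod_unfold)
    show "continuous_on UNIV (\<lambda>(x, y). pd1 (pd2 (pdl bs f)) (x, y))"
      using smooth2_pdl_continuous[OF f, of UNIV "False # True # bs"] by (simp add: case_prod_unfold)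
  qed (rule smooth2_pdl_deriv[OF f])+
  then show "pd2 (pd1 (pdl bs f)) (x, y) = pd1 (pd2 (pdl bs f)) (x, y)"
    by (simp add: pd2_def[of "pd1 (pdl bs f)"] DERIV_imp_deriv)
qed

lemma pdl_replicate: "(pd1 ^^ a) ((pd2 ^^ b) f) = pdl (replicate a False @ replicate b True) f"
proof (induction a)
  case 0
  show ?case by (induction b) auto
qed simp

text \<open>\<open>smooth2\<close> speaks of arbitrary words in the two partial derivatives. Moving
  one \<open>pd2\<close> inwards through a block of \<open>pd1\<close> restores the normal form with
  all \<open>pd1\<close> outside.\<close>

lemma smooth2_jet:
  assumes f: "smooth2 f"
  shows "jet (\<lambda>a b. (pd1 ^^ a) ((pd2 ^^ b) f))"
proof -
  have comm: "pd2 ((pd1 ^^ a) ((pd2 ^^ b) f)) = (pd1 ^^ a) ((pd2 ^^ Suc b) f)" for a b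
  proof (induction a)
    case (Suc a)
    then show ?case using smooth2_pd_commute[OF f] by (simp add: pdl_replicate)
  qed simp
  show ?thesis
    unfolding jet_def
  proof (intro allI conjI)
    fix a b x y
    show "((\<lambda>t. (pd1 ^^ a) ((pd2 ^^ b) f) (t, y)) has_real_derivative (pd1 ^^ Suc a) ((pd2 ^^ b) f) (x, y)) (at x)"
      using smooth2_pdl_deriv(1)[OF f] by (simp add: pdl_replicate)
    show "((\<lambda>t. (pd1 ^^ a) ((pd2 ^^ b) f) (x, t)) has_real_derivative (pd1 ^^ a) ((pd2 ^^ Suc b) f) (x, y)) (at y)"
      using smooth2_pdl_deriv(2)[OF f] unfolding comm[symmetric] by (simp add: pdl_replicate)
  qed
qed

lemma MW_jet_equation:
  assumes "\<phi> \<in> MW"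
  defines "F \<equiv> \<lambda>a b. (pd1 ^^ a) ((pd2 ^^ b) \<phi>)"
  shows "F (Suc (Suc a)) b w + F a (Suc (Suc b)) w + F a b w = 0"
proof -
  have j: "jet F" using smooth2_jet assms by (auto simp: MW_def F_def)
  note jx = j[unfolded jet_def, rule_format, THEN conjunct1]
  note jy = j[unfolded jet_def, rule_format, THEN conjunct2]
  have eq0: "F 2 0 z + F 0 2 z + F 0 0 z = 0" for z
    using assms by (cases z) (auto simp: MW_def F_def numeral_2_eq_2)
  have eq1: "F 2 b (x, y) + F 0 (Suc (Suc b)) (x, y) + F 0 b (x, y) = 0" for b x y
  proof (induction b arbitrary: x y)
    case 0
    then show ?case using eq0 by (simp add: numeral_2_eq_2)
  next
    case (Suc b)
    have "((\<lambda>t. F 2 b (x, t) + F 0 (Suc (Suc b)) (x, t) + F 0 b (x, t)) has_real_derivative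
        (F 2 (Suc b) (x, y) + F 0 (Suc (Suc (Suc b))) (x, y) + F 0 (Suc b) (x, y))) (at y)"
      by (intro DERIV_add jy)
    from DERIV_unique[OF this[unfolded Suc.IH] DERIV_const] show ?case .
  qed
  have "F (Suc (Suc a)) b (x, y) + F a (Suc (Suc b)) (x, y) + F a b (x, y) = 0" for x y
  proof (induction a arbitrary: x y)
    case 0
    then show ?case using eq1 by (simp add: numeral_2_eq_2)
  next
    case (Suc a)
    have "((\<lambda>t. F (Suc (Suc a)) b (t, y) + F a (Suc (Suc b)) (t, y) + F a b (t, y)) has_real_derivative
        (F (Suc (Suc (Suc a))) b (x, y) + F (Suc a) (Suc (Suc b)) (x, y) + F (Suc a) b (x, y))) (at x)"
      by (intro DERIV_add jx)
    from DERIV_unique[OF this[unfolded Suc.IH] DERIV_const] show ?case .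
  qed
  then show ?thesis by (cases w) simp
qed

text \<open>Complex jets, and the operators \<open>\<partial>\<^sub>x - i \<partial>\<^sub>y\<close> and \<open>- (\<partial>\<^sub>x + i \<partial>\<^sub>y)\<close>, which are inverse to
  each other on solutions of the Helmholtz equation.\<close>

definition cjet :: "(nat \<Rightarrow> nat \<Rightarrow> complex \<Rightarrow> complex) \<Rightarrow> bool" where
  "cjet A \<longleftrightarrow> (\<forall>a b w. (A a b has_derivative
     (\<lambda>h. of_real (Re h) * A (Suc a) b w + of_real (Im h) * A a (Suc b) w)) (at w)) \<and>
     (\<forall>a b w. A (Suc (Suc a)) b w + A a (Suc (Suc b)) w + A a b w = 0)"

definition ladder_up :: "(nat \<Rightarrow> nat \<Rightarrow> complex \<Rightarrow> complex) \<Rightarrow> nat \<Rightarrow> nat \<Rightarrow> complex \<Rightarrow> complex" where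
  "ladder_up A a b w = A (Suc a) b w - \<i> * A a (Suc b) w"

definition ladder_down :: "(nat \<Rightarrow> nat \<Rightarrow> complex \<Rightarrow> complex) \<Rightarrow> nat \<Rightarrow> nat \<Rightarrow> complex \<Rightarrow> complex" where
  "ladder_down A a b w = - (A (Suc a) b w + \<i> * A a (Suc b) w)"

lemma cjet_derivative:
  "cjet A \<Longrightarrow> (A a b has_derivative
     (\<lambda>h. of_real (Re h) * A (Suc a) b w + of_real (Im h) * A a (Suc b) w)) (at w)"
  unfolding cjet_def by blast

lemma cjet_equation: "cjet A \<Longrightarrow> A (Suc (Suc a)) b w = - A a (Suc (Suc b)) w - A a b w"
  unfolding cjet_def by (simp add: algebra_simps eq_neg_iff_add_eq_0)

lemma cjet_ladder_up:
  assumes "cjet A" shows "cjet (ladder_up A)"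
  unfolding cjet_def ladder_up_def[abs_def]
proof (intro conjI allI)
  fix a b w
  show "((\<lambda>w. A (Suc a) b w - \<i> * A a (Suc b) w) has_derivative
     (\<lambda>h. of_real (Re h) * (A (Suc (Suc a)) b w - \<i> * A (Suc a) (Suc b) w) +
          of_real (Im h) * (A (Suc a) (Suc b) w - \<i> * A a (Suc (Suc b)) w))) (at w)"
    by (rule has_derivative_eq_rhs[OF has_derivative_diff[OF cjet_derivative[OF assms]
          has_derivative_mult_right[OF cjet_derivative[OF assms]]]]) (simp add: fun_eq_iff algebra_simps)
qed (simp add: cjet_equation[OF assms] algebra_simps)

lemma cjet_ladder_down:
  assumes "cjet A" shows "cjet (ladder_down A)"
  unfolding cjet_def ladder_down_def[abs_def]
proof (intro conjI allI)
  fix a b w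
  show "((\<lambda>w. - (A (Suc a) b w + \<i> * A a (Suc b) w)) has_derivative
     (\<lambda>h. of_real (Re h) * - (A (Suc (Suc a)) b w + \<i> * A (Suc a) (Suc b) w) +
          of_real (Im h) * - (A (Suc a) (Suc b) w + \<i> * A a (Suc (Suc b)) w))) (at w)"
    by (rule has_derivative_eq_rhs[OF has_derivative_minus[OF has_derivative_add[OF cjet_derivative[OF assms]
          has_derivative_mult_right[OF cjet_derivative[OF assms]]]]]) (simp add: fun_eq_iff algebra_simps)
qed (simp add: cjet_equation[OF assms] algebra_simps)

lemma ladder_up_down:
  assumes "cjet A" shows "ladder_up (ladder_down A) = A" "ladder_down (ladder_up A) = A"
  by (simp_all add: fun_eq_iff ladder_up_def ladder_down_def cjet_equation[OF assms] algebra_simps)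

definition ladder_iterate :: "(nat \<Rightarrow> nat \<Rightarrow> complex \<Rightarrow> complex) \<Rightarrow> int \<Rightarrow> nat \<Rightarrow> nat \<Rightarrow> complex \<Rightarrow> complex" where
  "ladder_iterate A n = (if n \<ge> 0 then (ladder_up ^^ nat n) A else (ladder_down ^^ nat (- n)) A)"

lemma cjet_ladder_iterate: "cjet A \<Longrightarrow> cjet (ladder_iterate A n)"
proof -
  assume A: "cjet A"
  have "cjet ((ladder_up ^^ k) A)" "cjet ((ladder_down ^^ k) A)" for k
    by (induction k) (auto simp: A cjet_ladder_up cjet_ladder_down)
  then show ?thesis by (simp add: ladder_iterate_def)
qed

lemma ladder_iterate_step:
  assumes A: "cjet A"
  shows "ladder_iterate A (n + 1) = ladder_up (ladder_iterate A n)"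
    and "ladder_iterate A (n - 1) = ladder_down (ladder_iterate A n)"
proof -
  show up: "ladder_iterate A (n + 1) = ladder_up (ladder_iterate A n)" for n
  proof (cases "n \<ge> 0")
    case True
    then show ?thesis by (simp add: ladder_iterate_def nat_add_distrib)
  next
    case False
    then obtain k where k: "n = - int (Suc k)" by (metis int_cases2 neg_0_le_iff_le not_le zero_le_imp_eq_int of_nat_0_le_iff not0_implies_Suc of_nat_0)
    have "ladder_iterate A n = ladder_down ((ladder_down ^^ k) A)"
      unfolding k ladder_iterate_def by (simp add: nat_add_distrib)
    moreover have "ladder_iterate A (n + 1) = (ladder_down ^^ k) A"
      unfolding k ladder_iterate_def by simp
    moreover have "cjet ((ladder_down ^^ k) A)"
      by (induction k) (auto simp: A cjet_ladder_down)
    ultimately show ?thesis by (simp add: ladder_up_down)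
  qed
  show "ladder_iterate A (n - 1) = ladder_down (ladder_iterate A n)"
    using up[of "n - 1"] ladder_up_down(2)[OF cjet_ladder_iterate[OF A]] by simp
qed

lemma ladder_iterate_partials:
  assumes A: "cjet A"
  shows "ladder_iterate A n (Suc a) b w = (ladder_iterate A (n + 1) a b w - ladder_iterate A (n - 1) a b w) / 2"
    and "ladder_iterate A n a (Suc b) w = \<i> * (ladder_iterate A (n + 1) a b w + ladder_iterate A (n - 1) a b w) / 2"
  unfolding ladder_iterate_step[OF A] by (simp_all add: ladder_up_def ladder_down_def algebra_simps)

lemma helmholtz_ladder_iterate:
  assumes A: "cjet A"
  shows "helmholtz_ladder (\<lambda>n. ladder_iterate A n 0 0)"
  unfolding helmholtz_ladder_def
proof (intro allI)
  fix n w
  show "(ladder_iterate A n 0 0 has_derivative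
     (\<lambda>h. (h * ladder_iterate A (n + 1) 0 0 w - cnj h * ladder_iterate A (n - 1) 0 0 w) / 2)) (at w)"
  proof (rule has_derivative_eq_rhs[OF cjet_derivative[OF cjet_ladder_iterate[OF A]]], rule ext)
    fix h
    have "of_real (Re h) = (h + cnj h) / 2" "of_real (Im h) = - \<i> * (h - cnj h) / 2"
      by (simp_all add: complex_eq_iff)
    then show "of_real (Re h) * ladder_iterate A n (Suc 0) 0 w + of_real (Im h) * ladder_iterate A n 0 (Suc 0) w =
       (h * ladder_iterate A (n + 1) 0 0 w - cnj h * ladder_iterate A (n - 1) 0 0 w) / 2"
      unfolding ladder_iterate_partials[OF A] by (simp only:) (simp add: field_simps)
  qed
qed

text \<open>The partial derivative of order (a, b) of member n of a ladder, computed from the values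
  v of all members at one point: d/dx is half the difference, and d/dy is i/2 times the sum, of the
  raising and the lowering operator.\<close>

fun ladder_jet :: "(int \<Rightarrow> complex) \<Rightarrow> nat \<Rightarrow> nat \<Rightarrow> int \<Rightarrow> complex" where
  "ladder_jet v 0 0 n = v n"
| "ladder_jet v 0 (Suc b) n = \<i> * (ladder_jet v 0 b (n + 1) + ladder_jet v 0 b (n - 1)) / 2"
| "ladder_jet v (Suc a) b n = (ladder_jet v a b (n + 1) - ladder_jet v a b (n - 1)) / 2"

lemma ladder_iterate_eq_jet:
  assumes A: "cjet A"
  shows "ladder_iterate A n a b w = ladder_jet (\<lambda>m. ladder_iterate A m 0 0 w) a b n"
proof (induction a arbitrary: n)
  case 0
  show ?case
    by (induction b arbitrary: n) (auto simp: ladder_iterate_partials[OF A])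
next
  case (Suc a)
  then show ?case by (simp add: ladder_iterate_partials[OF A])
qed

text \<open>Every step of \<open>ladder_jet\<close> is an average up to unimodular factors, so a
  bound on the values passes to all partial derivatives without loss.\<close>

lemma norm_ladder_jet_le:
  assumes "\<And>m. \<bar>m\<bar> \<le> \<bar>n\<bar> + int (a + b) \<Longrightarrow> cmod (v m) \<le> e"
  shows "cmod (ladder_jet v a b n) \<le> e"
  using assms
proof (induction v a b n rule: ladder_jet.induct)
  case (1 v n)
  then show ?case by simp
next
  case (2 v b n)
  have "cmod (ladder_jet v 0 b (n + 1)) \<le> e" "cmod (ladder_jet v 0 b (n - 1)) \<le> e"
    using "2.prems" by (auto intro!: "2.IH")
  then show ?case
    using norm_triangle_ineq[of "ladder_jet v 0 b (n + 1)" "ladder_jet v 0 b (n - 1)"]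
    by (simp add: norm_mult norm_divide)
next
  case (3 v a b n)
  have "cmod (ladder_jet v a b (n + 1)) \<le> e" "cmod (ladder_jet v a b (n - 1)) \<le> e"
    using "3.prems" by (auto intro!: "3.IH")
  then show ?case
    using norm_triangle_ineq4[of "ladder_jet v a b (n + 1)" "ladder_jet v a b (n - 1)"]
    by (simp add: norm_divide)
qed

lemma ladder_jet_diff_sum:
  "ladder_jet (\<lambda>m. v m - (\<Sum>j\<in>J. f j * p j m)) a b n = ladder_jet v a b n - (\<Sum>j\<in>J. f j * ladder_jet (p j) a b n)"
proof (induction a arbitrary: n)
  case 0
  show ?case
  proof (induction b arbitrary: n)
    case (Suc b)
    show ?case
      by (simp only: ladder_jet.simps Suc.IH)
        (simp add: algebra_simps sum.distrib sum_distrib_left sum_divide_distrib add_divide_distrib diff_divide_distrib)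
  qed simp
next
  case (Suc a)
  show ?case
    by (simp only: ladder_jet.simps Suc.IH)
      (simp add: algebra_simps sum_subtractf sum_divide_distrib add_divide_distrib diff_divide_distrib)
qed

lemma ladder_jet_plane_wave:
  "ladder_jet (\<lambda>m. plane_wave \<psi> m w) a b n = (\<i> * of_real (cos \<psi>)) ^ a * (\<i> * of_real (sin \<psi>)) ^ b * plane_wave \<psi> n w"
proof -
  have c: "cis \<psi> + cis (- \<psi>) = of_real (2 * cos \<psi>)" "cis \<psi> - cis (- \<psi>) = \<i> * of_real (2 * sin \<psi>)"
    by (simp_all add: complex_eq_iff)
  have X: "(plane_wave \<psi> (n + 1) w - plane_wave \<psi> (n - 1) w) / 2 = \<i> * of_real (cos \<psi>) * plane_wave \<psi> n w" for n
  proof -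
    have "(plane_wave \<psi> (n + 1) w - plane_wave \<psi> (n - 1) w) / 2 = \<i> * (cis \<psi> + cis (- \<psi>)) / 2 * plane_wave \<psi> n w"
      unfolding plane_wave_step by (simp add: field_simps)
    then show ?thesis unfolding c by simp
  qed
  have Y: "\<i> * (plane_wave \<psi> (n + 1) w + plane_wave \<psi> (n - 1) w) / 2 = \<i> * of_real (sin \<psi>) * plane_wave \<psi> n w" for n
  proof -
    have "\<i> * (plane_wave \<psi> (n + 1) w + plane_wave \<psi> (n - 1) w) / 2 = (cis \<psi> - cis (- \<psi>)) / 2 * plane_wave \<psi> n w"
      unfolding plane_wave_step by (simp add: field_simps)
    then show ?thesis unfolding c by simp
  qed
  show ?thesis
  proof (induction a arbitrary: n)
    case 0
    show ?case
    proof (induction b arbitrary: n)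
      case (Suc b)
      have "ladder_jet (\<lambda>m. plane_wave \<psi> m w) 0 (Suc b) n =
         (\<i> * of_real (sin \<psi>)) ^ b * (\<i> * (plane_wave \<psi> (n + 1) w + plane_wave \<psi> (n - 1) w) / 2)"
        by (simp add: Suc field_simps)
      then show ?case unfolding Y by simp
    qed simp
  next
    case (Suc a)
    have "ladder_jet (\<lambda>m. plane_wave \<psi> m w) (Suc a) b n =
       (\<i> * of_real (cos \<psi>)) ^ a * (\<i> * of_real (sin \<psi>)) ^ b * ((plane_wave \<psi> (n + 1) w - plane_wave \<psi> (n - 1) w) / 2)"
      by (simp add: Suc field_simps)
    then show ?case unfolding X by simp
  qed
qed

lemma has_derivative_of_partials:
  fixes f f1 f2 :: "real \<times> real \<Rightarrow> real"
  assumes "\<And>x y. ((\<lambda>t. f (t, y)) has_real_derivative f1 (x, y)) (at x)"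
    and "\<And>x y. ((\<lambda>t. f (x, t)) has_real_derivative f2 (x, y)) (at y)"
    and "continuous_on UNIV f2"
  shows "(f has_derivative (\<lambda>(h, k). f1 w * h + f2 w * k)) (at w)"
proof -
  obtain x y where w: "w = (x, y)" by (cases w)
  have "((\<lambda>(x, y). f (x, y)) has_derivative (\<lambda>(h, k). f1 (x, y) * h + blinfun_apply (blinfun_mult_right (f2 (x, y))) k))
      (at (x, y) within UNIV \<times> UNIV)"
  proof (rule has_derivative_partialsI)
    show "((\<lambda>x. f (x, y)) has_derivative (*) (f1 (x, y))) (at x within UNIV)"
      using assms(1) by (simp add: has_field_derivative_def)
    show "((\<lambda>y. f (x, y)) has_derivative blinfun_apply (blinfun_mult_right (f2 (x, y)))) (at y within UNIV)" for x y
      using assms(2) by (simp add: has_field_derivative_def)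
    have "continuous (at (x, y)) (\<lambda>p. blinfun_mult_right (f2 p))"
      using assms(3) by (intro bounded_linear.continuous[OF bounded_linear_blinfun_mult_right])
        (simp add: continuous_on_eq_continuous_at)
    then show "continuous (at (x, y) within UNIV \<times> UNIV) (\<lambda>(x, y). blinfun_mult_right (f2 (x, y)))"
      by (simp add: case_prod_unfold)
  qed auto
  then show ?thesis by (simp add: w)
qed

lemma MW_ladder:
  assumes "\<phi> \<in> MW"
  shows "\<exists>g. helmholtz_ladder g \<and>
    (\<forall>a b x y. of_real ((pd1 ^^ a) ((pd2 ^^ b) \<phi>) (x, y)) = ladder_jet (\<lambda>n. g n (Complex x y)) a b 0)"
proof -
  define F where "F = (\<lambda>a b. (pd1 ^^ a) ((pd2 ^^ b) \<phi>))"
  define A where "A = (\<lambda>a b w. complex_of_real (F a b (Re w, Im w)))"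
  have sm: "smooth2 \<phi>" using assms by (simp add: MW_def)
  have j: "jet F" using smooth2_jet[OF sm] by (simp add: F_def)
  have cont: "continuous_on UNIV (F a b)" for a b
    unfolding F_def pdl_replicate by (rule smooth2_pdl_continuous[OF sm])
  have A: "cjet A"
    unfolding cjet_def
  proof (intro conjI allI)
    fix a b w
    have D: "(F a b has_derivative (\<lambda>(h, k). F (Suc a) b (Re w, Im w) * h + F a (Suc b) (Re w, Im w) * k)) (at (Re w, Im w))"
      using j cont unfolding jet_def by (intro has_derivative_of_partials) auto
    have P: "((\<lambda>w. (Re w, Im w)) has_derivative (\<lambda>h. (Re h, Im h))) (at w)"
      by (intro has_derivative_Pair has_derivative_Re has_derivative_Im has_derivative_ident)
    show "(A a b has_derivative (\<lambda>h. of_real (Re h) * A (Suc a) b w + of_real (Im h) * A a (Suc b) w)) (at w)"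
      unfolding A_def
      by (rule has_derivative_eq_rhs[OF has_derivative_of_real[OF has_derivative_compose[OF P D]]])
         (simp add: fun_eq_iff algebra_simps)
  next
    fix a b w
    show "A (Suc (Suc a)) b w + A a (Suc (Suc b)) w + A a b w = 0"
      using MW_jet_equation[OF assms, of a b "(Re w, Im w)"]
      unfolding A_def F_def by (metis of_real_add of_real_0)
  qed
  show ?thesis
  proof (intro exI conjI allI)
    show "helmholtz_ladder (\<lambda>n. ladder_iterate A n 0 0)" by (rule helmholtz_ladder_iterate[OF A])
    fix a b x y
    have "of_real ((pd1 ^^ a) ((pd2 ^^ b) \<phi>) (x, y)) = ladder_iterate A 0 a b (Complex x y)"
      by (simp add: ladder_iterate_def A_def F_def)
    also have "\<dots> = ladder_jet (\<lambda>n. ladder_iterate A n 0 0 (Complex x y)) a b 0"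
      by (rule ladder_iterate_eq_jet[OF A])
    finally show "of_real ((pd1 ^^ a) ((pd2 ^^ b) \<phi>) (x, y)) = ladder_jet (\<lambda>n. ladder_iterate A n 0 0 (Complex x y)) a b 0" .
  qed
qed

section \<open>Real waves\<close>

text \<open>The a-th derivative of cos(d x + \<gamma>). Written as a shifted cosine, it has the same
  shape for all orders, so estimates with an arbitrary phase shift cover every derivative.\<close>

definition wave :: "real \<Rightarrow> real \<Rightarrow> nat \<Rightarrow> real \<Rightarrow> real" where
  "wave d \<gamma> a x = d ^ a * cos (d * x + \<gamma> + real a * (pi / 2))"

lemma wave_deriv: "(wave d \<gamma> a has_real_derivative wave d \<gamma> (Suc a) x) (at x within S)"
proof -
  have "(wave d \<gamma> a has_real_derivative d ^ a * (- sin (d * x + \<gamma> + real a * (pi / 2)) * d)) (at x within S)"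
    unfolding wave_def[abs_def] by (auto intro!: derivative_eq_intros)
  moreover have "cos (d * x + \<gamma> + real (Suc a) * (pi / 2)) = - sin (d * x + \<gamma> + real a * (pi / 2))"
    using cos_add[of "d * x + \<gamma> + real a * (pi / 2)" "pi / 2"] by (simp add: algebra_simps add_divide_distrib)
  ultimately show ?thesis by (simp add: wave_def mult_ac)
qed

lemma wave_uminus: "wave (- d) \<gamma> a x = wave d (- \<gamma>) a x"
proof -
  let ?z = "d * x - \<gamma> - real a * (pi / 2)"
  have "cos (?z + real a * pi) = (- 1) ^ a * cos ?z"
    unfolding cos_add by (simp add: mult.commute)
  moreover have "?z + real a * pi = d * x - \<gamma> + real a * (pi / 2)" by (simp add: algebra_simps)
  moreover have "cos (- d * x + \<gamma> + real a * (pi / 2)) = cos ?z"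
    using cos_minus[of ?z] by (simp add: algebra_simps)
  ultimately have "(- d) ^ a * cos (- d * x + \<gamma> + real a * (pi / 2)) = ((- 1) ^ a * (- 1) ^ a) * (d ^ a * cos (d * x - \<gamma> + real a * (pi / 2)))"
    by (simp only: power_minus[of d] mult_ac) (simp flip: power_add)
  then show ?thesis by (simp add: wave_def flip: power_mult_distrib)
qed

text \<open>The lattice points are taken with positive coordinates, so a negative component of a
  direction is traded for a negated phase.\<close>

lemma wave_abs: "wave d \<gamma> a x = wave \<bar>d\<bar> (if d \<ge> 0 then \<gamma> else - \<gamma>) a x"
  using wave_uminus[of "- d" \<gamma> a x] by (auto simp: abs_if)

text \<open>The eigenfunctions are sums of products of one-variable functions, so a plane wave cos(U
  + V) is split as cos U cos V + cos(U + pi/2) cos(V - pi/2), each product with its own phases in x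
  and y.\<close>

lemma Re_plane_wave_jet:
  "Re (f * ((\<i> * of_real (cos \<psi>)) ^ a * (\<i> * of_real (sin \<psi>)) ^ b * plane_wave \<psi> 0 (Complex x y))) =
     cmod f * (wave (cos \<psi>) (Arg f) a x * wave (sin \<psi>) 0 b y
       + wave (cos \<psi>) (Arg f + pi / 2) a x * wave (sin \<psi>) (- pi / 2) b y)"
proof -
  let ?U = "cos \<psi> * x + Arg f + real a * (pi / 2)" and ?V = "sin \<psi> * y + real b * (pi / 2)"
  have i: "\<i> ^ n = cis (real n * (pi / 2))" for n
    using Complex.DeMoivre[of "pi / 2" n] by simp
  have pw: "plane_wave \<psi> 0 (Complex x y) = cis (cos \<psi> * x + sin \<psi> * y)"
    by (simp add: plane_wave_def)
  have f: "of_real (cmod f) * cis (Arg f) = f"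
    using rcis_cmod_Arg[of f] by (simp add: rcis_def)
  have "of_real r * cis \<theta> * ((\<i> * of_real c) ^ a * (\<i> * of_real s) ^ b * cis v) =
     of_real (r * c ^ a * s ^ b) * cis (\<theta> + real a * (pi / 2) + real b * (pi / 2) + v)" for r \<theta> c s v
    unfolding power_mult_distrib i of_real_mult of_real_power cis_mult[symmetric] by (simp only: mult_ac)
  note this[of "cmod f" "Arg f" "cos \<psi>" "sin \<psi>" "cos \<psi> * x + sin \<psi> * y", unfolded f]
  moreover have "Arg f + real a * (pi / 2) + real b * (pi / 2) + (cos \<psi> * x + sin \<psi> * y) = ?U + ?V"
    by simp
  ultimately
  have "f * ((\<i> * of_real (cos \<psi>)) ^ a * (\<i> * of_real (sin \<psi>)) ^ b * plane_wave \<psi> 0 (Complex x y)) =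
     of_real (cmod f * cos \<psi> ^ a * sin \<psi> ^ b) * cis (?U + ?V)"
    unfolding pw by (simp only: mult.assoc)
  then have "Re (f * ((\<i> * of_real (cos \<psi>)) ^ a * (\<i> * of_real (sin \<psi>)) ^ b * plane_wave \<psi> 0 (Complex x y))) =
     cmod f * cos \<psi> ^ a * sin \<psi> ^ b * cos (?U + ?V)"
    by (simp only: Re_mult_of_real_cis)
  also have "cos (?U + ?V) = cos ?U * cos ?V + cos (?U + pi / 2) * cos (?V - pi / 2)"
    by (simp add: cos_add cos_diff)
  finally show ?thesis
    by (simp add: wave_def algebra_simps)
qed

text \<open>The boolean in an index distinguishes the two products into which each plane wave
  splits. As \<phi> is real, taking real parts of the complex approximation costs nothing.\<close>

lemma MW_approx_waves:
  assumes "\<phi> \<in> MW" "\<epsilon> > 0"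
  shows "\<exists>(I :: (nat \<times> bool) set) A d1 d2 \<gamma> \<delta>. finite I \<and>
    (\<forall>i\<in>I. A i \<ge> (0::real) \<and> d1 i \<ge> 0 \<and> d2 i \<ge> 0 \<and> (d1 i)\<^sup>2 + (d2 i)\<^sup>2 = 1) \<and>
    (\<forall>a b x y. a + b \<le> k \<longrightarrow> \<bar>x\<bar> \<le> R \<longrightarrow> \<bar>y\<bar> \<le> R \<longrightarrow>
      \<bar>(pd1 ^^ a) ((pd2 ^^ b) \<phi>) (x, y) - (\<Sum>i\<in>I. A i * (wave (d1 i) (\<gamma> i) a x * wave (d2 i) (\<delta> i) b y))\<bar> \<le> \<epsilon>)"
proof -
  obtain g where g: "helmholtz_ladder g"
    and gF: "\<And>a b x y. of_real ((pd1 ^^ a) ((pd2 ^^ b) \<phi>) (x, y)) = ladder_jet (\<lambda>n. g n (Complex x y)) a b 0"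
    using MW_ladder[OF assms(1)] by blast
  obtain Q and f :: "nat \<Rightarrow> complex" and \<psi> where
    Q': "\<forall>n w. \<bar>n\<bar> \<le> int k \<longrightarrow> cmod w \<le> 2 * R \<longrightarrow> cmod (g n w - (\<Sum>j<Q. f j * plane_wave (\<psi> j) n w)) \<le> \<epsilon>"
    using ladder_approx_plane_waves[OF g assms(2), of k "2 * R"] by (elim exE) (rule that)
  note Q = Q'[rule_format]
  define sg where "sg = (\<lambda>(d::real) \<gamma>::real. if d \<ge> 0 then \<gamma> else - \<gamma>)"
  define I where "I = {..<Q} \<times> (UNIV :: bool set)"
  define A where "A = (\<lambda>i::nat \<times> bool. cmod (f (fst i)))"
  define d1 where "d1 = (\<lambda>i::nat \<times> bool. \<bar>cos (\<psi> (fst i))\<bar>)"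
  define d2 where "d2 = (\<lambda>i::nat \<times> bool. \<bar>sin (\<psi> (fst i))\<bar>)"
  define \<gamma> where "\<gamma> = (\<lambda>i::nat \<times> bool. sg (cos (\<psi> (fst i))) (if snd i then Arg (f (fst i)) else Arg (f (fst i)) + pi / 2))"
  define \<delta> where "\<delta> = (\<lambda>i::nat \<times> bool. sg (sin (\<psi> (fst i))) (if snd i then 0 else - pi / 2))"
  have "\<bar>(pd1 ^^ a) ((pd2 ^^ b) \<phi>) (x, y) - (\<Sum>i\<in>I. A i * (wave (d1 i) (\<gamma> i) a x * wave (d2 i) (\<delta> i) b y))\<bar> \<le> \<epsilon>"
    if ab: "a + b \<le> k" and x: "\<bar>x\<bar> \<le> R" and y: "\<bar>y\<bar> \<le> R" for a b x y
  proof -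
    let ?w = "Complex x y"
    have w: "cmod ?w \<le> 2 * R" using cmod_le[of ?w] x y by simp
    have "cmod (ladder_jet (\<lambda>m. g m ?w - (\<Sum>j<Q. f j * plane_wave (\<psi> j) m ?w)) a b 0) \<le> \<epsilon>"
      by (rule norm_ladder_jet_le) (use Q w ab in auto)
    then have C: "cmod (of_real ((pd1 ^^ a) ((pd2 ^^ b) \<phi>) (x, y)) -
        (\<Sum>j<Q. f j * ((\<i> * of_real (cos (\<psi> j))) ^ a * (\<i> * of_real (sin (\<psi> j))) ^ b * plane_wave (\<psi> j) 0 ?w))) \<le> \<epsilon>"
      unfolding ladder_jet_diff_sum gF[symmetric] ladder_jet_plane_wave .
    have "\<bar>(pd1 ^^ a) ((pd2 ^^ b) \<phi>) (x, y) -
        (\<Sum>j<Q. Re (f j * ((\<i> * of_real (cos (\<psi> j))) ^ a * (\<i> * of_real (sin (\<psi> j))) ^ b * plane_wave (\<psi> j) 0 ?w)))\<bar> \<le> \<epsilon>"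
      using order_trans[OF abs_Re_le_cmod C] by (simp only: minus_complex.sel Re_sum Re_complex_of_real)
    also have "(\<Sum>j<Q. Re (f j * ((\<i> * of_real (cos (\<psi> j))) ^ a * (\<i> * of_real (sin (\<psi> j))) ^ b * plane_wave (\<psi> j) 0 ?w))) =
        (\<Sum>j<Q. \<Sum>s\<in>UNIV. A (j, s) * (wave (d1 (j, s)) (\<gamma> (j, s)) a x * wave (d2 (j, s)) (\<delta> (j, s)) b y))"
      unfolding Re_plane_wave_jet A_def d1_def d2_def \<gamma>_def \<delta>_def sg_def
      by (simp add: UNIV_bool wave_abs[symmetric] algebra_simps)
    also have "\<dots> = (\<Sum>i\<in>I. A i * (wave (d1 i) (\<gamma> i) a x * wave (d2 i) (\<delta> i) b y))"
      unfolding I_def sum.cartesian_product by (simp add: case_prod_unfold)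
    finally show ?thesis .
  qed
  moreover have "finite I" by (simp add: I_def)
  moreover have "\<forall>i\<in>I. A i \<ge> 0 \<and> d1 i \<ge> 0 \<and> d2 i \<ge> 0 \<and> (d1 i)\<^sup>2 + (d2 i)\<^sup>2 = 1"
    by (simp add: A_def d1_def d2_def)
  ultimately show ?thesis
    by (intro exI[of _ I] exI[of _ A] exI[of _ d1] exI[of _ d2] exI[of _ \<gamma>] exI[of _ \<delta>] conjI allI impI)
       simp_all
qed

section \<open>Quasi-independent phases\<close>

lemma cis_sum: "finite A \<Longrightarrow> cis (\<Sum>x\<in>A. f x) = (\<Prod>x\<in>A. cis (f x))"
  by (induction A rule: finite_induct) (auto simp: cis_mult[symmetric])

lemma sum_cis_roots:
  assumes "\<bar>k\<bar> < int Q"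
  shows "(\<Sum>i<Q. cis (of_int k * (2 * pi * real i / real Q))) = of_nat Q * of_bool (k = 0)"
proof (cases "k = 0")
  case False
  let ?z = "cis (of_int k * (2 * pi / real Q))"
  have Q: "real Q > 0" using assms by linarith
  have "?z \<noteq> 1"
  proof
    assume "?z = 1"
    then have "cos (of_int k * (2 * pi / real Q)) = 1" by (simp add: complex_eq_iff)
    then obtain n where "of_int k * (2 * pi / real Q) = of_int n * 2 * pi"
      unfolding cos_one_2pi_int by auto
    then have "real_of_int k = of_int n * real Q" using Q by (simp add: field_simps)
    then have "k = n * int Q" by (metis of_int_eq_iff of_int_mult of_int_of_nat_eq)
    then have "int Q dvd k" by simp
    then show False using assms False by (metis dvd_imp_le_int abs_of_nat not_le)
  qed
  moreover have "?z ^ Q = 1"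
  proof -
    have "?z ^ Q = cis (of_int k * (2 * pi))" using Q by (simp add: Complex.DeMoivre)
    then show ?thesis by (metis cis_multiple_2pi Ints_of_int mult.commute)
  qed
  moreover have "cis (of_int k * (2 * pi * real i / real Q)) = ?z ^ i" for i
    by (simp add: Complex.DeMoivre algebra_simps)
  ultimately show ?thesis using False by (simp add: geometric_sum)
qed simp

text \<open>Dissociativity with bounded coefficients: the characters exp(2 pi i m x), m in S, behave
  like independent variables when tested against polynomials of degree at most K in each of them and
  their conjugates.\<close>

definition no_relations :: "int \<Rightarrow> nat set \<Rightarrow> bool" where
  "no_relations K S \<longleftrightarrow> (\<forall>k. (\<forall>m\<in>S. \<bar>k m\<bar> \<le> K) \<longrightarrow> (\<Sum>m\<in>S. k m * int m) = 0 \<longrightarrow> (\<forall>m\<in>S. k m = (0::int)))"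

text \<open>A Riesz product built from Fejer kernels, on the grid of the Q-th roots of unity. The
  factor for m favours base points x = i/Q with 2 pi m x close to a m modulo 2 pi. On a grid all
  averages are finite sums.\<close>

definition fejer_weight :: "nat \<Rightarrow> nat set \<Rightarrow> (nat \<Rightarrow> real) \<Rightarrow> nat \<Rightarrow> nat \<Rightarrow> real" where
  "fejer_weight D S a Q i = (\<Prod>m\<in>S. fejer D (real m * (2 * pi * real i / real Q) - a m)) / real Q"

lemma fejer_weight_nonneg: "fejer_weight D S a Q i \<ge> 0"
  unfolding fejer_weight_def by (intro divide_nonneg_nonneg prod_nonneg fejer_nonneg) auto

text \<open>Expanding the product of Fejer kernels, only frequencies vanishing in every variable survive the
  average over the \<open>Q\<close>-th roots of unity, because the integers in \<open>S\<close> satisfy no short relation.\<close>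

lemma fejer_weight_cis:
  assumes S: "finite S" and nr: "no_relations (int D + 2) S"
    and l: "\<And>m. m \<in> S \<Longrightarrow> \<bar>l m\<bar> \<le> 2" and Q: "int Q > (\<Sum>m\<in>S. (int D + 2) * int m)"
  shows "(\<Sum>i<Q. of_real (fejer_weight D S a Q i) * cis (\<Sum>m\<in>S. of_int (l m) * (real m * (2 * pi * real i / real Q)))) =
     of_real (\<Prod>m\<in>S. fejer_coeff D (l m)) * cis (\<Sum>m\<in>S. of_int (l m) * a m)"
proof -
  let ?B = "{..D} \<times> {..D}"
  let ?d = "\<lambda>p::nat \<times> nat. int (fst p) - int (snd p)"
  let ?c = "\<lambda>m p. cis (- (of_int (?d p) * a m)) / of_nat (D + 1)"
  let ?r = "\<lambda>g. \<Sum>m\<in>S. (?d (g m) + l m) * int m"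
  have finPi: "finite (PiE S (\<lambda>_. ?B))" by (intro finite_PiE S) auto
  have dB: "\<bar>?d p\<bar> \<le> int D" if "p \<in> ?B" for p using that by auto
  \<comment> \<open>The kernels contribute at most D to each coefficient and the tested exponents at
    most 2, which is what second moments of cosines require; hence the bound D + 2 on
    relations.\<close>
  have kb: "\<bar>?d (g m) + l m\<bar> \<le> int D + 2" if "g \<in> PiE S (\<lambda>_. ?B)" "m \<in> S" for g m
    using dB[of "g m"] l[OF that(2)] PiE_mem[OF that] by linarith
  have expand: "of_real (fejer_weight D S a Q i) * cis (\<Sum>m\<in>S. of_int (l m) * (real m * (2 * pi * real i / real Q))) =
     (\<Sum>g\<in>PiE S (\<lambda>_. ?B). (\<Prod>m\<in>S. ?c m (g m)) * cis (of_int (?r g) * (2 * pi * real i / real Q))) / of_nat Q" for i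
  proof -
    let ?x = "2 * pi * real i / real Q"
    have gen: "of_real (fejer D (real m * y - a m)) * cis (of_int (l m) * (real m * y)) =
        (\<Sum>p\<in>?B. ?c m p * cis (of_int ((?d p + l m) * int m) * y))" for m y
      unfolding fejer_expand sum_divide_distrib sum_distrib_right
      by (intro sum.cong refl) (simp add: cis_mult algebra_simps)
    have "of_real (fejer_weight D S a Q i) * cis (\<Sum>m\<in>S. of_int (l m) * (real m * ?x)) =
        (\<Prod>m\<in>S. \<Sum>p\<in>?B. ?c m p * cis (of_int ((?d p + l m) * int m) * ?x)) / of_nat Q"
      by (simp only: gen[of _ ?x, symmetric])
        (simp only: fejer_weight_def cis_sum[OF S] of_real_divide of_real_prod times_divide_eq_left
          prod.distrib of_real_of_nat_eq)
    also have "(\<Prod>m\<in>S. \<Sum>p\<in>?B. ?c m p * cis (of_int ((?d p + l m) * int m) * ?x)) =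
        (\<Sum>g\<in>PiE S (\<lambda>_. ?B). \<Prod>m\<in>S. ?c m (g m) * cis (of_int ((?d (g m) + l m) * int m) * ?x))"
      by (rule prod_sum_PiE[OF S]) auto
    also have "\<dots> = (\<Sum>g\<in>PiE S (\<lambda>_. ?B). (\<Prod>m\<in>S. ?c m (g m)) * cis (of_int (?r g) * ?x))"
      unfolding prod.distrib cis_sum[OF S, symmetric] of_int_sum sum_distrib_right ..
    finally show ?thesis .
  qed
  have Qpos: "Q > 0"
  proof -
    have "(\<Sum>m\<in>S. (int D + 2) * int m) \<ge> 0" by (intro sum_nonneg) auto
    then show ?thesis using Q by simp
  qed
  have avg: "(\<Sum>i<Q. cis (of_int (?r g) * (2 * pi * real i / real Q))) = of_nat Q * (\<Prod>m\<in>S. of_bool (?d (g m) = - l m))"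
    if g: "g \<in> PiE S (\<lambda>_. ?B)" for g
  proof -
    \<comment> \<open>All frequencies lie below Q in absolute value, so the average over the roots
      of unity detects the frequency 0 itself and not just frequencies divisible by Q.\<close>
    have "\<bar>?r g\<bar> \<le> (\<Sum>m\<in>S. \<bar>(?d (g m) + l m) * int m\<bar>)" by (rule sum_abs)
    also have "\<dots> \<le> (\<Sum>m\<in>S. (int D + 2) * int m)"
      unfolding abs_mult using kb[OF g] by (intro sum_mono mult_mono) auto
    finally have "\<bar>?r g\<bar> < int Q" using Q by linarith
    then have "(\<Sum>i<Q. cis (of_int (?r g) * (2 * pi * real i / real Q))) = of_nat Q * of_bool (?r g = 0)"
      by (rule sum_cis_roots)
    also have "?r g = 0 \<longleftrightarrow> (\<forall>m\<in>S. ?d (g m) = - l m)"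
    proof
      assume "?r g = 0"
      then have "\<forall>m\<in>S. ?d (g m) + l m = 0"
        using kb[OF g] by (intro nr[unfolded no_relations_def, rule_format, of "\<lambda>m. ?d (g m) + l m"] ballI)
      then show "\<forall>m\<in>S. ?d (g m) = - l m" by (simp add: eq_neg_iff_add_eq_0)
    qed simp
    also have "of_bool (\<forall>m\<in>S. ?d (g m) = - l m) = (\<Prod>m\<in>S. of_bool (?d (g m) = - l m) :: complex)"
      using S by (auto simp: of_bool_def prod_zero_iff)
    finally show ?thesis .
  qed
  have "(\<Sum>i<Q. of_real (fejer_weight D S a Q i) * cis (\<Sum>m\<in>S. of_int (l m) * (real m * (2 * pi * real i / real Q)))) =
      (\<Sum>g\<in>PiE S (\<lambda>_. ?B). (\<Prod>m\<in>S. ?c m (g m)) * (\<Sum>i<Q. cis (of_int (?r g) * (2 * pi * real i / real Q)))) / of_nat Q"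
    unfolding expand sum_divide_distrib[symmetric] sum_distrib_left by (subst sum.swap) (rule refl)
  also have "\<dots> = (\<Sum>g\<in>PiE S (\<lambda>_. ?B). \<Prod>m\<in>S. ?c m (g m) * of_bool (?d (g m) = - l m))"
    unfolding sum_divide_distrib
  proof (rule sum.cong[OF refl])
    fix g assume "g \<in> PiE S (\<lambda>_. ?B)"
    show "(\<Prod>m\<in>S. ?c m (g m)) * (\<Sum>i<Q. cis (of_int (?r g) * (2 * pi * real i / real Q))) / of_nat Q =
        (\<Prod>m\<in>S. ?c m (g m) * of_bool (?d (g m) = - l m))"
      unfolding avg[OF \<open>g \<in> _\<close>] prod.distrib using Qpos by simp
  qed
  also have "\<dots> = (\<Prod>m\<in>S. \<Sum>p\<in>?B. ?c m p * of_bool (?d p = - l m))"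
    by (rule prod_sum_PiE[OF S, symmetric]) auto
  also have "\<dots> = (\<Prod>m\<in>S. of_real (fejer_coeff D (l m)) * cis (of_int (l m) * a m))"
  proof (rule prod.cong[OF refl])
    fix m
    have "(\<Sum>p\<in>?B. ?c m p * of_bool (?d p = - l m)) = (\<Sum>p\<in>?B. of_real (of_bool (?d p = - l m) / real (D + 1)) * cis (of_int (l m) * a m))"
    proof (rule sum.cong[OF refl])
      fix p
      show "?c m p * of_bool (?d p = - l m) = of_real (of_bool (?d p = - l m) / real (D + 1)) * cis (of_int (l m) * a m)"
      proof (cases "?d p = - l m")
        case True
        show ?thesis unfolding True by simp
      qed simp
    qed
    also have "\<dots> = of_real (fejer_coeff D (- l m)) * cis (of_int (l m) * a m)"
      by (simp only: fejer_coeff_def sum_divide_distrib of_real_sum sum_distrib_right)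
    finally show "(\<Sum>p\<in>?B. ?c m p * of_bool (?d p = - l m)) = of_real (fejer_coeff D (l m)) * cis (of_int (l m) * a m)"
      by (simp only: fejer_coeff_minus)
  qed
  also have "\<dots> = of_real (\<Prod>m\<in>S. fejer_coeff D (l m)) * cis (\<Sum>m\<in>S. of_int (l m) * a m)"
    by (simp add: prod.distrib cis_sum[OF S])
  finally show ?thesis .
qed

lemma fejer_weight_cos:
  assumes S: "finite S" and nr: "no_relations (int D + 2) S"
    and l: "\<And>m. m \<in> S \<Longrightarrow> \<bar>l m\<bar> \<le> 2" and Q: "int Q > (\<Sum>m\<in>S. (int D + 2) * int m)"
  shows "(\<Sum>i<Q. fejer_weight D S a Q i * cos ((\<Sum>m\<in>S. of_int (l m) * (real m * (2 * pi * real i / real Q))) + \<sigma>)) =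
     (\<Prod>m\<in>S. fejer_coeff D (l m)) * cos ((\<Sum>m\<in>S. of_int (l m) * a m) + \<sigma>)"
proof -
  have "Re ((\<Sum>i<Q. of_real (fejer_weight D S a Q i) * cis (\<Sum>m\<in>S. of_int (l m) * (real m * (2 * pi * real i / real Q)))) * cis \<sigma>) =
     Re ((of_real (\<Prod>m\<in>S. fejer_coeff D (l m)) * cis (\<Sum>m\<in>S. of_int (l m) * a m)) * cis \<sigma>)"
    by (simp only: fejer_weight_cis[OF assms])
  then show ?thesis
    by (simp only: sum_distrib_right mult.assoc cis_mult Re_sum Re_complex_of_real Re_mult_of_real_cis)
qed

text \<open>First and second moments of the cosines under a probability weight: prescribed damped
  means, exact pairwise uncorrelatedness, variance at most \<delta>. The shift \<sigma> is arbitrary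
  because derivatives and boundary conditions shift phases by multiples of pi/2.\<close>

definition concentrated_phases :: "nat set \<Rightarrow> (nat \<Rightarrow> real) \<Rightarrow> real \<Rightarrow> real \<Rightarrow> nat \<Rightarrow> (nat \<Rightarrow> real) \<Rightarrow> bool" where
  "concentrated_phases S a \<kappa> \<delta> Q w \<longleftrightarrow> (\<forall>i. w i \<ge> 0) \<and> (\<Sum>i<Q. w i) = 1 \<and>
    (\<forall>m\<in>S. \<forall>\<sigma>. (\<Sum>i<Q. w i * cos (2 * pi * real m * (real i / real Q) + \<sigma>)) = \<kappa> * cos (a m + \<sigma>)) \<and>
    (\<forall>m\<in>S. \<forall>m'\<in>S. m \<noteq> m' \<longrightarrow> (\<forall>\<sigma>. (\<Sum>i<Q. w i * (cos (2 * pi * real m * (real i / real Q) + \<sigma>) *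
        cos (2 * pi * real m' * (real i / real Q) + \<sigma>))) = (\<kappa> * cos (a m + \<sigma>)) * (\<kappa> * cos (a m' + \<sigma>)))) \<and>
    (\<forall>m\<in>S. \<forall>\<sigma>. (\<Sum>i<Q. w i * (cos (2 * pi * real m * (real i / real Q) + \<sigma>))\<^sup>2) \<le> (\<kappa> * cos (a m + \<sigma>))\<^sup>2 + \<delta>)"

text \<open>The moments come from testing the weight with exponents supported on one or two elements
  of S: 1 for the mean, 2 for the square, and 1, 1 or 1, -1 for a product of two cosines.\<close>

lemma fejer_weight_moments:
  assumes S: "finite S" and nr: "no_relations (int D + 2) S" and D: "D \<ge> 1"
  defines "\<kappa> \<equiv> real D / real (D + 1)"
  shows "\<exists>Q w. concentrated_phases S a \<kappa> (1 / real (D + 1)) Q w"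
proof -
  define Q where "Q = nat ((\<Sum>m\<in>S. (int D + 2) * int m) + 1)"
  have "(\<Sum>m\<in>S. (int D + 2) * int m) \<ge> 0" by (intro sum_nonneg) auto
  then have Q: "int Q > (\<Sum>m\<in>S. (int D + 2) * int m)" by (simp add: Q_def)
  define w where "w = fejer_weight D S a Q"
  define \<theta> where "\<theta> = (\<lambda>i. 2 * pi * real i / real Q)"
  have fc0: "fejer_coeff D 0 = 1" using fejer_coeff_nat[of D 0] by simp
  have fc1: "fejer_coeff D 1 = \<kappa>" "fejer_coeff D (- 1) = \<kappa>"
    using fejer_coeff_nat[of D 1] fejer_coeff_minus[of D 1] by (simp_all add: \<kappa>_def)
  define e where "e = 1 / real (D + 1)"
  have \<kappa>e: "\<kappa> = 1 - e" by (simp add: \<kappa>_def e_def field_simps)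
  have fc2: "fejer_coeff D 2 = 1 - 2 * e"
    using fejer_coeff_nat[of D 2] D by (simp add: e_def field_simps of_nat_diff)
  note cosw = fejer_weight_cos[OF S nr _ Q, where a = a, folded w_def]
  have w1: "(\<Sum>i<Q. w i) = 1"
    using cosw[of "\<lambda>_. 0" 0] by (simp add: fc0)
  have one: "(\<Sum>i<Q. w i * cos (of_int u * (real m * \<theta> i) + \<sigma>)) = fejer_coeff D u * cos (of_int u * a m + \<sigma>)"
    if m: "m \<in> S" and u: "\<bar>u\<bar> \<le> 2" for m u \<sigma>
  proof -
    let ?l = "\<lambda>k. if k = m then u else 0"
    have s: "(\<Sum>k\<in>S. of_int (?l k) * f k) = of_int u * f m" for f :: "nat \<Rightarrow> real"
      using sum.remove[OF S m, of "\<lambda>k. of_int (?l k) * f k"] by (simp add: sum.neutral)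
    have p: "(\<Prod>k\<in>S. fejer_coeff D (?l k)) = fejer_coeff D u"
      using prod.remove[OF S m, of "\<lambda>k. fejer_coeff D (?l k)"] by (simp add: prod.neutral fc0)
    show ?thesis
      using cosw[of ?l \<sigma>] u unfolding s p \<theta>_def by simp
  qed
  have two: "(\<Sum>i<Q. w i * cos (of_int u * (real m * \<theta> i) + of_int v * (real m' * \<theta> i) + \<sigma>)) =
      fejer_coeff D u * fejer_coeff D v * cos (of_int u * a m + of_int v * a m' + \<sigma>)"
    if m: "m \<in> S" and m': "m' \<in> S" "m \<noteq> m'" and uv: "\<bar>u\<bar> \<le> 2" "\<bar>v\<bar> \<le> 2" for m m' u v \<sigma>
  proof -
    let ?l = "\<lambda>k. if k = m then u else if k = m' then v else 0"
    have S': "finite (S - {m})" "m' \<in> S - {m}" using S m' by auto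
    have s: "(\<Sum>k\<in>S. of_int (?l k) * f k) = of_int u * f m + of_int v * f m'" for f :: "nat \<Rightarrow> real"
      using sum.remove[OF S m, of "\<lambda>k. of_int (?l k) * f k"] sum.remove[OF S', of "\<lambda>k. of_int (?l k) * f k"] m'
      by (simp add: sum.neutral)
    have p: "(\<Prod>k\<in>S. fejer_coeff D (?l k)) = fejer_coeff D u * fejer_coeff D v"
      using prod.remove[OF S m, of "\<lambda>k. fejer_coeff D (?l k)"] prod.remove[OF S', of "\<lambda>k. fejer_coeff D (?l k)"] m'
      by (simp add: prod.neutral fc0)
    show ?thesis
      using cosw[of ?l \<sigma>] uv unfolding s p \<theta>_def by simp
  qed
  have \<theta>: "2 * pi * real m * (real i / real Q) = real m * \<theta> i" for m i by (simp add: \<theta>_def)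
  show ?thesis
  proof (rule exI[of _ Q], rule exI[of _ w], unfold concentrated_phases_def \<theta>, intro conjI ballI allI impI)
    show "w i \<ge> 0" for i by (simp add: w_def fejer_weight_nonneg)
    show "(\<Sum>i<Q. w i) = 1" by (rule w1)
    show "(\<Sum>i<Q. w i * cos (real m * \<theta> i + \<sigma>)) = \<kappa> * cos (a m + \<sigma>)" if "m \<in> S" for m \<sigma>
      using one[OF that, of 1 \<sigma>] by (simp add: fc1)
    fix m \<sigma> assume m: "m \<in> S"
    show "(\<Sum>i<Q. w i * (cos (real m * \<theta> i + \<sigma>) * cos (real m' * \<theta> i + \<sigma>))) =
        (\<kappa> * cos (a m + \<sigma>)) * (\<kappa> * cos (a m' + \<sigma>))" if m': "m' \<in> S" "m \<noteq> m'" for m'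
    proof -
      have "(\<Sum>i<Q. w i * (cos (real m * \<theta> i + \<sigma>) * cos (real m' * \<theta> i + \<sigma>))) =
          ((\<Sum>i<Q. w i * cos (of_int 1 * (real m * \<theta> i) + of_int (- 1) * (real m' * \<theta> i) + 0)) +
           (\<Sum>i<Q. w i * cos (of_int 1 * (real m * \<theta> i) + of_int 1 * (real m' * \<theta> i) + 2 * \<sigma>))) / 2"
        unfolding sum.distrib[symmetric] sum_divide_distrib
        by (intro sum.cong refl, subst cos_times_cos) (simp add: algebra_simps)
      also have "\<dots> = (\<kappa> * \<kappa> * cos (a m - a m') + \<kappa> * \<kappa> * cos (a m + a m' + 2 * \<sigma>)) / 2"
        using two[OF m m', of 1 "-1" 0] two[OF m m', of 1 1 "2 * \<sigma>"] by (simp add: fc1)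
      also have "\<dots> = (\<kappa> * cos (a m + \<sigma>)) * (\<kappa> * cos (a m' + \<sigma>))"
        using cos_times_cos[of "a m + \<sigma>" "a m' + \<sigma>"] by (simp add: algebra_simps)
      finally show ?thesis .
    qed
    have sq: "(cos t)\<^sup>2 = (1 + cos (2 * t)) / 2" for t :: real
      using cos_double_cos[of t] by simp
    have "(\<Sum>i<Q. w i * (cos (real m * \<theta> i + \<sigma>))\<^sup>2) =
        ((\<Sum>i<Q. w i) + (\<Sum>i<Q. w i * cos (of_int 2 * (real m * \<theta> i) + 2 * \<sigma>))) / 2"
      unfolding sum.distrib[symmetric] sum_divide_distrib
      by (intro sum.cong refl) (simp add: sq algebra_simps)
    also have "\<dots> = (1 + (1 - 2 * e) * cos (2 * (a m + \<sigma>))) / 2"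
      unfolding w1 using one[OF m, of 2 "2 * \<sigma>"] by (simp only: fc2) (simp add: algebra_simps)
    also have "\<dots> = (1 - 2 * e) * (cos (a m + \<sigma>))\<^sup>2 + e"
      unfolding sq by (simp add: field_simps)
    \<comment> \<open>With e = 1/(D+1) the kernel has coefficients 1 - e and 1 - 2e at the
      frequencies 1 and 2. Since 1 - 2e \<le> (1 - e)^2, the variance is at most e.\<close>
    also have "\<dots> \<le> \<kappa>\<^sup>2 * (cos (a m + \<sigma>))\<^sup>2 + e"
    proof -
      have "\<kappa>\<^sup>2 = 1 - 2 * e + e\<^sup>2" unfolding \<kappa>e by (simp add: power2_eq_square algebra_simps)
      then have "1 - 2 * e \<le> \<kappa>\<^sup>2" by simp
      then show ?thesis by (intro add_right_mono mult_right_mono) auto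
    qed
    finally show "(\<Sum>i<Q. w i * (cos (real m * \<theta> i + \<sigma>))\<^sup>2) \<le> (\<kappa> * cos (a m + \<sigma>))\<^sup>2 + 1 / real (D + 1)"
      by (simp add: power_mult_distrib e_def)
  qed
qed

section \<open>Variance under independent weights in the two variables\<close>

lemma sum_square_expand:
  fixes f :: "'a \<Rightarrow> real"
  shows "(\<Sum>q\<in>P. f q)\<^sup>2 = (\<Sum>q\<in>P. \<Sum>q'\<in>P. f q * f q')"
  by (simp add: power2_eq_square sum_product)

text \<open>The two variables are averaged independently, so distinct products stay uncorrelated and
  only the diagonal contributes. There E(X^2) E(Y^2) \<le> (x^2 + \<delta>) E(Y^2), and E(Y^2) is at
  most y^2 + \<delta> and at most 1, so x^2 y^2 is exceeded by at most 2 \<delta>. The size of P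
  enters only through the coefficients v.\<close>

lemma product_variance_le:
  fixes w1 w2 :: "nat \<Rightarrow> real" and X Y :: "'a \<Rightarrow> nat \<Rightarrow> real" and x y v :: "'a \<Rightarrow> real"
  assumes P: "finite P" and w: "\<And>i. w1 i \<ge> 0" "\<And>j. w2 j \<ge> 0" "(\<Sum>i<n1. w1 i) = 1" "(\<Sum>j<n2. w2 j) = 1"
    and X1: "\<And>q. q \<in> P \<Longrightarrow> (\<Sum>i<n1. w1 i * X q i) = x q"
    and Y1: "\<And>q. q \<in> P \<Longrightarrow> (\<Sum>j<n2. w2 j * Y q j) = y q"
    and X2: "\<And>q q'. q \<in> P \<Longrightarrow> q' \<in> P \<Longrightarrow> q \<noteq> q' \<Longrightarrow> (\<Sum>i<n1. w1 i * (X q i * X q' i)) = x q * x q'"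
    and Y2: "\<And>q q'. q \<in> P \<Longrightarrow> q' \<in> P \<Longrightarrow> q \<noteq> q' \<Longrightarrow> (\<Sum>j<n2. w2 j * (Y q j * Y q' j)) = y q * y q'"
    and XX: "\<And>q. q \<in> P \<Longrightarrow> (\<Sum>i<n1. w1 i * (X q i)\<^sup>2) \<le> (x q)\<^sup>2 + \<delta>"
    and YY: "\<And>q. q \<in> P \<Longrightarrow> (\<Sum>j<n2. w2 j * (Y q j)\<^sup>2) \<le> (y q)\<^sup>2 + \<delta>"
    and bd: "\<And>q i. \<bar>X q i\<bar> \<le> 1" "\<And>q j. \<bar>Y q j\<bar> \<le> 1" "\<And>q. \<bar>x q\<bar> \<le> 1" and \<delta>: "\<delta> \<ge> 0"
  shows "(\<Sum>i<n1. \<Sum>j<n2. w1 i * w2 j * (\<Sum>q\<in>P. v q * (X q i * Y q j - x q * y q))\<^sup>2) \<le> 2 * \<delta> * (\<Sum>q\<in>P. (v q)\<^sup>2)"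
proof -
  let ?E = "\<lambda>f. \<Sum>i<n1. \<Sum>j<n2. w1 i * w2 j * f i j"
  have Epr: "?E (\<lambda>i j. f i * g j) = (\<Sum>i<n1. w1 i * f i) * (\<Sum>j<n2. w2 j * g j)" for f g
    by (simp add: sum_product mult_ac)
  have E1: "?E (\<lambda>i j. X q i * Y q j) = x q * y q" if "q \<in> P" for q
    unfolding Epr using X1 Y1 that by simp
  have Ec: "?E (\<lambda>i j. c) = c" for c
    using Epr[of "\<lambda>_. c" "\<lambda>_. 1"] w by (simp add: sum_distrib_right[symmetric])
  define Z where "Z = (\<lambda>q i j. X q i * Y q j - x q * y q)"
  have EZ: "?E (\<lambda>i j. Z q i j * Z q' i j) =
      (\<Sum>i<n1. w1 i * (X q i * X q' i)) * (\<Sum>j<n2. w2 j * (Y q j * Y q' j)) - x q * y q * (x q' * y q')"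
    if q: "q \<in> P" "q' \<in> P" for q q'
  proof -
    have "?E (\<lambda>i j. Z q i j * Z q' i j) = ?E (\<lambda>i j. (X q i * X q' i) * (Y q j * Y q' j))
        - x q' * y q' * ?E (\<lambda>i j. X q i * Y q j) - x q * y q * ?E (\<lambda>i j. X q' i * Y q' j) + ?E (\<lambda>i j. x q * y q * (x q' * y q'))"
      unfolding Z_def sum_distrib_left sum_subtractf[symmetric] sum.distrib[symmetric]
      by (intro sum.cong refl) (simp add: algebra_simps)
    then show ?thesis unfolding E1[OF q(1)] E1[OF q(2)] Ec Epr by simp
  qed
  have diag: "?E (\<lambda>i j. Z q i j * Z q i j) \<le> 2 * \<delta>" if q: "q \<in> P" for q
  proof -
    let ?A = "\<Sum>i<n1. w1 i * (X q i)\<^sup>2" and ?B = "\<Sum>j<n2. w2 j * (Y q j)\<^sup>2"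
    have B1: "?B \<le> 1"
    proof -
      have "(Y q j)\<^sup>2 \<le> 1" for j using bd(2)[of q j] by (simp add: abs_square_le_1)
      then have "?B \<le> (\<Sum>j<n2. w2 j * 1)" using w by (intro sum_mono mult_left_mono) auto
      then show ?thesis using w by simp
    qed
    have B0: "?B \<ge> 0" using w by (intro sum_nonneg mult_nonneg_nonneg) auto
    have x1: "(x q)\<^sup>2 \<le> 1" using bd(3)[of q] by (simp add: abs_square_le_1)
    have "?A * ?B \<le> ((x q)\<^sup>2 + \<delta>) * ?B" using XX[OF q] B0 by (intro mult_right_mono)
    also have "\<dots> = (x q)\<^sup>2 * ?B + \<delta> * ?B" by (simp add: algebra_simps)
    also have "\<dots> \<le> (x q)\<^sup>2 * ((y q)\<^sup>2 + \<delta>) + \<delta> * 1"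
      using YY[OF q] B1 \<delta> by (intro add_mono mult_left_mono) auto
    also have "\<dots> = (x q)\<^sup>2 * (y q)\<^sup>2 + (x q)\<^sup>2 * \<delta> + \<delta>" by (simp add: algebra_simps)
    also have "(x q)\<^sup>2 * \<delta> \<le> 1 * \<delta>" using x1 \<delta> by (intro mult_right_mono)
    finally show ?thesis
      unfolding EZ[OF q q] by (simp add: power2_eq_square mult_ac)
  qed
  have off: "?E (\<lambda>i j. Z q i j * Z q' i j) = 0" if "q \<in> P" "q' \<in> P" "q \<noteq> q'" for q q'
    unfolding EZ[OF that(1,2)] X2[OF that] Y2[OF that] by simp
  have "?E (\<lambda>i j. (\<Sum>q\<in>P. v q * Z q i j)\<^sup>2) = (\<Sum>q\<in>P. \<Sum>q'\<in>P. v q * v q' * ?E (\<lambda>i j. Z q i j * Z q' i j))"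
  proof -
    have "?E (\<lambda>i j. (\<Sum>q\<in>P. v q * Z q i j)\<^sup>2) =
       (\<Sum>i<n1. \<Sum>j<n2. \<Sum>q\<in>P. \<Sum>q'\<in>P. v q * v q' * (w1 i * w2 j * (Z q i j * Z q' i j)))"
      unfolding sum_square_expand sum_distrib_left by (intro sum.cong refl) (simp add: mult_ac)
    also have "\<dots> = (\<Sum>i<n1. \<Sum>q\<in>P. \<Sum>q'\<in>P. \<Sum>j<n2. v q * v q' * (w1 i * w2 j * (Z q i j * Z q' i j)))"
      by (subst sum.swap, subst (2) sum.swap) (rule refl)
    also have "\<dots> = (\<Sum>q\<in>P. \<Sum>q'\<in>P. \<Sum>i<n1. \<Sum>j<n2. v q * v q' * (w1 i * w2 j * (Z q i j * Z q' i j)))"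
      by (subst sum.swap, subst (2) sum.swap) (rule refl)
    finally show ?thesis by (simp only: sum_distrib_left)
  qed
  also have "\<dots> \<le> (\<Sum>q\<in>P. \<Sum>q'\<in>P. if q = q' then (v q)\<^sup>2 * (2 * \<delta>) else 0)"
  proof (intro sum_mono)
    fix q q' assume q: "q \<in> P" "q' \<in> P"
    show "v q * v q' * ?E (\<lambda>i j. Z q i j * Z q' i j) \<le> (if q = q' then (v q)\<^sup>2 * (2 * \<delta>) else 0)"
    proof (cases "q = q'")
      case True
      have "(v q)\<^sup>2 * ?E (\<lambda>i j. Z q i j * Z q i j) \<le> (v q)\<^sup>2 * (2 * \<delta>)"
        using diag[OF q(1)] by (intro mult_left_mono) auto
      then show ?thesis using True by (simp add: power2_eq_square)
    next
      case False
      then show ?thesis using off[OF q False] by simp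
    qed
  qed
  also have "\<dots> = 2 * \<delta> * (\<Sum>q\<in>P. (v q)\<^sup>2)"
    using P by (simp add: sum_distrib_left mult_ac)
  finally show ?thesis by (simp add: Z_def)
qed

text \<open>A weighted sum over all k of the squared fluctuations has small mean, so some single
  base point is good for all k together. Phases are prescribed per coordinate, so distinct points of
  P must differ in both coordinates, as lattice points with positive coordinates on one circle
  do.\<close>

lemma ex_small_fluctuation:
  fixes P :: "(nat \<times> nat) set" and c :: "'k \<Rightarrow> nat \<times> nat \<Rightarrow> real" and \<alpha> \<beta> :: "nat \<Rightarrow> real" and \<sigma> \<tau> \<rho> :: "'k \<Rightarrow> real"
  assumes P: "finite P" "inj_on fst P" "inj_on snd P" and S: "finite S" "fst ` P \<subseteq> S" "snd ` P \<subseteq> S"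
    and nr: "no_relations (int D + 2) S" and D: "D \<ge> 1"
    and c: "\<And>k. k \<in> I \<Longrightarrow> (\<Sum>q\<in>P. (c k q)\<^sup>2) \<le> V" and \<rho>: "\<And>k. k \<in> I \<Longrightarrow> \<rho> k \<ge> 0"
  defines "\<kappa> \<equiv> real D / real (D + 1)"
  shows "\<exists>x y. 0 \<le> x \<and> x < 1 \<and> 0 \<le> y \<and> y < 1 \<and>
    (\<Sum>k\<in>I. \<rho> k * (\<Sum>q\<in>P. c k q * (cos (2 * pi * real (fst q) * x + \<sigma> k) * cos (2 * pi * real (snd q) * y + \<tau> k)
       - (\<kappa> * cos (\<alpha> (fst q) + \<sigma> k)) * (\<kappa> * cos (\<beta> (snd q) + \<tau> k))))\<^sup>2) \<le> 2 * V / real (D + 1) * (\<Sum>k\<in>I. \<rho> k)"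
proof -
  obtain Q1 w1 where "concentrated_phases S \<alpha> \<kappa> (1 / real (D + 1)) Q1 w1"
    using fejer_weight_moments[OF S(1) nr D, of \<alpha>, folded \<kappa>_def] by (elim exE) (rule that)
  note c1 = this[unfolded concentrated_phases_def]
  note w1 = c1[THEN conjunct1] c1[THEN conjunct2, THEN conjunct1]
  note w1m = c1[THEN conjunct2, THEN conjunct2, THEN conjunct1]
    c1[THEN conjunct2, THEN conjunct2, THEN conjunct2, THEN conjunct1]
    c1[THEN conjunct2, THEN conjunct2, THEN conjunct2, THEN conjunct2]
  obtain Q2 w2 where "concentrated_phases S \<beta> \<kappa> (1 / real (D + 1)) Q2 w2"
    using fejer_weight_moments[OF S(1) nr D, of \<beta>, folded \<kappa>_def] by (elim exE) (rule that)
  note c2 = this[unfolded concentrated_phases_def]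
  note w2 = c2[THEN conjunct1] c2[THEN conjunct2, THEN conjunct1]
  note w2m = c2[THEN conjunct2, THEN conjunct2, THEN conjunct1]
    c2[THEN conjunct2, THEN conjunct2, THEN conjunct2, THEN conjunct1]
    c2[THEN conjunct2, THEN conjunct2, THEN conjunct2, THEN conjunct2]
  define F where "F = (\<lambda>k i j. (\<Sum>q\<in>P. c k q * (cos (2 * pi * real (fst q) * (real i / real Q1) + \<sigma> k) * cos (2 * pi * real (snd q) * (real j / real Q2) + \<tau> k)
       - (\<kappa> * cos (\<alpha> (fst q) + \<sigma> k)) * (\<kappa> * cos (\<beta> (snd q) + \<tau> k))))\<^sup>2)"
  define Bd where "Bd = 2 * V / real (D + 1) * (\<Sum>k\<in>I. \<rho> k)"
  have k1: "0 \<le> \<kappa>" "\<kappa> \<le> 1" by (auto simp: \<kappa>_def)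
  have S1: "fst q \<in> S" "snd q \<in> S" if "q \<in> P" for q using S that by auto
  have "(\<Sum>i<Q1. \<Sum>j<Q2. w1 i * w2 j * F k i j) \<le> 2 * (1 / real (D + 1)) * (\<Sum>q\<in>P. (c k q)\<^sup>2)" for k
    unfolding F_def
  proof (rule product_variance_le[OF P(1)])
    show "\<bar>\<kappa> * cos (\<alpha> (fst q) + \<sigma> k)\<bar> \<le> 1" for q :: "nat \<times> nat"
      using k1 abs_cos_le_one mult_mono[of \<kappa> 1 "\<bar>cos (\<alpha> (fst q) + \<sigma> k)\<bar>" 1] by (simp add: abs_mult)
    fix q q' assume q: "q \<in> P" "q' \<in> P" "q \<noteq> q'"
    then have "fst q \<noteq> fst q'" "snd q \<noteq> snd q'" using P(2,3) by (auto dest: inj_onD)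
    then show "(\<Sum>i<Q1. w1 i * (cos (2 * pi * real (fst q) * (real i / real Q1) + \<sigma> k) * cos (2 * pi * real (fst q') * (real i / real Q1) + \<sigma> k))) =
        (\<kappa> * cos (\<alpha> (fst q) + \<sigma> k)) * (\<kappa> * cos (\<alpha> (fst q') + \<sigma> k))"
      "(\<Sum>i<Q2. w2 i * (cos (2 * pi * real (snd q) * (real i / real Q2) + \<tau> k) * cos (2 * pi * real (snd q') * (real i / real Q2) + \<tau> k))) =
        (\<kappa> * cos (\<beta> (snd q) + \<tau> k)) * (\<kappa> * cos (\<beta> (snd q') + \<tau> k))"
      using w1m(2)[rule_format, of "fst q" "fst q'"] w2m(2)[rule_format, of "snd q" "snd q'"] S1 q by simp_all
  qed (use w1 w2 w1m w2m S1 in auto)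
  moreover have "2 * (1 / real (D + 1)) * (\<Sum>q\<in>P. (c k q)\<^sup>2) \<le> 2 * V / real (D + 1)" if "k \<in> I" for k
    using mult_left_mono[OF c[OF that], of "2 * (1 / real (D + 1))"] by simp
  ultimately have Ek: "(\<Sum>i<Q1. \<Sum>j<Q2. w1 i * w2 j * F k i j) \<le> 2 * V / real (D + 1)" if "k \<in> I" for k
    using that order_trans by blast
  have "(\<Sum>i<Q1. \<Sum>j<Q2. w1 i * w2 j * (\<Sum>k\<in>I. \<rho> k * F k i j)) = (\<Sum>k\<in>I. \<rho> k * (\<Sum>i<Q1. \<Sum>j<Q2. w1 i * w2 j * F k i j))"
  proof -
    have "(\<Sum>i<Q1. \<Sum>j<Q2. w1 i * w2 j * (\<Sum>k\<in>I. \<rho> k * F k i j)) = (\<Sum>i<Q1. \<Sum>j<Q2. \<Sum>k\<in>I. \<rho> k * (w1 i * w2 j * F k i j))"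
      unfolding sum_distrib_left by (intro sum.cong refl) (simp add: mult_ac)
    also have "\<dots> = (\<Sum>i<Q1. \<Sum>k\<in>I. \<Sum>j<Q2. \<rho> k * (w1 i * w2 j * F k i j))"
      by (subst sum.swap) (rule refl)
    also have "\<dots> = (\<Sum>k\<in>I. \<Sum>i<Q1. \<Sum>j<Q2. \<rho> k * (w1 i * w2 j * F k i j))"
      by (rule sum.swap)
    finally show ?thesis by (simp only: sum_distrib_left)
  qed
  also have "\<dots> \<le> (\<Sum>k\<in>I. \<rho> k * (2 * V / real (D + 1)))"
    using Ek \<rho> by (intro sum_mono mult_left_mono) auto
  also have "\<dots> = Bd" unfolding Bd_def by (subst mult.commute) (rule sum_distrib_right[symmetric])
  finally have avg: "(\<Sum>i<Q1. \<Sum>j<Q2. w1 i * w2 j * (\<Sum>k\<in>I. \<rho> k * F k i j)) \<le> Bd" .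
  have "\<exists>i<Q1. \<exists>j<Q2. (\<Sum>k\<in>I. \<rho> k * F k i j) \<le> Bd"
  proof (rule ccontr)
    assume "\<not> ?thesis"
    then have big: "Bd < (\<Sum>k\<in>I. \<rho> k * F k i j)" if "i < Q1" "j < Q2" for i j using that by force
    have tot: "(\<Sum>i<Q1. \<Sum>j<Q2. w1 i * w2 j) = 1"
      using w1(2) w2(2) by (simp flip: sum_product)
    have "(\<Sum>i<Q1. \<Sum>j<Q2. w1 i * w2 j * ((\<Sum>k\<in>I. \<rho> k * F k i j) - Bd)) = (\<Sum>i<Q1. \<Sum>j<Q2. w1 i * w2 j * (\<Sum>k\<in>I. \<rho> k * F k i j)) - (\<Sum>i<Q1. \<Sum>j<Q2. w1 i * w2 j) * Bd"
      by (simp add: right_diff_distrib sum_subtractf sum_distrib_right)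
    then have le0: "(\<Sum>i<Q1. \<Sum>j<Q2. w1 i * w2 j * ((\<Sum>k\<in>I. \<rho> k * F k i j) - Bd)) \<le> 0"
      using avg tot by simp
    have nn: "w1 i * w2 j * ((\<Sum>k\<in>I. \<rho> k * F k i j) - Bd) \<ge> 0" if "i < Q1" "j < Q2" for i j
      using w1(1) w2(1) big[OF that] by simp
    have "w1 i * w2 j = 0" if ij: "i < Q1" "j < Q2" for i j
    proof -
      let ?g = "\<lambda>i j. w1 i * w2 j * ((\<Sum>k\<in>I. \<rho> k * F k i j) - Bd)"
      have nn1: "0 \<le> (\<Sum>j<Q2. ?g i j)" if "i \<in> {..<Q1}" for i
        using nn that by (intro sum_nonneg) simp
      have "(\<Sum>i<Q1. \<Sum>j<Q2. ?g i j) = 0"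
        by (rule antisym[OF le0 sum_nonneg]) (rule nn1)
      from iffD1[OF sum_nonneg_eq_0_iff[OF finite_lessThan nn1] this] ij(1)
      have i0: "(\<Sum>j<Q2. ?g i j) = 0" by blast
      have nn2: "0 \<le> ?g i j" if "j \<in> {..<Q2}" for j
        using nn[OF ij(1)] that by simp
      from iffD1[OF sum_nonneg_eq_0_iff[OF finite_lessThan nn2] i0] ij(2)
      have "?g i j = 0" by blast
      then show ?thesis using big[OF ij] by simp
    qed
    then have "(\<Sum>i<Q1. \<Sum>j<Q2. w1 i * w2 j) = 0" by (intro sum.neutral ballI) auto
    then show False using tot by simp
  qed
  then obtain i j where ij: "i < Q1" "j < Q2" "(\<Sum>k\<in>I. \<rho> k * F k i j) \<le> Bd" by blast
  show ?thesis
    by (rule exI[of _ "real i / real Q1"], rule exI[of _ "real j / real Q2"])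
       (use ij in \<open>auto simp: F_def Bd_def\<close>)
qed

section \<open>Lattice points on circles of odd prime power norm\<close>

text \<open>Thue's argument: among the (r + 1)^2 > p numbers u + s v with u, v at most r =
  floor(sqrt p), two agree modulo p. Their difference (a, b) has a^2 + b^2 divisible by p and
  strictly between 0 and 2p.\<close>

lemma prime_dvd_square_plus_one_sum_squares:
  fixes p s :: nat
  assumes p: "prime p" and s: "p dvd s\<^sup>2 + 1"
  shows "\<exists>a b. p = a\<^sup>2 + b\<^sup>2"
proof -
  define r where "r = nat \<lfloor>sqrt (real p)\<rfloor>"
  have r: "real r \<le> sqrt p" "sqrt p < real r + 1" by (auto simp: r_def)
  have "(real r)\<^sup>2 \<le> (sqrt p)\<^sup>2" using r(1) by (intro power_mono) auto
  then have "r\<^sup>2 \<le> p" by (simp flip: of_nat_power)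
  moreover have "r\<^sup>2 \<noteq> p"
    using p prime_power_iff[of r 2] by auto
  ultimately have r1: "r\<^sup>2 < p" by simp
  have "(sqrt p)\<^sup>2 < (real (r + 1))\<^sup>2" using r(2) by (intro power_strict_mono) auto
  then have "real p < real ((r + 1)\<^sup>2)" by simp
  then have r2: "p < (r + 1)\<^sup>2" by (simp only: of_nat_less_iff)
  let ?f = "\<lambda>(u, v). (int u + int s * int v) mod int p"
  have "\<not> inj_on ?f ({..r} \<times> {..r})"
  proof
    assume "inj_on ?f ({..r} \<times> {..r})"
    moreover have "?f ` ({..r} \<times> {..r}) \<subseteq> {0..<int p}"
      using p prime_gt_0_nat by auto
    ultimately have "card ({..r} \<times> {..r}) \<le> card {0..<int p}"
      by (intro card_inj_on_le) auto
    then show False using r2 by (simp add: power2_eq_square)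
  qed
  then obtain u v u' v' where uv: "u \<le> r" "v \<le> r" "u' \<le> r" "v' \<le> r" "(u, v) \<noteq> (u', v')"
    and eq: "(int u + int s * int v) mod int p = (int u' + int s * int v') mod int p"
    unfolding inj_on_def by auto
  define a where "a = int u - int u'"
  define b where "b = int v - int v'"
  have "int p dvd a + int s * b"
    using eq unfolding a_def b_def by (simp add: mod_eq_dvd_iff algebra_simps)
  then have "int p dvd (a + int s * b) * (a - int s * b)" by simp
  moreover have "int p dvd (int s ^ 2 + 1) * b\<^sup>2"
    using s by (metis dvd_mult2 of_nat_1 of_nat_add of_nat_dvd_iff of_nat_power)
  ultimately have "int p dvd (a + int s * b) * (a - int s * b) + (int s ^ 2 + 1) * b\<^sup>2" by simp
  also have "(a + int s * b) * (a - int s * b) + (int s ^ 2 + 1) * b\<^sup>2 = a\<^sup>2 + b\<^sup>2"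
    by (simp add: power2_eq_square algebra_simps)
  finally obtain q where q: "a\<^sup>2 + b\<^sup>2 = int p * q" by blast
  have "a\<^sup>2 + b\<^sup>2 > 0" using uv by (auto simp: a_def b_def sum_power2_gt_zero_iff)
  moreover have "\<bar>a\<bar> \<le> int r" "\<bar>b\<bar> \<le> int r" using uv by (auto simp: a_def b_def)
  then have "a\<^sup>2 \<le> (int r)\<^sup>2" "b\<^sup>2 \<le> (int r)\<^sup>2" by (metis abs_ge_zero power2_abs power_mono)+
  then have "a\<^sup>2 + b\<^sup>2 < 2 * int p" using r1 by (simp flip: of_nat_power)
  ultimately have "0 < q" "q < 2"
    using q p prime_gt_0_nat[OF p] by (auto simp: zero_less_mult_iff)
  then have "a\<^sup>2 + b\<^sup>2 = int p" using q by simp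
  then have "int ((nat \<bar>a\<bar>)\<^sup>2 + (nat \<bar>b\<bar>)\<^sup>2) = int p" by simp
  then show ?thesis by (metis of_nat_eq_iff)
qed

text \<open>A prime factor of (K!)^2 + 1 exceeds K, and -1 is a square modulo it.\<close>

lemma ex_prime_sum_squares_gt: "\<exists>p a b :: nat. prime p \<and> p > K \<and> p = a\<^sup>2 + b\<^sup>2"
proof -
  obtain p :: nat where p: "prime p" "p dvd (fact K)\<^sup>2 + 1"
    using prime_factor_nat[of "(fact K)\<^sup>2 + 1"] by auto
  have "p > K"
  proof (rule ccontr)
    assume "\<not> p > K"
    then have "p dvd fact K" using p prime_gt_0_nat[OF p(1)] by (intro dvd_fact) auto
    then have "p dvd (fact K)\<^sup>2" by (simp add: power2_eq_square)
    then have "p dvd 1" using p(2) dvd_add_right_iff by blast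
    then show False using p(1) by simp
  qed
  then show ?thesis using prime_dvd_square_plus_one_sum_squares[OF p] p(1) by blast
qed

text \<open>The open quadrant is enough: for prime p and odd b no lattice point of the circle lies
  on an axis.\<close>

definition circle_points :: "nat \<Rightarrow> nat \<Rightarrow> (nat \<times> nat) set" where
  "circle_points p b = {(m, n). m > 0 \<and> n > 0 \<and> m\<^sup>2 + n\<^sup>2 = p ^ b}"

lemma finite_circle_points [simp]: "finite (circle_points p b)"
proof (rule finite_subset)
  show "circle_points p b \<subseteq> {..p ^ b} \<times> {..p ^ b}"
  proof (clarsimp simp: circle_points_def)
    fix m n :: nat assume "0 < m" "0 < n" "m\<^sup>2 + n\<^sup>2 = p ^ b"
    moreover have "m \<le> m\<^sup>2" "n \<le> n\<^sup>2" by (auto simp: power2_eq_square)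
    ultimately show "m \<le> p ^ b \<and> n \<le> p ^ b" by linarith
  qed
qed auto

lemma circle_points_swap: "(m, n) \<in> circle_points p b \<Longrightarrow> (n, m) \<in> circle_points p b"
  by (auto simp: circle_points_def)

lemma circle_points_inj:
  "(m, n) \<in> circle_points p b \<Longrightarrow> (m, n') \<in> circle_points p b \<Longrightarrow> n = n'"
  "(m, n) \<in> circle_points p b \<Longrightarrow> (m', n) \<in> circle_points p b \<Longrightarrow> m = m'"
  by (auto simp: circle_points_def) (metis add_left_cancel add_right_cancel power2_eq_imp_eq le0)+

lemma circle_points_0 [simp]: "circle_points p 0 = {}"
proof -
  have ge2: "m\<^sup>2 + n\<^sup>2 \<ge> 2" if "m > 0" "n > 0" for m n :: nat
  proof -
    have "m\<^sup>2 > 0" "n\<^sup>2 > 0" using that by auto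
    then show ?thesis by linarith
  qed
  have "(m, n) \<notin> circle_points p 0" for m n
    using ge2[of m n] by (auto simp: circle_points_def)
  then show ?thesis by auto
qed

lemma circle_points_exponent: "(m, n) \<in> circle_points p b \<Longrightarrow> b > 0"
  by (cases b) auto

lemma circle_points_dvd:
  assumes "prime p" "(m, n) \<in> circle_points p b"
  shows "p dvd m \<longleftrightarrow> p dvd n"
proof -
  have "p dvd p ^ b" using circle_points_exponent[OF assms(2)] by simp
  then have "p dvd m\<^sup>2 + n\<^sup>2" using assms(2) by (simp add: circle_points_def)
  then show ?thesis
    using assms(1) by (metis dvd_add_left_iff dvd_add_right_iff prime_dvd_power_iff zero_less_numeral)
qed

lemma circle_points_divisible:
  assumes p: "prime p" and mn: "(m, n) \<in> circle_points p b" "p dvd m"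
  shows "b \<ge> 2 \<and> (\<exists>m' n'. m = p * m' \<and> n = p * n' \<and> (m', n') \<in> circle_points p (b - 2))"
proof -
  obtain m' n' where mn': "m = p * m'" "n = p * n'"
    using mn circle_points_dvd[OF p mn(1)] by (metis dvdE)
  have eq: "p\<^sup>2 * (m'\<^sup>2 + n'\<^sup>2) = p ^ b" and pos: "m' > 0" "n' > 0"
    using mn(1) unfolding circle_points_def mn' by (auto simp: power_mult_distrib algebra_simps)
  have p1: "p > 1" using p by (rule prime_gt_1_nat)
  have "m'\<^sup>2 + n'\<^sup>2 > 0" using pos by simp
  then have "p\<^sup>2 * 1 \<le> p\<^sup>2 * (m'\<^sup>2 + n'\<^sup>2)" by (intro mult_le_mono) linarith+
  then have "p ^ 2 \<le> p ^ b" unfolding eq by simp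
  then have b: "b \<ge> 2" using p1 power_le_imp_le_exp by blast
  then have "p ^ b = p\<^sup>2 * p ^ (b - 2)" by (metis le_add_diff_inverse power_add)
  then have "m'\<^sup>2 + n'\<^sup>2 = p ^ (b - 2)" using eq p1 by simp
  then show ?thesis using b pos mn' by (auto simp: circle_points_def)
qed

lemma circle_points_scale:
  assumes "p > 0" "(m, n) \<in> circle_points p b"
  shows "(p ^ k * m, p ^ k * n) \<in> circle_points p (b + 2 * k)"
  using assms unfolding circle_points_def
  by (auto simp: power_mult_distrib power_add power_mult[symmetric] mult.commute[of 2] simp flip: distrib_left)

text \<open>In the Gaussian integers, a primitive point is the b-th power of one prime factor of p,
  up to units and conjugation. In elementary terms: X Y = p^b (m'^2 - n^2), and p cannot divide both
  X and Y because X + Y = 2 m m', so p^b divides one of them. As 0 < X \<le> p^b and |Y| < X, either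
  X = p^b or Y = 0, and these are the two alternatives.\<close>

lemma circle_points_primitive_unique:
  assumes p: "prime p" "p > 2" and mn: "(m, n) \<in> circle_points p b" "\<not> p dvd m"
    and mn': "(m', n') \<in> circle_points p b" "\<not> p dvd m'"
  shows "m' = m \<and> n' = n \<or> m' = n \<and> n' = m"
proof -
  let ?m = "int m" and ?n = "int n" and ?m' = "int m'" and ?n' = "int n'" and ?P = "int p ^ b"
  define X where "X = ?m * ?m' + ?n * ?n'"
  define Y where "Y = ?m * ?m' - ?n * ?n'"
  have e: "?m\<^sup>2 + ?n\<^sup>2 = ?P" "?m'\<^sup>2 + ?n'\<^sup>2 = ?P"
    using mn(1) mn'(1) unfolding circle_points_def by (auto simp flip: of_nat_power of_nat_add)
  have pos: "?m > 0" "?n > 0" "?m' > 0" "?n' > 0" using mn(1) mn'(1) by (auto simp: circle_points_def)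
  have pp: "prime (int p)" using p by simp
  have XY: "X * Y = ?P * (?m'\<^sup>2 - ?n\<^sup>2)"
  proof -
    have "X * Y = ?m\<^sup>2 * ?m'\<^sup>2 - ?n\<^sup>2 * ?n'\<^sup>2"
      by (simp add: X_def Y_def power2_eq_square algebra_simps)
    moreover have "?m\<^sup>2 = ?P - ?n\<^sup>2" "?n'\<^sup>2 = ?P - ?m'\<^sup>2" using e by linarith+
    ultimately show ?thesis by (simp only:) (simp add: algebra_simps)
  qed
  have "\<not> (int p dvd X \<and> int p dvd Y)"
  proof
    assume "int p dvd X \<and> int p dvd Y"
    then have "int p dvd X + Y" by simp
    then have "int p dvd 2 * (?m * ?m')" by (simp add: X_def Y_def)
    moreover have "\<not> int p dvd 2" using p by (metis int_dvd_int_iff of_nat_numeral nat_dvd_not_less zero_less_numeral)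
    ultimately show False using pp mn(2) mn'(2) by (simp add: prime_dvd_mult_iff)
  qed
  then have "coprime (int p) X \<or> coprime (int p) Y" using pp by (metis prime_imp_coprime)
  then have dv: "?P dvd X \<or> ?P dvd Y"
    using XY by (metis coprime_dvd_mult_left_iff coprime_dvd_mult_right_iff coprime_power_left_iff dvd_triv_left)
  have X0: "X > 0" using pos by (simp add: X_def add_pos_pos)
  have XP: "(?m - ?m')\<^sup>2 + (?n - ?n')\<^sup>2 = 2 * ?P - 2 * X"
    using e by (simp add: X_def power2_eq_square algebra_simps)
  from dv show ?thesis
  proof
    assume "?P dvd X"
    then have "?P \<le> X" using X0 by (rule zdvd_imp_le)
    then have "(?m - ?m')\<^sup>2 + (?n - ?n')\<^sup>2 \<le> 0" using XP by simp
    then show ?thesis by (simp add: sum_power2_le_zero_iff)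
  next
    assume dY: "?P dvd Y"
    have "\<bar>Y\<bar> < X" using pos by (auto simp: X_def Y_def abs_if)
    moreover have "X \<le> ?P" using XP by (smt (verit) sum_power2_ge_zero)
    ultimately have "\<bar>Y\<bar> < ?P" by linarith
    then have "Y = 0" using dY dvd_imp_le_int[of Y ?P] by fastforce
    then have "?P * (?m'\<^sup>2 - ?n\<^sup>2) = 0" using XY by simp
    then have "?m'\<^sup>2 = ?n\<^sup>2" using p by simp
    then have "m' = n" using pos by (simp add: power2_eq_iff)
    moreover have "n' = m"
      using circle_points_inj(1)[OF mn'(1)] circle_points_swap[OF mn(1)] calculation by blast
    ultimately show ?thesis by simp
  qed
qed

text \<open>There are at most two primitive points, and the others are p times the points for b - 2.
  This linear growth makes the square root of the count negligible against the number of points near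
  a given direction.\<close>

lemma card_circle_points_le:
  assumes p: "prime p" "p > 2"
  shows "card (circle_points p b) \<le> b + 1"
proof (induction b rule: less_induct)
  case (less b)
  let ?prim = "{q \<in> circle_points p b. \<not> p dvd fst q}"
  have "card ?prim \<le> 2"
  proof (cases "?prim = {}")
    case False
    then obtain m n where mn: "(m, n) \<in> circle_points p b" "\<not> p dvd m" by auto
    have "?prim \<subseteq> {(m, n), (n, m)}"
    proof clarsimp
      fix m' n' assume "(m', n') \<in> circle_points p b" "\<not> p dvd m'" "m' = m \<longrightarrow> n' \<noteq> n"
      then show "m' = n \<and> n' = m" using circle_points_primitive_unique[OF p mn] by blast
    qed
    then have "card ?prim \<le> card {(m, n), (n, m)}" by (intro card_mono) auto
    also have "\<dots> \<le> 2" by (rule card_insert_le_m1) simp_all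
    finally show ?thesis .
  next
    case True
    show ?thesis unfolding True by simp
  qed
  moreover have "card {q \<in> circle_points p b. p dvd fst q} \<le> b - 1"
  proof (cases "b \<ge> 2")
    case True
    have "{q \<in> circle_points p b. p dvd fst q} \<subseteq> (\<lambda>(m, n). (p * m, p * n)) ` circle_points p (b - 2)"
    proof clarsimp
      fix m n assume "(m, n) \<in> circle_points p b" "p dvd m"
      from circle_points_divisible[OF p(1) this]
      show "(m, n) \<in> (\<lambda>(m, n). (p * m, p * n)) ` circle_points p (b - 2)" by auto
    qed
    then have "card {q \<in> circle_points p b. p dvd fst q} \<le> card (circle_points p (b - 2))"
      by (meson card_image_le card_mono finite_circle_points finite_imageI order_trans)
    also have "\<dots> \<le> b - 2 + 1" using True by (intro less) auto
    finally show ?thesis using True by simp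
  next
    case False
    then have "\<not> p dvd m" if "(m, n) \<in> circle_points p b" for m n
      using circle_points_divisible[OF p(1) that] by blast
    then have "{q \<in> circle_points p b. p dvd fst q} = {}" by auto
    then show ?thesis by (simp only: card.empty)
  qed
  moreover have "card (circle_points p b) = card ?prim + card {q \<in> circle_points p b. p dvd fst q}"
    by (subst card_Un_disjoint[symmetric]) (auto intro!: arg_cong[where f = card])
  ultimately show ?case by (cases b) auto
qed

text \<open>Descent in b. Modulo p only the two primitive coordinates m and n remain in the
  relation. Multiplying their part by k(m) m - k(n) n and using n^2 = -m^2 modulo p shows that p
  divides k(m)^2 + k(n)^2, which is at most 2 K^2 < p; so both coefficients vanish and the rest can
  be divided by p. The first projection sees all coordinates, the point set being symmetric.\<close>

lemma circle_points_no_relation: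
  fixes k :: "nat \<Rightarrow> int"
  assumes p: "prime p" "int p > 2 * K\<^sup>2" "p > 2"
    and k: "\<And>m. m \<in> fst ` circle_points p b \<Longrightarrow> \<bar>k m\<bar> \<le> K"
    and rel: "(\<Sum>m\<in>fst ` circle_points p b. k m * int m) = 0"
  shows "\<forall>m\<in>fst ` circle_points p b. k m = 0"
  using k rel
proof (induction b arbitrary: k rule: less_induct)
  case (less b)
  let ?S = "fst ` circle_points p b"
  let ?prim = "{m \<in> ?S. \<not> p dvd m}" and ?div = "{m \<in> ?S. p dvd m}"
  have pp: "prime (int p)" using p by simp
  have split: "(\<Sum>m\<in>?S. k m * int m) = (\<Sum>m\<in>?prim. k m * int m) + (\<Sum>m\<in>?div. k m * int m)"
    by (subst sum.union_disjoint[symmetric]) (auto intro!: sum.cong)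
  have pdiv: "int p dvd (\<Sum>m\<in>?div. k m * int m)"
    by (intro dvd_sum) auto
  have prim0: "\<forall>m\<in>?prim. k m = 0"
  proof (cases "?prim = {}")
    case False
    then obtain m n where mn: "(m, n) \<in> circle_points p b" "\<not> p dvd m" by auto
    have b: "b > 0" by (rule circle_points_exponent[OF mn(1)])
    have n: "\<not> p dvd n" using mn circle_points_dvd[OF p(1)] by blast
    have prim: "?prim = {m, n}"
    proof
      show "?prim \<subseteq> {m, n}"
      proof clarsimp
        fix m' n' assume "(m', n') \<in> circle_points p b" "\<not> p dvd m'" "m' \<noteq> m"
        then show "m' = n" using circle_points_primitive_unique[OF p(1,3) mn] by blast
      qed
      show "{m, n} \<subseteq> ?prim" using mn n circle_points_swap[OF mn(1)] by force
    qed
    have ps: "p dvd m\<^sup>2 + n\<^sup>2" using mn(1) b by (auto simp: circle_points_def)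
    have "m \<noteq> n"
    proof
      assume "m = n"
      then have "p dvd 2 * m\<^sup>2" using ps by (simp add: mult_2)
      then show False using p mn(2) nat_dvd_not_less[of 2 p]
        by (auto simp: prime_dvd_mult_iff prime_dvd_power_iff)
    qed
    then have "int p dvd k m * int m + k n * int n"
      using less.prems(2) pdiv unfolding split prim
      by (simp) (metis add_eq_0_iff dvd_minus_iff)
    then have "int p dvd (k m * int m + k n * int n) * (k m * int m - k n * int n) + (k n)\<^sup>2 * int (m\<^sup>2 + n\<^sup>2)"
      using ps by (metis dvd_add dvd_mult dvd_mult2 int_dvd_int_iff)
    also have "\<dots> = ((k m)\<^sup>2 + (k n)\<^sup>2) * (int m)\<^sup>2"
      by (simp add: power2_eq_square algebra_simps)
    finally have "int p dvd (k m)\<^sup>2 + (k n)\<^sup>2"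
      using pp mn(2) by (simp add: prime_dvd_mult_iff prime_dvd_power_iff)
    moreover have "(k m)\<^sup>2 + (k n)\<^sup>2 < int p"
    proof -
      have "m \<in> ?S" "n \<in> ?S" using prim by blast+
      then have "\<bar>k m\<bar> \<le> K" "\<bar>k n\<bar> \<le> K" using less.prems(1) by auto
      then have "(k m)\<^sup>2 \<le> K\<^sup>2" "(k n)\<^sup>2 \<le> K\<^sup>2"
        by (metis abs_ge_zero power2_abs power_mono)+
      then show ?thesis using p(2) by simp
    qed
    ultimately have "(k m)\<^sup>2 + (k n)\<^sup>2 \<le> 0"
      by (meson linorder_not_less zdvd_imp_le)
    then show ?thesis unfolding prim by (simp add: sum_power2_le_zero_iff)
  qed auto
  have "\<forall>m\<in>?div. k m = 0"
  proof (cases "?div = {}")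
    case False
    then have b: "b \<ge> 2" using circle_points_divisible[OF p(1)] by force
    have div: "?div = (*) p ` fst ` circle_points p (b - 2)"
    proof
      show "?div \<subseteq> (*) p ` fst ` circle_points p (b - 2)"
        using circle_points_divisible[OF p(1)] by force
      show "(*) p ` fst ` circle_points p (b - 2) \<subseteq> ?div"
      proof clarify
        fix m n assume "(m, n) \<in> circle_points p (b - 2)"
        moreover have "b - 2 + 2 * 1 = b" using b by simp
        ultimately have "(p * m, p * n) \<in> circle_points p b"
          using circle_points_scale[of p m n "b - 2" 1] p by (simp only: power_one_right)
        then show "p * fst (m, n) \<in> ?S \<and> p dvd p * fst (m, n)" by force
      qed
    qed
    have "(\<Sum>m\<in>?div. k m * int m) = 0"
      using less.prems(2) split prim0 by simp
    then have "(\<Sum>m\<in>fst ` circle_points p (b - 2). int p * (k (p * m) * int m)) = 0"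
      unfolding div using p by (subst (asm) sum.reindex) (auto simp: inj_on_def mult_ac)
    then have "(\<Sum>m\<in>fst ` circle_points p (b - 2). k (p * m) * int m) = 0"
      unfolding sum_distrib_left[symmetric] using p by simp
    moreover have "\<bar>k (p * m)\<bar> \<le> K" if "m \<in> fst ` circle_points p (b - 2)" for m
      using less.prems(1) div that by blast
    ultimately have "\<forall>m\<in>fst ` circle_points p (b - 2). k (p * m) = 0"
      using b by (intro less.IH[of "b - 2" "\<lambda>m. k (p * m)"]) auto
    then show ?thesis unfolding div by auto
  qed auto
  with prim0 show ?case by auto
qed

section \<open>Directions of the lattice points\<close>

lemma norm_cis_diff_le: "cmod (cis x - cis y) \<le> \<bar>x - y\<bar>"
proof -
  have "(cmod (cis x - cis y))\<^sup>2 = (cos x - cos y)\<^sup>2 + (sin x - sin y)\<^sup>2"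
    by (simp add: cmod_power2)
  also have "\<dots> = 2 - 2 * cos (x - y)"
    using sin_cos_squared_add3[of x] sin_cos_squared_add3[of y]
    by (simp add: cos_diff power2_eq_square algebra_simps)
  also have "\<dots> = 4 * (sin ((x - y) / 2))\<^sup>2"
  proof -
    define t where "t = (x - y) / 2"
    have "x - y = 2 * t" by (simp add: t_def)
    then show ?thesis unfolding t_def[symmetric] by (simp add: cos_double_sin)
  qed
  also have "\<dots> \<le> 4 * ((x - y) / 2)\<^sup>2"
    using abs_le_square_iff[THEN iffD1, OF abs_sin_x_le_abs_x[of "(x - y) / 2"]] by simp
  also have "\<dots> = \<bar>x - y\<bar>\<^sup>2" by (simp add: power_divide)
  finally show ?thesis by (rule power2_le_imp_le) simp
qed

text \<open>Dirichlet's theorem makes some \<open>\<omega>\<^sup>k\<close> a tiny nontrivial rotation; its powers sweep the circle.\<close>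

lemma circle_orbit_syndetic:
  fixes \<omega> :: complex
  assumes w1: "cmod \<omega> = 1" and nr: "\<And>q. q > 0 \<Longrightarrow> \<omega> ^ q \<noteq> 1" and "\<eta> > 0"
  shows "\<exists>L>0. \<forall>v s. cmod v = 1 \<longrightarrow> (\<exists>j. s \<le> j \<and> j < s + L \<and> cmod (\<omega> ^ j - v) < \<eta>)"
proof -
  obtain N :: nat where N: "real N > 2 * pi / \<eta>" using reals_Archimedean2 by blast
  have N0: "N > 0" using N \<open>\<eta> > 0\<close> by (cases N) (auto simp: field_simps)
  obtain h k where k: "0 < k" "\<bar>of_int k * (Arg \<omega> / (2 * pi)) - of_int h\<bar> < 1 / real N"
    using Dirichlet_approx[OF N0, of "Arg \<omega> / (2 * pi)"] by blast
  define \<tau> where "\<tau> = 2 * pi * (of_int k * (Arg \<omega> / (2 * pi)) - of_int h)"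
  define q where "q = nat k"
  have q0: "q > 0" using k by (simp add: q_def)
  have "\<bar>\<tau>\<bar> = 2 * pi * \<bar>of_int k * (Arg \<omega> / (2 * pi)) - of_int h\<bar>"
    unfolding \<tau>_def abs_mult by simp
  also have "\<dots> < 2 * pi * (1 / real N)"
    by (rule mult_strict_left_mono[OF k(2)]) simp
  also have "\<dots> < \<eta>" using N N0 \<open>\<eta> > 0\<close> by (simp add: field_simps)
  finally have tau: "\<bar>\<tau>\<bar> < \<eta>" .
  have wc: "\<omega> = cis (Arg \<omega>)" using rcis_cmod_Arg[of \<omega>] w1 by (simp add: rcis_def)
  have "\<tau> = real q * Arg \<omega> - of_int h * (2 * pi)"
    using k by (simp add: \<tau>_def q_def field_simps)
  then have "cis \<tau> = cis (real q * Arg \<omega>) / cis (of_int h * (2 * pi))"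
    by (simp add: cis_divide)
  also have "cis (of_int h * (2 * pi)) = 1"
    by (metis cis_multiple_2pi Ints_of_int mult.commute)
  finally have wq: "\<omega> ^ q = cis \<tau>" by (subst wc) (simp add: Complex.DeMoivre)
  then have tau0: "\<tau> \<noteq> 0" using nr[OF q0] by auto
  \<comment> \<open>The number of steps of size |\<tau>| that fit into one turn. From the exponent s
    every target is approached within J steps of length q, whence the window q (J + 1).\<close>
  define J where "J = nat \<lfloor>2 * pi / \<bar>\<tau>\<bar>\<rfloor>"
  show ?thesis
  proof (rule exI[of _ "q * (J + 1)"], intro conjI allI impI)
    show "0 < q * (J + 1)" using q0 by simp
    fix v :: complex and s assume v: "cmod v = 1"
    define u where "u = v * cnj (\<omega> ^ s)"
    have ws2: "cmod (\<omega> ^ s) = 1" using w1 by (simp add: norm_power)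
    have ws: "\<omega> ^ s * cnj (\<omega> ^ s) = 1" "cmod (\<omega> ^ s) = 1"
      unfolding complex_norm_square[symmetric] ws2 by simp_all
    have u: "cmod u = 1" using v ws by (simp add: u_def norm_mult del: complex_cnj_power)
    have vu: "v = \<omega> ^ s * u" using ws(1) by (simp add: u_def mult_ac)
    \<comment> \<open>The angle of the target is measured in the direction in which the powers of
      cis \<tau> move, so that counting steps forward suffices.\<close>
    have "\<exists>\<sigma>. 0 \<le> \<sigma> \<and> \<sigma> < 2 * pi \<and> u = cis (sgn \<tau> * \<sigma>)"
    proof (cases "\<tau> > 0")
      case True
      then show ?thesis using Arg2pi[of u] u
        by (intro exI[of _ "Arg2pi u"]) (auto simp: cis_conv_exp is_Arg_def)
    next
      case False
      have "cnj u = cis (Arg2pi (cnj u))" using Arg2pi[of "cnj u"] u by (auto simp: cis_conv_exp is_Arg_def)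
      then have "u = cis (- Arg2pi (cnj u))" by (metis cis_cnj complex_cnj_cnj)
      then show ?thesis using Arg2pi[of "cnj u"] False tau0
        by (intro exI[of _ "Arg2pi (cnj u)"]) (auto simp: sgn_if)
    qed
    then obtain \<sigma> where sg: "0 \<le> \<sigma>" "\<sigma> < 2 * pi" "u = cis (sgn \<tau> * \<sigma>)" by blast
    define j where "j = nat \<lfloor>\<sigma> / \<bar>\<tau>\<bar>\<rfloor>"
    have rj: "real j \<le> \<sigma> / \<bar>\<tau>\<bar>" "\<sigma> / \<bar>\<tau>\<bar> < real j + 1"
      using sg tau0 by (auto simp: j_def)
    have "j \<le> J" unfolding j_def J_def
      using sg by (intro nat_mono floor_mono divide_right_mono) auto
    have "\<bar>real j * \<bar>\<tau>\<bar> - \<sigma>\<bar> < \<eta>"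
      using rj tau tau0 by (auto simp: field_simps abs_if)
    moreover have "real j * \<tau> - sgn \<tau> * \<sigma> = sgn \<tau> * (real j * \<bar>\<tau>\<bar> - \<sigma>)"
      by (simp add: algebra_simps sgn_mult_abs abs_mult_sgn)
    ultimately have "\<bar>real j * \<tau> - sgn \<tau> * \<sigma>\<bar> < \<eta>"
      using tau0 by (simp add: abs_mult abs_sgn_eq)
    then have "cmod (cis (real j * \<tau>) - u) < \<eta>"
      using norm_cis_diff_le[of "real j * \<tau>" "sgn \<tau> * \<sigma>"] by (simp add: sg(3))
    moreover have "\<omega> ^ (s + q * j) - v = \<omega> ^ s * (cis (real j * \<tau>) - u)"
      unfolding vu power_add power_mult wq by (simp add: Complex.DeMoivre algebra_simps)
    ultimately have "cmod (\<omega> ^ (s + q * j) - v) < \<eta>"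
      using ws(2) by (simp add: norm_mult)
    moreover have "q * j < q * (J + 1)" using \<open>j \<le> J\<close> q0 by (intro mult_strict_left_mono) auto
    ultimately show "\<exists>j. s \<le> j \<and> j < s + q * (J + 1) \<and> cmod (\<omega> ^ j - v) < \<eta>"
      by (intro exI[of _ "s + q * j"]) auto
  qed
qed

fun gauss_power :: "int \<Rightarrow> int \<Rightarrow> nat \<Rightarrow> int \<times> int" where
  "gauss_power A B 0 = (1, 0)"
| "gauss_power A B (Suc b) = (A * fst (gauss_power A B b) - B * snd (gauss_power A B b),
     A * snd (gauss_power A B b) + B * fst (gauss_power A B b))"

lemma gauss_power_complex:
  "Complex (of_int A) (of_int B) ^ b = Complex (of_int (fst (gauss_power A B b))) (of_int (snd (gauss_power A B b)))"
proof (induction b)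
  case 0
  show ?case by (simp add: complex_eq_iff)
next
  case (Suc b)
  show ?case unfolding power_Suc Suc by (simp add: complex_eq_iff)
qed

lemma gauss_power_norm:
  "(fst (gauss_power A B b))\<^sup>2 + (snd (gauss_power A B b))\<^sup>2 = (A\<^sup>2 + B\<^sup>2) ^ b"
proof (induction b)
  case (Suc b)
  have "(A\<^sup>2 + B\<^sup>2) ^ Suc b = (A\<^sup>2 + B\<^sup>2) * ((fst (gauss_power A B b))\<^sup>2 + (snd (gauss_power A B b))\<^sup>2)"
    by (simp add: Suc)
  then show ?case by (simp add: power2_eq_square algebra_simps)
qed simp

text \<open>For z = A + iB and z^(b+1) = c + id, the product of conj z and z^(b+1) is p z^b, so A c
  + B d is divisible by p. The next real part A c - B d is thus 2 A c modulo p, and p divides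
  neither 2 nor A. It follows that z / conj z is no root of unity and that the points coming from
  powers of z are primitive.\<close>

lemma gauss_power_not_dvd:
  assumes p: "prime p" "p > 2" "int p = A\<^sup>2 + B\<^sup>2" and b: "b > 0"
  shows "\<not> int p dvd fst (gauss_power A B b) \<and> \<not> int p dvd snd (gauss_power A B b)"
proof -
  have pp: "prime (int p)" using p(1) by simp
  have nd: "\<not> int p dvd A" if "int p = A\<^sup>2 + B\<^sup>2" for A B
  proof
    assume d: "int p dvd A"
    then have "int p dvd A\<^sup>2" by (simp add: power2_eq_square)
    then have "int p dvd B\<^sup>2" using that by (metis dvd_add_right_iff dvd_refl)
    then have "int p dvd B" using pp prime_dvd_power by blast
    then have "(int p)\<^sup>2 dvd int p" using d that dvd_add by (metis dvd_power_same)
    then show False using p(2) zdvd_imp_le[of "(int p)\<^sup>2" "int p"] by (simp add: power2_eq_square)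
  qed
  have A: "\<not> int p dvd A" and B: "\<not> int p dvd B"
    using nd[OF p(3)] nd[of B A] p(3) by (auto simp: add.commute)
  have two: "\<not> int p dvd 2" using p zdvd_not_zless[of 2 "int p"] by simp
  have orth: "int p dvd A * fst (gauss_power A B (Suc b)) + B * snd (gauss_power A B (Suc b))" for b
  proof -
    have "A * fst (gauss_power A B (Suc b)) + B * snd (gauss_power A B (Suc b)) = int p * fst (gauss_power A B b)"
      unfolding p(3) by (simp add: power2_eq_square algebra_simps)
    then show ?thesis by simp
  qed
  have c: "\<not> int p dvd fst (gauss_power A B (Suc b))" for b
  proof (induction b)
    case 0
    then show ?case using A by simp
  next
    case (Suc b)
    let ?c = "fst (gauss_power A B (Suc b))" and ?d = "snd (gauss_power A B (Suc b))"
    have "fst (gauss_power A B (Suc (Suc b))) + (A * ?c + B * ?d) = 2 * (A * ?c)"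
      by simp
    moreover have "\<not> int p dvd 2 * (A * ?c)"
      using pp two A Suc by (simp only: prime_dvd_mult_iff) simp
    ultimately show ?case using orth[of b] by (metis dvd_add)
  qed
  have d: "\<not> int p dvd snd (gauss_power A B (Suc b))" for b
  proof
    assume "int p dvd snd (gauss_power A B (Suc b))"
    then have "int p dvd A * fst (gauss_power A B (Suc b))"
      using orth[of b] by (metis dvd_add_left_iff dvd_mult)
    then show False using pp A c[of b] by (simp add: prime_dvd_mult_iff del: gauss_power.simps)
  qed
  show ?thesis using b c d by (cases b) (auto simp del: gauss_power.simps)
qed

text \<open>For j < J, scaling z^(2j+1) by p^(J-1-j) and taking absolute values of the coordinates
  gives a point with exponent 2J - 1; different j give different powers of p in it. Its direction is
  that of \<zeta> \<omega>^j up to signs, so each window of L consecutive j holds a point near the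
  target. This yields J div L points, against sqrt N \<le> 2 sqrt J.\<close>

lemma circle_points_many_near:
  assumes p: "prime p" "p > 2" "int p = A\<^sup>2 + B\<^sup>2" and "C > 0" "\<eta> > 0"
  shows "\<exists>J0. \<forall>J\<ge>J0. \<forall>d1 d2. d1 \<ge> 0 \<longrightarrow> d2 \<ge> 0 \<longrightarrow> d1\<^sup>2 + d2\<^sup>2 = 1 \<longrightarrow>
     C * sqrt (real (card (circle_points p (2 * J - 1)))) \<le>
     real (card {q \<in> circle_points p (2 * J - 1).
       \<bar>real (fst q) / sqrt (real p ^ (2 * J - 1)) - d1\<bar> < \<eta> \<and>
       \<bar>real (snd q) / sqrt (real p ^ (2 * J - 1)) - d2\<bar> < \<eta>})"
proof -
  define c where "c = (\<lambda>b. fst (gauss_power A B b))"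
  define d where "d = (\<lambda>b. snd (gauss_power A B b))"
  define z where "z = Complex (of_int A) (of_int B)"
  define \<zeta> where "\<zeta> = z / of_real (sqrt (real p))"
  define \<omega> where "\<omega> = \<zeta>\<^sup>2"
  have p0: "real p > 0" using p by simp
  have "cmod z = sqrt (real p)"
    unfolding z_def cmod_def using p(3) by (metis complex.sel of_int_add of_int_of_nat_eq of_int_power)
  then have \<zeta>1: "cmod \<zeta> = 1" using p0 by (simp add: \<zeta>_def norm_divide)
  have \<zeta>b: "\<zeta> ^ b = Complex (of_int (c b)) (of_int (d b)) / of_real (sqrt (real p ^ b))" for b
    unfolding \<zeta>_def power_divide z_def gauss_power_complex c_def d_def
    by (simp add: real_sqrt_power)
  have "\<omega> ^ q \<noteq> 1" if "q > 0" for q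
  proof
    assume "\<omega> ^ q = 1"
    then have "Im (\<zeta> ^ (2 * q)) = 0" by (simp add: \<omega>_def power_mult)
    then have "d (2 * q) = 0" using p0 unfolding \<zeta>b by simp
    then show False using gauss_power_not_dvd[OF p, of "2 * q"] that by (simp add: d_def)
  qed
  moreover have "cmod \<omega> = 1" using \<zeta>1 by (simp add: \<omega>_def norm_power)
  ultimately obtain L where L: "L > 0" and
    orb: "\<And>v s. cmod v = 1 \<Longrightarrow> \<exists>j. s \<le> j \<and> j < s + L \<and> cmod (\<omega> ^ j - v) < \<eta>"
    using circle_orbit_syndetic[of \<omega> \<eta>] \<open>\<eta> > 0\<close> by blast
  \<comment> \<open>For J \<ge> X^2 one has L (2 C sqrt J + 1) \<le> L (2 C + 1) sqrt J \<le> J,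
    hence 2 C sqrt J \<le> J div L.\<close>
  define X where "X = real L * (2 * C + 1) + 1"
  have X1: "X > 1" using L \<open>C > 0\<close> by (simp add: X_def)
  show ?thesis
  proof (intro exI[of _ "nat \<lceil>X\<^sup>2\<rceil>"] allI impI)
    fix J :: nat and d1 d2 :: real
    assume J: "nat \<lceil>X\<^sup>2\<rceil> \<le> J" and d12: "d1 \<ge> 0" "d2 \<ge> 0" "d1\<^sup>2 + d2\<^sup>2 = 1"
    let ?a = "2 * J - 1"
    let ?E = "{q \<in> circle_points p ?a. \<bar>real (fst q) / sqrt (real p ^ ?a) - d1\<bar> < \<eta> \<and> \<bar>real (snd q) / sqrt (real p ^ ?a) - d2\<bar> < \<eta>}"
    have JX: "X\<^sup>2 \<le> real J" using J by linarith
    have J0: "J > 0" using JX X1 by (cases J) auto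
    define P where "P = (\<lambda>j. (p ^ (J - 1 - j) * nat \<bar>c (2 * j + 1)\<bar>, p ^ (J - 1 - j) * nat \<bar>d (2 * j + 1)\<bar>))"
    have nd: "\<not> p dvd nat \<bar>c (2 * j + 1)\<bar>" "\<not> p dvd nat \<bar>d (2 * j + 1)\<bar>" for j
      using gauss_power_not_dvd[OF p, of "2 * j + 1"] unfolding c_def d_def
      by (auto simp: int_dvd_int_iff[symmetric] simp del: gauss_power.simps)
    have Pin: "P j \<in> circle_points p ?a" if "j < J" for j
    proof -
      have "int ((nat \<bar>c (2 * j + 1)\<bar>)\<^sup>2 + (nat \<bar>d (2 * j + 1)\<bar>)\<^sup>2) = int (p ^ (2 * j + 1))"
        using gauss_power_norm[of A B "2 * j + 1"] unfolding c_def d_def p(3)[symmetric]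
        by (simp del: gauss_power.simps)
      then have "(nat \<bar>c (2 * j + 1)\<bar>)\<^sup>2 + (nat \<bar>d (2 * j + 1)\<bar>)\<^sup>2 = p ^ (2 * j + 1)"
        by (simp only: of_nat_eq_iff)
      moreover have "nat \<bar>c (2 * j + 1)\<bar> > 0" "nat \<bar>d (2 * j + 1)\<bar> > 0"
        using nd[of j] by (metis dvd_0_right gr0I)+
      ultimately have "(nat \<bar>c (2 * j + 1)\<bar>, nat \<bar>d (2 * j + 1)\<bar>) \<in> circle_points p (2 * j + 1)"
        by (simp add: circle_points_def)
      moreover have "2 * j + 1 + 2 * (J - 1 - j) = ?a" using that by simp
      ultimately show ?thesis
        using circle_points_scale[of p _ _ "2 * j + 1" "J - 1 - j"] p(2) unfolding P_def by fastforce
    qed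
    have Pinj: "i = j" if "i < J" "j < J" "P i = P j" for i j
    proof -
      have False if ij: "i < j" "j < J" "P i = P j" for i j
      proof -
        have "J - 1 - i = J - 1 - j + (j - i)" using ij by simp
        then have "p ^ (J - 1 - j) * (p ^ (j - i) * nat \<bar>c (2 * i + 1)\<bar>) = p ^ (J - 1 - j) * nat \<bar>c (2 * j + 1)\<bar>"
          using ij(3) by (simp add: P_def power_add mult.assoc)
        then have "p ^ (j - i) * nat \<bar>c (2 * i + 1)\<bar> = nat \<bar>c (2 * j + 1)\<bar>" using p by simp
        moreover have "p dvd p ^ (j - i)" using ij by simp
        ultimately show False using nd(1)[of j] by (metis dvd_mult2)
      qed
      from this[of i j] this[of j i] show ?thesis using that by (metis linorder_neqE_nat)
    qed
    have Pdir: "real (fst (P j)) / sqrt (real p ^ ?a) = \<bar>Re (\<zeta> * \<omega> ^ j)\<bar>"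
      "real (snd (P j)) / sqrt (real p ^ ?a) = \<bar>Im (\<zeta> * \<omega> ^ j)\<bar>" if "j < J" for j
    proof -
      have e: "?a = 2 * (J - 1 - j) + (2 * j + 1)" using that by simp
      have s: "sqrt (real p ^ ?a) = real p ^ (J - 1 - j) * sqrt (real p ^ (2 * j + 1))"
        unfolding e power_add[of _ "2 * (J - 1 - j)"] real_sqrt_mult power_mult real_sqrt_power
        using p0 by (simp add: power_mult[symmetric] mult.commute real_sqrt_power[symmetric] real_sqrt_abs2 power_even_eq)
      have z: "\<zeta> * \<omega> ^ j = Complex (of_int (c (2 * j + 1))) (of_int (d (2 * j + 1))) / of_real (sqrt (real p ^ (2 * j + 1)))"
        unfolding \<zeta>b[symmetric] \<omega>_def by (simp add: power_mult)
      have pk: "real p ^ (J - 1 - j) > 0" using p0 by simp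
      show "real (fst (P j)) / sqrt (real p ^ ?a) = \<bar>Re (\<zeta> * \<omega> ^ j)\<bar>"
        "real (snd (P j)) / sqrt (real p ^ ?a) = \<bar>Im (\<zeta> * \<omega> ^ j)\<bar>"
        unfolding s z Re_divide_of_real Im_divide_of_real using pk by (simp_all add: P_def)
    qed
    \<comment> \<open>Since \<zeta> v is the target, \<omega>^j near v puts \<zeta> \<omega>^j near
      the target. The target has nonnegative coordinates, so passing to absolute values does not
      increase the distances.\<close>
    define v where "v = Complex d1 d2 * cnj \<zeta>"
    have "cmod (Complex d1 d2) = 1" using d12 by (simp add: cmod_def)
    then have v1: "cmod v = 1" using \<zeta>1 by (simp add: v_def norm_mult)
    have "\<zeta> * cnj \<zeta> = 1" using \<zeta>1 by (simp add: complex_norm_square[symmetric])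
    then have \<zeta>v: "\<zeta> * v = Complex d1 d2" by (simp add: v_def mult_ac)
    have PE: "P j \<in> ?E" if j: "j < J" "cmod (\<omega> ^ j - v) < \<eta>" for j
    proof -
      have "cmod (\<zeta> * \<omega> ^ j - Complex d1 d2) < \<eta>"
        unfolding \<zeta>v[symmetric] right_diff_distrib[symmetric] norm_mult \<zeta>1 using j by simp
      then have "\<bar>Re (\<zeta> * \<omega> ^ j) - d1\<bar> < \<eta>" "\<bar>Im (\<zeta> * \<omega> ^ j) - d2\<bar> < \<eta>"
        using abs_Re_le_cmod[of "\<zeta> * \<omega> ^ j - Complex d1 d2"] abs_Im_le_cmod[of "\<zeta> * \<omega> ^ j - Complex d1 d2"]
        by simp_all
      then show ?thesis using Pin[OF j(1)] Pdir[OF j(1)] d12 by auto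
    qed
    obtain f where f: "\<And>i. i * L \<le> f i \<and> f i < i * L + L \<and> cmod (\<omega> ^ f i - v) < \<eta>"
    proof -
      have "\<forall>i. \<exists>j. i * L \<le> j \<and> j < i * L + L \<and> cmod (\<omega> ^ j - v) < \<eta>"
        by (intro allI orb[OF v1])
      from choice[OF this] show ?thesis using that by blast
    qed
    have fJ: "f i < J" if "i < J div L" for i
    proof -
      have "i * L + L \<le> J div L * L" using that by (metis Suc_leI add.commute mult_Suc mult_le_mono1)
      also have "\<dots> \<le> J" by simp
      finally show ?thesis using f[of i] by linarith
    qed
    have fdiv: "f i div L = i" for i
      using f[of i] by (intro div_nat_eqI) (auto simp: algebra_simps)
    have "inj_on (\<lambda>i. P (f i)) {..<J div L}"
      using Pinj fJ fdiv by (intro inj_onI) (metis lessThan_iff)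
    moreover have "(\<lambda>i. P (f i)) ` {..<J div L} \<subseteq> ?E" using PE fJ f by blast
    ultimately have "card {..<J div L} \<le> card ?E" by (intro card_inj_on_le) auto
    then have cE: "real (J div L) \<le> real (card ?E)" by simp
    have "card (circle_points p ?a) \<le> 2 * J" using card_circle_points_le[OF p(1,2), of ?a] J0 by simp
    then have "sqrt (real (card (circle_points p ?a))) \<le> sqrt (4 * real J)" by simp
    then have sq: "sqrt (real (card (circle_points p ?a))) \<le> 2 * sqrt (real J)" by (simp add: real_sqrt_mult)
    have xJ: "sqrt (real J) \<ge> X" using JX by (rule real_le_rsqrt)
    have "real L * (2 * C * sqrt (real J) + 1) \<le> sqrt (real J) * sqrt (real J)"
    proof -
      have "real L * (2 * C * sqrt (real J) + 1) \<le> real L * (2 * C * sqrt (real J) + sqrt (real J))"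
        using J0 by (intro mult_left_mono) auto
      also have "\<dots> = (real L * (2 * C + 1)) * sqrt (real J)" by (simp add: algebra_simps)
      also have "\<dots> \<le> sqrt (real J) * sqrt (real J)" using xJ by (intro mult_right_mono) (auto simp: X_def)
      finally show ?thesis .
    qed
    then have "real L * (2 * C * sqrt (real J) + 1) \<le> real J" by simp
    then have "2 * C * sqrt (real J) + 1 \<le> real J / real L" using L by (simp add: field_simps)
    also have "\<dots> \<le> real (J div L) + 1"
    proof -
      have "real (J div L) = of_int \<lfloor>real J / real L\<rfloor>" by (simp add: floor_divide_of_nat_eq)
      then show ?thesis by linarith
    qed
    finally have "C * (2 * sqrt (real J)) \<le> real (J div L)" by simp
    moreover have "C * sqrt (real (card (circle_points p ?a))) \<le> C * (2 * sqrt (real J))"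
      using sq \<open>C > 0\<close> by (intro mult_left_mono) auto
    ultimately show "C * sqrt (real (card (circle_points p ?a))) \<le> real (card ?E)" using cE by linarith
  qed
qed

section \<open>Choice of the phases\<close>

text \<open>The signs alternate along \<open>U\<close>, and \<open>h\<close> majorises the variation of \<open>f\<close>. The second bound is there
  because adding a new maximum \<open>b\<close> replaces the sum \<open>T\<close> by \<open>f b - T\<close>.\<close>

lemma alternating_signs_aux:
  fixes U :: "nat set"
  assumes "finite U" "U \<noteq> {}"
  shows "\<exists>s. (\<forall>m. s m = 1 \<or> s m = - 1) \<and> (\<forall>(f :: nat \<Rightarrow> real) h B c.
    (\<forall>m\<in>U. \<bar>f m\<bar> \<le> B \<and> c \<le> h m) \<longrightarrow> (\<forall>m\<in>U. \<forall>m'\<in>U. m < m' \<longrightarrow> \<bar>f m' - f m\<bar> \<le> h m' - h m) \<longrightarrow>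
    \<bar>\<Sum>m\<in>U. s m * f m\<bar> \<le> B + (h (Max U) - c) \<and> \<bar>f (Max U) - (\<Sum>m\<in>U. s m * f m)\<bar> \<le> B + (h (Max U) - c))"
  using assms
proof (induction U rule: finite_linorder_max_induct)
  case (insert b A)
  show ?case
  proof (cases "A = {}")
    case True
    show ?thesis
      unfolding True by (rule exI[of _ "\<lambda>_. 1"]) auto
  next
    case False
    obtain s where s: "\<forall>m. s m = 1 \<or> s m = - 1"
      and IH: "\<And>(f :: nat \<Rightarrow> real) h B c. (\<forall>m\<in>A. \<bar>f m\<bar> \<le> B \<and> c \<le> h m) \<Longrightarrow>
        (\<forall>m\<in>A. \<forall>m'\<in>A. m < m' \<longrightarrow> \<bar>f m' - f m\<bar> \<le> h m' - h m) \<Longrightarrow>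
        \<bar>\<Sum>m\<in>A. s m * f m\<bar> \<le> B + (h (Max A) - c) \<and> \<bar>f (Max A) - (\<Sum>m\<in>A. s m * f m)\<bar> \<le> B + (h (Max A) - c)"
      using insert.IH[OF False] by blast
    define s' where "s' = (\<lambda>m. if m = b then 1 else - s m :: real)"
    have bA: "b \<notin> A" using insert.hyps(2) by auto
    have MA: "Max A \<in> A" using False insert.hyps(1) by simp
    then have Mb: "Max A < b" using insert.hyps(2) by blast
    then have Max: "Max (insert b A) = b" using False insert.hyps(1) by simp
    show ?thesis
    proof (rule exI[of _ s'], intro conjI allI impI)
      show "s' m = 1 \<or> s' m = - 1" for m using s by (auto simp: s'_def)
      fix f h :: "nat \<Rightarrow> real" and B c :: real
      assume 1: "\<forall>m\<in>insert b A. \<bar>f m\<bar> \<le> B \<and> c \<le> h m"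
        and 2: "\<forall>m\<in>insert b A. \<forall>m'\<in>insert b A. m < m' \<longrightarrow> \<bar>f m' - f m\<bar> \<le> h m' - h m"
      let ?T = "\<Sum>m\<in>A. s m * f m"
      have T: "(\<Sum>m\<in>insert b A. s' m * f m) = f b - ?T"
      proof -
        have "(\<Sum>m\<in>A. s' m * f m) = (\<Sum>m\<in>A. - (s m * f m))"
          using bA by (intro sum.cong refl) (auto simp: s'_def)
        then show ?thesis using bA insert.hyps(1) by (simp add: s'_def sum_negf)
      qed
      have i: "\<bar>?T\<bar> \<le> B + (h (Max A) - c)" "\<bar>f (Max A) - ?T\<bar> \<le> B + (h (Max A) - c)"
        using IH[of f B c h] 1 2 by auto
      have v: "\<bar>f b - f (Max A)\<bar> \<le> h b - h (Max A)" using 2 MA Mb by blast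
      show "\<bar>\<Sum>m\<in>insert b A. s' m * f m\<bar> \<le> B + (h (Max (insert b A)) - c)"
        unfolding T Max using i v by linarith
      show "\<bar>f (Max (insert b A)) - (\<Sum>m\<in>insert b A. s' m * f m)\<bar> \<le> B + (h (Max (insert b A)) - c)"
        unfolding T Max using i v by linarith
    qed
  qed
qed simp

text \<open>The signs are fixed before f and h: one choice of phases has to serve monomials of every
  degree, that is, all derivatives at once.\<close>

lemma alternating_signs:
  fixes U :: "nat set"
  assumes "finite U"
  shows "\<exists>s. (\<forall>m. s m = 1 \<or> s m = - 1) \<and> (\<forall>(f :: nat \<Rightarrow> real) h B c H.
    B \<ge> 0 \<longrightarrow> c \<le> H \<longrightarrow> (\<forall>m\<in>U. \<bar>f m\<bar> \<le> B \<and> c \<le> h m \<and> h m \<le> H) \<longrightarrow>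
    (\<forall>m\<in>U. \<forall>m'\<in>U. m < m' \<longrightarrow> \<bar>f m' - f m\<bar> \<le> h m' - h m) \<longrightarrow>
    \<bar>\<Sum>m\<in>U. s m * f m\<bar> \<le> B + (H - c))"
proof (cases "U = {}")
  case True
  then show ?thesis by (intro exI[of _ "\<lambda>_. 1"]) auto
next
  case False
  obtain s where s: "\<forall>m. s m = 1 \<or> s m = - 1"
    and A: "\<And>(f :: nat \<Rightarrow> real) h B c. (\<forall>m\<in>U. \<bar>f m\<bar> \<le> B \<and> c \<le> h m) \<Longrightarrow>
      (\<forall>m\<in>U. \<forall>m'\<in>U. m < m' \<longrightarrow> \<bar>f m' - f m\<bar> \<le> h m' - h m) \<Longrightarrow>
      \<bar>\<Sum>m\<in>U. s m * f m\<bar> \<le> B + (h (Max U) - c)"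
    using alternating_signs_aux[OF assms False] by blast
  have M: "Max U \<in> U" using False assms by simp
  show ?thesis
  proof (rule exI[of _ s], intro conjI allI impI s)
    show "s m = 1 \<or> s m = - 1" for m using s by blast
    fix f h :: "nat \<Rightarrow> real" and B c H :: real
    assume 1: "\<forall>m\<in>U. \<bar>f m\<bar> \<le> B \<and> c \<le> h m \<and> h m \<le> H"
      and 2: "\<forall>m\<in>U. \<forall>m'\<in>U. m < m' \<longrightarrow> \<bar>f m' - f m\<bar> \<le> h m' - h m"
    have "\<bar>\<Sum>m\<in>U. s m * f m\<bar> \<le> B + (h (Max U) - c)" using A[of f B c h] 1 2 by blast
    moreover have "h (Max U) \<le> H" using 1 M by blast
    ultimately show "\<bar>\<Sum>m\<in>U. s m * f m\<bar> \<le> B + (H - c)" by simp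
  qed
qed

text \<open>A greedy choice: every E i has room for the demands of all indices together, so the
  elements already taken leave enough.\<close>

lemma ex_disjoint_subsets:
  fixes E :: "'i \<Rightarrow> 'a set" and n :: "'i \<Rightarrow> nat"
  assumes "finite I" "\<And>i. i \<in> I \<Longrightarrow> finite (E i)" "\<And>i. i \<in> I \<Longrightarrow> (\<Sum>j\<in>I. n j) \<le> card (E i)"
  shows "\<exists>C. (\<forall>i\<in>I. C i \<subseteq> E i \<and> card (C i) = n i) \<and> (\<forall>i\<in>I. \<forall>j\<in>I. i \<noteq> j \<longrightarrow> C i \<inter> C j = {})"
  using assms
proof (induction I rule: finite_induct)
  case (insert i I)
  have le: "(\<Sum>j\<in>I. n j) \<le> card (E k)" if "k \<in> I" for k
    using insert.prems(2)[of k] that insert.hyps by simp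
  have fin: "finite (E k)" if "k \<in> I" for k using insert.prems(1) that by simp
  have "\<exists>C. (\<forall>i\<in>I. C i \<subseteq> E i \<and> card (C i) = n i) \<and> (\<forall>i\<in>I. \<forall>j\<in>I. i \<noteq> j \<longrightarrow> C i \<inter> C j = {})"
    by (rule insert.IH) (fact fin le)+
  then obtain C where C: "\<forall>i\<in>I. C i \<subseteq> E i \<and> card (C i) = n i" "\<forall>i\<in>I. \<forall>j\<in>I. i \<noteq> j \<longrightarrow> C i \<inter> C j = {}"
    by (elim exE conjE) (rule that)
  let ?V = "\<Union>j\<in>I. C j"
  have "card ?V \<le> (\<Sum>j\<in>I. card (C j))" by (rule card_UN_le[OF insert.hyps(1)])
  also have "\<dots> = (\<Sum>j\<in>I. n j)" using C by simp
  finally have "card ?V + n i \<le> card (E i)"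
    using insert.prems(2)[of i] insert.hyps by simp
  moreover have "card (E i) \<le> card (E i - ?V) + card ?V"
  proof -
    have "finite (C j)" if "j \<in> I" for j
      using finite_subset[of "C j" "E j"] C(1) insert.prems(1)[of j] that by blast
    then have "finite ?V" using insert.hyps(1) by (intro finite_UN_I)
    then show ?thesis using diff_card_le_card_Diff[of ?V "E i"] by simp
  qed
  ultimately have "n i \<le> card (E i - ?V)" by simp
  then obtain T where T: "T \<subseteq> E i - ?V" "card T = n i"
    by (meson obtain_subset_with_card_n)
  show ?case
  proof (rule exI[of _ "C(i := T)"], intro conjI ballI impI)
    fix k assume "k \<in> insert i I"
    then show "(C(i := T)) k \<subseteq> E k" "card ((C(i := T)) k) = n k" using C T by auto
  next
    fix k l assume "k \<in> insert i I" "l \<in> insert i I" "k \<noteq> l"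
    then show "(C(i := T)) k \<inter> (C(i := T)) l = {}" using C(2) T(1) by auto
  qed
qed simp

lemma abs_le_add: "x = y + z \<Longrightarrow> \<bar>y\<bar> \<le> p \<Longrightarrow> \<bar>z\<bar> \<le> q \<Longrightarrow> \<bar>x\<bar> \<le> p + (q :: real)"
  by linarith

lemma power_product_diff_le:
  fixes a b c d :: real
  assumes "0 \<le> a" "a \<le> 1" "0 \<le> b" "b \<le> 1" "0 \<le> c" "c \<le> 1" "0 \<le> d" "d \<le> 1"
  shows "\<bar>a ^ s * b ^ t - c ^ s * d ^ t\<bar> \<le> \<bar>a ^ s - c ^ s\<bar> + \<bar>b ^ t - d ^ t\<bar>"
proof -
  have "\<bar>(a ^ s - c ^ s) * b ^ t\<bar> \<le> \<bar>a ^ s - c ^ s\<bar> * 1"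
    unfolding abs_mult using assms by (intro mult_left_mono) (auto simp: power_le_one)
  moreover have "\<bar>c ^ s * (b ^ t - d ^ t)\<bar> \<le> 1 * \<bar>b ^ t - d ^ t\<bar>"
    unfolding abs_mult using assms by (intro mult_right_mono) (auto simp: power_le_one)
  ultimately show ?thesis
    by (intro abs_le_add[of _ "(a ^ s - c ^ s) * b ^ t" "c ^ s * (b ^ t - d ^ t)"]) (simp_all add: algebra_simps)
qed

lemma power_diff_le:
  fixes a c :: real
  assumes "0 \<le> a" "a \<le> 1" "0 \<le> c" "c \<le> 1"
  shows "\<bar>a ^ s - c ^ s\<bar> \<le> real s * \<bar>a - c\<bar>"
  using norm_power_diff[of a c s] assms by simp

lemma wave_0: "wave d \<gamma> a 0 = d ^ a * cos (\<gamma> + real a * (pi / 2))"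
  by (simp add: wave_def)

lemma wave_product_diff_le:
  assumes "0 \<le> a" "a \<le> 1" "0 \<le> b" "b \<le> 1" "0 \<le> c" "c \<le> 1" "0 \<le> d" "d \<le> 1"
  shows "\<bar>wave a \<gamma> s 0 * wave b \<delta> t 0 - wave c \<gamma> s 0 * wave d \<delta> t 0\<bar> \<le> real s * \<bar>a - c\<bar> + real t * \<bar>b - d\<bar>"
proof -
  let ?C = "cos (\<gamma> + real s * (pi / 2)) * cos (\<delta> + real t * (pi / 2))"
  have "wave a \<gamma> s 0 * wave b \<delta> t 0 - wave c \<gamma> s 0 * wave d \<delta> t 0 = (a ^ s * b ^ t - c ^ s * d ^ t) * ?C"
    by (simp add: wave_0 algebra_simps)
  moreover have "\<bar>?C\<bar> \<le> 1" by (simp add: abs_mult mult_le_one)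
  ultimately have "\<bar>wave a \<gamma> s 0 * wave b \<delta> t 0 - wave c \<gamma> s 0 * wave d \<delta> t 0\<bar> \<le> \<bar>a ^ s * b ^ t - c ^ s * d ^ t\<bar> * 1"
    by (simp only: abs_mult[of "_ - _"]) (intro mult_left_mono, auto)
  also have "\<dots> \<le> \<bar>a ^ s - c ^ s\<bar> + \<bar>b ^ t - d ^ t\<bar>"
    using power_product_diff_le[OF assms, of s t] by simp
  also have "\<dots> \<le> real s * \<bar>a - c\<bar> + real t * \<bar>b - d\<bar>"
    using assms by (intro add_mono power_diff_le)
  finally show ?thesis .
qed

lemma abs_wave_0_le: "0 \<le> d \<Longrightarrow> d \<le> 1 \<Longrightarrow> \<bar>wave d \<gamma> a 0\<bar> \<le> 1"
  by (simp add: wave_0 abs_mult power_le_one mult_le_one)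

lemma circle_coordinates_le_1:
  fixes \<rho> :: real and m n :: nat
  assumes "(real m)\<^sup>2 + (real n)\<^sup>2 = \<rho>\<^sup>2" "\<rho> > 0"
  shows "0 \<le> real m / \<rho> \<and> real m / \<rho> \<le> 1 \<and> 0 \<le> real n / \<rho> \<and> real n / \<rho> \<le> 1"
proof -
  have "(real m)\<^sup>2 \<le> \<rho>\<^sup>2" "(real n)\<^sup>2 \<le> \<rho>\<^sup>2"
    using assms(1) zero_le_power2[of "real m"] zero_le_power2[of "real n"] by linarith+
  then have "real m \<le> \<rho>" "real n \<le> \<rho>" using assms(2) by (auto intro: power2_le_imp_le)
  then show ?thesis using assms(2) by auto
qed

text \<open>Along the quarter circle, ordered by the first coordinate, x grows and y falls, so h =
  x^s - y^t increases and dominates the variation of x^s y^t. As h stays in [-1, 1], the bound is 1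
  + 2 = 3 for all s and t and any number of points.\<close>

lemma circle_signs:
  fixes P :: "(nat \<times> nat) set" and \<rho> :: real
  assumes P: "finite P" "\<rho> > 0" "\<And>q. q \<in> P \<Longrightarrow> (real (fst q))\<^sup>2 + (real (snd q))\<^sup>2 = \<rho>\<^sup>2"
  shows "\<exists>\<epsilon>. (\<forall>q. \<epsilon> q = 1 \<or> \<epsilon> q = - 1) \<and>
    (\<forall>s t. \<bar>\<Sum>q\<in>P. \<epsilon> q * ((real (fst q) / \<rho>) ^ s * (real (snd q) / \<rho>) ^ t)\<bar> \<le> 3)"
proof -
  have inj: "inj_on fst P"
  proof (rule inj_onI)
    fix q q' assume q: "q \<in> P" "q' \<in> P" "fst q = fst q'"
    then have "(real (snd q))\<^sup>2 = (real (snd q'))\<^sup>2" using P(3)[OF q(1)] P(3)[OF q(2)] unfolding q(3) by linarith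
    then have "snd q = snd q'" by simp
    then show "q = q'" using q(3) by (simp add: prod_eq_iff)
  qed
  define pt where "pt = inv_into P fst"
  have pt: "pt (fst q) = q" if "q \<in> P" for q unfolding pt_def by (rule inv_into_f_f[OF inj that])
  obtain s0 where s0: "\<forall>m. s0 m = 1 \<or> s0 m = - 1"
    and A: "\<And>(f :: nat \<Rightarrow> real) h B c H. B \<ge> 0 \<Longrightarrow> c \<le> H \<Longrightarrow> (\<forall>m\<in>fst ` P. \<bar>f m\<bar> \<le> B \<and> c \<le> h m \<and> h m \<le> H) \<Longrightarrow>
      (\<forall>m\<in>fst ` P. \<forall>m'\<in>fst ` P. m < m' \<longrightarrow> \<bar>f m' - f m\<bar> \<le> h m' - h m) \<Longrightarrow> \<bar>\<Sum>m\<in>fst ` P. s0 m * f m\<bar> \<le> B + (H - c)"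
    using alternating_signs[of "fst ` P"] P(1) by blast
  show ?thesis
  proof (rule exI[of _ "\<lambda>q. s0 (fst q)"], intro conjI allI)
    show "s0 (fst q) = 1 \<or> s0 (fst q) = - 1" for q :: "nat \<times> nat" using s0 by blast
    fix s t
    let ?x = "\<lambda>q::nat \<times> nat. real (fst q) / \<rho>" and ?y = "\<lambda>q::nat \<times> nat. real (snd q) / \<rho>"
    have x01: "0 \<le> ?x q" "?x q \<le> 1" "0 \<le> ?y q" "?y q \<le> 1" if "q \<in> P" for q
      using circle_coordinates_le_1[OF P(3)[OF that] P(2)] by blast+
    let ?f = "\<lambda>m. ?x (pt m) ^ s * ?y (pt m) ^ t" and ?h = "\<lambda>m. ?x (pt m) ^ s - ?y (pt m) ^ t"
    have "\<bar>\<Sum>m\<in>fst ` P. s0 m * ?f m\<bar> \<le> 1 + (1 - (- 1))"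
    proof (rule A[of 1 "- 1" 1 ?f ?h])
      show "\<forall>m\<in>fst ` P. \<bar>?f m\<bar> \<le> 1 \<and> - 1 \<le> ?h m \<and> ?h m \<le> 1"
      proof
        fix m assume "m \<in> fst ` P"
        then have q: "pt m \<in> P" using pt by force
        have "0 \<le> ?x (pt m) ^ s" "?x (pt m) ^ s \<le> 1" "0 \<le> ?y (pt m) ^ t" "?y (pt m) ^ t \<le> 1"
          using x01[OF q] by (auto intro: power_le_one)
        moreover from this have "\<bar>?f m\<bar> \<le> 1" by (simp add: abs_mult mult_le_one)
        ultimately show "\<bar>?f m\<bar> \<le> 1 \<and> - 1 \<le> ?h m \<and> ?h m \<le> 1" by linarith
      qed
      show "\<forall>m\<in>fst ` P. \<forall>m'\<in>fst ` P. m < m' \<longrightarrow> \<bar>?f m' - ?f m\<bar> \<le> ?h m' - ?h m"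
      proof (intro ballI impI)
        fix m m' assume m: "m \<in> fst ` P" "m' \<in> fst ` P" "m < m'"
        then obtain q q' where q: "q \<in> P" "q' \<in> P" "m = fst q" "m' = fst q'" by auto
        have "(real (fst q))\<^sup>2 \<le> (real (fst q'))\<^sup>2" using m q by (intro power_mono) auto
        then have "(real (snd q'))\<^sup>2 \<le> (real (snd q))\<^sup>2" using P(3)[OF q(1)] P(3)[OF q(2)] by linarith
        then have "real (snd q') \<le> real (snd q)" by (rule power2_le_imp_le) simp
        then have "?x q \<le> ?x q'" "?y q' \<le> ?y q" using m q P(2) by (auto intro: divide_right_mono)
        then have "?x q ^ s \<le> ?x q' ^ s" "?y q' ^ t \<le> ?y q ^ t"
          using x01[OF q(1)] x01[OF q(2)] by (auto intro: power_mono)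
        then show "\<bar>?f m' - ?f m\<bar> \<le> ?h m' - ?h m"
          using power_product_diff_le[of "?x q'" "?y q'" "?x q" "?y q" s t] x01[OF q(1)] x01[OF q(2)]
          unfolding q(3,4) pt[OF q(1)] pt[OF q(2)] by simp
      qed
    qed auto
    moreover have "(\<Sum>m\<in>fst ` P. s0 m * ?f m) = (\<Sum>q\<in>P. s0 (fst q) * (?x q ^ s * ?y q ^ t))"
      by (subst sum.reindex[OF inj]) (simp add: pt)
    ultimately show "\<bar>\<Sum>q\<in>P. s0 (fst q) * (?x q ^ s * ?y q ^ t)\<bar> \<le> 3" by simp
  qed
qed

text \<open>Direction i receives about A i sqrt N / K points carrying the phases of the wave to be
  built, so that K / sqrt N times their number is A i up to rounding. The remaining points get phase
  0 or pi with alternating signs. The errors are the spread \<eta> of the directions, linear in the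
  order of the derivative, one rounding K / sqrt N for each i, and three times K / sqrt N for the
  cancelling points.\<close>

lemma ex_phases:
  fixes P :: "(nat \<times> nat) set" and \<rho> K \<eta> :: real and A d1 d2 \<gamma> \<delta> :: "'i \<Rightarrow> real"
  assumes P: "finite P" "\<rho> > 0" "\<And>q. q \<in> P \<Longrightarrow> (real (fst q))\<^sup>2 + (real (snd q))\<^sup>2 = \<rho>\<^sup>2"
    and I: "finite I" "\<And>i. i \<in> I \<Longrightarrow> A i \<ge> 0 \<and> 0 \<le> d1 i \<and> d1 i \<le> 1 \<and> 0 \<le> d2 i \<and> d2 i \<le> 1"
    and K: "K > 0" and \<eta>: "\<eta> > 0" and N: "card P > 0"
    and near: "\<And>i. i \<in> I \<Longrightarrow> (\<Sum>j\<in>I. A j) / K * sqrt (real (card P)) \<le>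
      real (card {q \<in> P. \<bar>real (fst q) / \<rho> - d1 i\<bar> < \<eta> \<and> \<bar>real (snd q) / \<rho> - d2 i\<bar> < \<eta>})"
  shows "\<exists>\<alpha> \<beta>. \<forall>s t. \<bar>K / sqrt (real (card P)) * (\<Sum>q\<in>P. wave (real (fst q) / \<rho>) (\<alpha> q) s 0 * wave (real (snd q) / \<rho>) (\<beta> q) t 0)
      - (\<Sum>i\<in>I. A i * (wave (d1 i) (\<gamma> i) s 0 * wave (d2 i) (\<delta> i) t 0))\<bar>
    \<le> (\<Sum>i\<in>I. A i) * (real (s + t) * \<eta>) + (real (card I) + 3) * (K / sqrt (real (card P)))"
proof -
  define R where "R = sqrt (real (card P))"
  have R0: "R > 0" using N by (simp add: R_def)
  define E where "E = (\<lambda>i. {q \<in> P. \<bar>real (fst q) / \<rho> - d1 i\<bar> < \<eta> \<and> \<bar>real (snd q) / \<rho> - d2 i\<bar> < \<eta>})"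
  define n where "n = (\<lambda>i. nat \<lfloor>A i * R / K\<rfloor>)"
  have n: "real (n i) \<le> A i * R / K" "A i * R / K < real (n i) + 1" if "i \<in> I" for i
    using I(2)[OF that] R0 K by (auto simp: n_def)
  have fE: "finite (E i)" for i using P(1) by (simp add: E_def)
  have cE: "(\<Sum>j\<in>I. n j) \<le> card (E i)" if "i \<in> I" for i
  proof -
    have "real (\<Sum>j\<in>I. n j) \<le> (\<Sum>j\<in>I. A j * R / K)" using n by (auto intro!: sum_mono)
    also have "\<dots> = (\<Sum>j\<in>I. A j) / K * R" by (simp add: sum_divide_distrib sum_distrib_right)
    also have "\<dots> \<le> real (card (E i))" using near[OF that] by (simp add: R_def E_def)
    finally show ?thesis by (simp only: of_nat_le_iff)
  qed
  have "\<exists>C. (\<forall>i\<in>I. C i \<subseteq> E i \<and> card (C i) = n i) \<and> (\<forall>i\<in>I. \<forall>j\<in>I. i \<noteq> j \<longrightarrow> C i \<inter> C j = {})"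
    by (rule ex_disjoint_subsets[OF I(1)]) (rule fE cE, assumption?)+
  then obtain C where CE: "\<forall>i\<in>I. C i \<subseteq> E i \<and> card (C i) = n i" and Cd: "\<forall>i\<in>I. \<forall>j\<in>I. i \<noteq> j \<longrightarrow> C i \<inter> C j = {}"
    by (elim exE conjE) (rule that)
  define V where "V = (\<Union>i\<in>I. C i)"
  have VP: "V \<subseteq> P" using CE by (auto simp: V_def E_def)
  have fC: "finite (C i)" if "i \<in> I" for i using CE that fE finite_subset by blast
  define ind where "ind = (\<lambda>q. THE i. i \<in> I \<and> q \<in> C i)"
  have ind: "ind q = i" if "i \<in> I" "q \<in> C i" for i q
    unfolding ind_def using that Cd by (intro the_equality) auto
  obtain \<epsilon> where eps: "\<forall>q. \<epsilon> q = 1 \<or> \<epsilon> q = - 1"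
    and alt: "\<forall>s t. \<bar>\<Sum>q\<in>P - V. \<epsilon> q * ((real (fst q) / \<rho>) ^ s * (real (snd q) / \<rho>) ^ t)\<bar> \<le> 3"
    using circle_signs[of "P - V" \<rho>] P by auto
  define \<alpha> where "\<alpha> = (\<lambda>q. if q \<in> V then \<gamma> (ind q) else if \<epsilon> q = 1 then 0 else pi)"
  define \<beta> where "\<beta> = (\<lambda>q. if q \<in> V then \<delta> (ind q) else 0)"
  let ?x = "\<lambda>q::nat \<times> nat. real (fst q) / \<rho>" and ?y = "\<lambda>q::nat \<times> nat. real (snd q) / \<rho>"
  have x01: "0 \<le> ?x q \<and> ?x q \<le> 1 \<and> 0 \<le> ?y q \<and> ?y q \<le> 1" if "q \<in> P" for q
    using circle_coordinates_le_1[OF P(3)[OF that] P(2)] by blast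
  show ?thesis
    unfolding R_def[symmetric]
  proof (rule exI[of _ \<alpha>], rule exI[of _ \<beta>], intro allI)
    fix s t
    define F where "F = (\<lambda>q. wave (?x q) (\<alpha> q) s 0 * wave (?y q) (\<beta> q) t 0)"
    define G where "G = (\<lambda>i. wave (d1 i) (\<gamma> i) s 0 * wave (d2 i) (\<delta> i) t 0)"
    have G1: "\<bar>G i\<bar> \<le> 1" if "i \<in> I" for i
      unfolding G_def abs_mult using I(2)[OF that] by (intro mult_le_one abs_wave_0_le) auto
    have split: "(\<Sum>q\<in>P. F q) = (\<Sum>i\<in>I. \<Sum>q\<in>C i. F q) + (\<Sum>q\<in>P - V. F q)"
    proof -
      have "(\<Sum>q\<in>P. F q) = (\<Sum>q\<in>V. F q) + (\<Sum>q\<in>P - V. F q)"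
        using sum.subset_diff[OF VP P(1), of F] by simp
      also have "(\<Sum>q\<in>V. F q) = (\<Sum>i\<in>I. \<Sum>q\<in>C i. F q)"
        unfolding V_def using I(1) fC Cd by (intro sum.UNION_disjoint) auto
      finally show ?thesis .
    qed
    have rest: "\<bar>\<Sum>q\<in>P - V. F q\<bar> \<le> 3"
    proof -
      let ?c = "cos (real s * (pi / 2)) * cos (real t * (pi / 2))"
      \<comment> \<open>With phases 0 and pi, differentiation contributes a factor common to all
        these points, so the same signs cancel at every order.\<close>
      have "F q = ?c * (\<epsilon> q * (?x q ^ s * ?y q ^ t))" if "q \<in> P - V" for q
        using that eps[rule_format, of q] by (auto simp: F_def wave_0 \<alpha>_def \<beta>_def cos_add)
      then have "(\<Sum>q\<in>P - V. F q) = ?c * (\<Sum>q\<in>P - V. \<epsilon> q * (?x q ^ s * ?y q ^ t))"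
        unfolding sum_distrib_left by (intro sum.cong) auto
      moreover have "\<bar>?c\<bar> \<le> 1" by (simp add: abs_mult mult_le_one)
      ultimately show ?thesis
        using mult_mono[of "\<bar>?c\<bar>" 1 "\<bar>\<Sum>q\<in>P - V. \<epsilon> q * (?x q ^ s * ?y q ^ t)\<bar>" 3] alt[rule_format, of s t]
        by (simp add: abs_mult)
    qed
    have clus: "\<bar>K / R * (\<Sum>q\<in>C i. F q) - A i * G i\<bar> \<le> A i * (real (s + t) * \<eta>) + K / R" if i: "i \<in> I" for i
    proof -
      have qd: "\<bar>F q - G i\<bar> \<le> real (s + t) * \<eta>" if q: "q \<in> C i" for q
      proof -
        have qE: "q \<in> E i" "q \<in> V" using q CE i by (auto simp: V_def)
        then have qP: "q \<in> P" by (simp add: E_def)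
        have "\<bar>F q - G i\<bar> \<le> real s * \<bar>?x q - d1 i\<bar> + real t * \<bar>?y q - d2 i\<bar>"
          unfolding F_def G_def \<alpha>_def \<beta>_def using qE(2) ind[OF i q] x01[OF qP] I(2)[OF i]
          by (simp add: wave_product_diff_le)
        also have "\<dots> \<le> real s * \<eta> + real t * \<eta>"
          using qE(1) by (intro add_mono mult_left_mono) (auto simp: E_def)
        finally show ?thesis by (simp add: algebra_simps)
      qed
      have "\<bar>(\<Sum>q\<in>C i. F q) - real (n i) * G i\<bar> = \<bar>\<Sum>q\<in>C i. F q - G i\<bar>"
        using CE i by (simp add: sum_subtractf)
      also have "\<dots> \<le> (\<Sum>q\<in>C i. real (s + t) * \<eta>)"
        by (rule order_trans[OF sum_abs sum_mono]) (rule qd)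
      also have "\<dots> = real (n i) * (real (s + t) * \<eta>)" using CE i by simp
      finally have 1: "\<bar>(\<Sum>q\<in>C i. F q) - real (n i) * G i\<bar> \<le> real (n i) * (real (s + t) * \<eta>)" .
      have Kn: "K / R * real (n i) \<le> A i" "A i - K / R * real (n i) \<le> K / R"
      proof -
        show "K / R * real (n i) \<le> A i" using n(1)[OF i] K R0 by (simp add: field_simps)
        have "A i * R < K * real (n i) + K" using n(2)[OF i] K by (simp add: field_simps)
        then have "A i < (K * real (n i) + K) / R" using R0 by (simp add: pos_less_divide_eq)
        then show "A i - K / R * real (n i) \<le> K / R" by (simp add: add_divide_distrib)
      qed
      have "\<bar>K / R * (\<Sum>q\<in>C i. F q) - K / R * real (n i) * G i\<bar> = K / R * \<bar>(\<Sum>q\<in>C i. F q) - real (n i) * G i\<bar>"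
      proof -
        have "K / R * (\<Sum>q\<in>C i. F q) - K / R * real (n i) * G i = K / R * ((\<Sum>q\<in>C i. F q) - real (n i) * G i)"
          by (simp only: right_diff_distrib mult.assoc)
        then show ?thesis using K R0 by (simp only: abs_mult) simp
      qed
      also have "\<dots> \<le> K / R * (real (n i) * (real (s + t) * \<eta>))"
        using 1 K R0 by (intro mult_left_mono) auto
      finally have 2: "\<bar>K / R * (\<Sum>q\<in>C i. F q) - K / R * real (n i) * G i\<bar> \<le> (K / R * real (n i)) * (real (s + t) * \<eta>)"
        by (simp add: mult.assoc)
      have 3: "\<bar>K / R * real (n i) * G i - A i * G i\<bar> \<le> K / R"
      proof -
        have "\<bar>K / R * real (n i) * G i - A i * G i\<bar> = (A i - K / R * real (n i)) * \<bar>G i\<bar>"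
        proof -
          have "K / R * real (n i) * G i - A i * G i = (K / R * real (n i) - A i) * G i"
            by (simp only: left_diff_distrib)
          then show ?thesis using Kn(1) by (simp only: abs_mult abs_minus_commute[of _ "A i"])
        qed
        also have "\<dots> \<le> (K / R) * 1" using Kn G1[OF i] by (intro mult_mono) auto
        finally show ?thesis by simp
      qed
      have "(K / R * real (n i)) * (real (s + t) * \<eta>) \<le> A i * (real (s + t) * \<eta>)"
        using Kn(1) \<eta> by (intro mult_right_mono) auto
      from abs_le_add[OF _ order_trans[OF 2 this] 3] show ?thesis by simp
    qed
    have "K / R * (\<Sum>q\<in>P. F q) - (\<Sum>i\<in>I. A i * G i) =
       (\<Sum>i\<in>I. K / R * (\<Sum>q\<in>C i. F q) - A i * G i) + K / R * (\<Sum>q\<in>P - V. F q)"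
      unfolding split by (simp add: sum_subtractf distrib_left sum_distrib_left)
    moreover have "\<bar>\<Sum>i\<in>I. K / R * (\<Sum>q\<in>C i. F q) - A i * G i\<bar> \<le> (\<Sum>i\<in>I. A i * (real (s + t) * \<eta>) + K / R)"
      by (rule order_trans[OF sum_abs sum_mono]) (rule clus)
    moreover have "(\<Sum>i\<in>I. A i * (real (s + t) * \<eta>) + K / R) = (\<Sum>i\<in>I. A i) * (real (s + t) * \<eta>) + real (card I) * (K / R)"
      by (simp only: sum.distrib sum_distrib_right sum_constant)
    moreover have "\<bar>K / R * (\<Sum>q\<in>P - V. F q)\<bar> \<le> K / R * 3"
      unfolding abs_mult using rest K R0 by (intro mult_mono) auto
    ultimately have "\<bar>K / R * (\<Sum>q\<in>P. F q) - (\<Sum>i\<in>I. A i * G i)\<bar>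
      \<le> (\<Sum>i\<in>I. A i) * (real (s + t) * \<eta>) + real (card I) * (K / R) + K / R * 3"
      by linarith
    then show "\<bar>K / R * (\<Sum>q\<in>P. wave (?x q) (\<alpha> q) s 0 * wave (?y q) (\<beta> q) t 0) - (\<Sum>i\<in>I. A i * (wave (d1 i) (\<gamma> i) s 0 * wave (d2 i) (\<delta> i) t 0))\<bar>
      \<le> (\<Sum>i\<in>I. A i) * (real (s + t) * \<eta>) + (real (card I) + 3) * (K / R)"
      unfolding F_def G_def by (simp add: algebra_simps)
  qed
qed

section \<open>Comparison of Taylor coefficients\<close>

lemma abs_wave_le: "0 \<le> d \<Longrightarrow> d \<le> 1 \<Longrightarrow> \<bar>wave d \<gamma> a x\<bar> \<le> 1"
  by (simp add: wave_def abs_mult power_le_one mult_le_one)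

lemma wave_taylor:
  assumes d: "0 \<le> d" "d \<le> 1" and x: "\<bar>x\<bar> \<le> R"
  shows "\<bar>wave d \<gamma> a x - (\<Sum>m<T. x ^ m / fact m * wave d \<gamma> (a + m) 0)\<bar> \<le> R ^ T / fact T"
proof -
  obtain t where t: "wave d \<gamma> a x = (\<Sum>m<T. wave d \<gamma> (a + m) 0 / fact m * x ^ m) + wave d \<gamma> (a + T) t / fact T * x ^ T"
    using Maclaurin_all_le[of "\<lambda>m. wave d \<gamma> (a + m)" "wave d \<gamma> a" x T] wave_deriv by auto
  have "\<bar>wave d \<gamma> a x - (\<Sum>m<T. x ^ m / fact m * wave d \<gamma> (a + m) 0)\<bar> = \<bar>wave d \<gamma> (a + T) t\<bar> * (\<bar>x\<bar> ^ T / fact T)"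
    unfolding t by (simp add: abs_mult power_abs mult_ac)
  also have "\<dots> \<le> 1 * (R ^ T / fact T)"
    using x d by (intro mult_mono abs_wave_le divide_right_mono power_mono) auto
  finally show ?thesis by simp
qed

text \<open>The factor 3: with waves u, v and their Taylor polynomials X, Y one has u v - X Y = u (v
  - Y) + (u - X) Y, where |Y| \<le> 2 because the remainder is at most 1.\<close>

lemma wave_sum_taylor:
  fixes c d1 d2 \<gamma> \<delta> :: "'i \<Rightarrow> real"
  assumes J: "\<And>j. j \<in> J \<Longrightarrow> 0 \<le> d1 j \<and> d1 j \<le> 1 \<and> 0 \<le> d2 j \<and> d2 j \<le> 1"
    and xy: "\<bar>x\<bar> \<le> R" "\<bar>y\<bar> \<le> R" and T: "R ^ T / fact T \<le> 1"
  shows "\<bar>(\<Sum>j\<in>J. c j * (wave (d1 j) (\<gamma> j) a x * wave (d2 j) (\<delta> j) b y))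
      - (\<Sum>m<T. \<Sum>n<T. x ^ m / fact m * (y ^ n / fact n) *
          (\<Sum>j\<in>J. c j * (wave (d1 j) (\<gamma> j) (a + m) 0 * wave (d2 j) (\<delta> j) (b + n) 0)))\<bar>
    \<le> 3 * (R ^ T / fact T) * (\<Sum>j\<in>J. \<bar>c j\<bar>)"
proof -
  let ?r = "R ^ T / fact T"
  define X where "X = (\<lambda>j. \<Sum>m<T. x ^ m / fact m * wave (d1 j) (\<gamma> j) (a + m) 0)"
  define Y where "Y = (\<lambda>j. \<Sum>n<T. y ^ n / fact n * wave (d2 j) (\<delta> j) (b + n) 0)"
  have "(\<Sum>m<T. \<Sum>n<T. x ^ m / fact m * (y ^ n / fact n) *
          (\<Sum>j\<in>J. c j * (wave (d1 j) (\<gamma> j) (a + m) 0 * wave (d2 j) (\<delta> j) (b + n) 0)))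
      = (\<Sum>j\<in>J. c j * (X j * Y j))"
  proof -
    have "(\<Sum>j\<in>J. c j * (X j * Y j)) = (\<Sum>j\<in>J. \<Sum>m<T. \<Sum>n<T. x ^ m / fact m * (y ^ n / fact n) *
          (c j * (wave (d1 j) (\<gamma> j) (a + m) 0 * wave (d2 j) (\<delta> j) (b + n) 0)))"
      unfolding X_def Y_def sum_product unfolding sum_distrib_left by (intro sum.cong refl) (simp add: mult_ac)
    also have "\<dots> = (\<Sum>m<T. \<Sum>j\<in>J. \<Sum>n<T. x ^ m / fact m * (y ^ n / fact n) *
          (c j * (wave (d1 j) (\<gamma> j) (a + m) 0 * wave (d2 j) (\<delta> j) (b + n) 0)))"
      by (rule sum.swap)
    also have "\<dots> = (\<Sum>m<T. \<Sum>n<T. \<Sum>j\<in>J. x ^ m / fact m * (y ^ n / fact n) *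
          (c j * (wave (d1 j) (\<gamma> j) (a + m) 0 * wave (d2 j) (\<delta> j) (b + n) 0)))"
      by (intro sum.cong refl sum.swap)
    finally show ?thesis by (simp only: sum_distrib_left)
  qed
  moreover have "\<bar>c j * (wave (d1 j) (\<gamma> j) a x * wave (d2 j) (\<delta> j) b y) - c j * (X j * Y j)\<bar> \<le> 3 * ?r * \<bar>c j\<bar>"
    if j: "j \<in> J" for j
  proof -
    let ?u = "wave (d1 j) (\<gamma> j) a x" and ?v = "wave (d2 j) (\<delta> j) b y"
    have u: "\<bar>?u - X j\<bar> \<le> ?r"
      unfolding X_def by (rule wave_taylor) (use J[OF j] xy in blast)+
    have v: "\<bar>?v - Y j\<bar> \<le> ?r"
      unfolding Y_def by (rule wave_taylor) (use J[OF j] xy in blast)+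
    have u1: "\<bar>?u\<bar> \<le> 1" and v1: "\<bar>?v\<bar> \<le> 1" using J[OF j] by (auto intro!: abs_wave_le)
    have Y2: "\<bar>Y j\<bar> \<le> 2" using v v1 T by linarith
    have "\<bar>?u * (?v - Y j)\<bar> \<le> 1 * ?r" unfolding abs_mult using u1 v by (intro mult_mono) auto
    moreover have "\<bar>(?u - X j) * Y j\<bar> \<le> ?r * 2" unfolding abs_mult using u Y2 by (intro mult_mono) auto
    ultimately have "\<bar>?u * ?v - X j * Y j\<bar> \<le> 1 * ?r + ?r * 2"
      by (intro abs_le_add[of _ "?u * (?v - Y j)" "(?u - X j) * Y j"]) (simp_all add: algebra_simps)
    then have "\<bar>c j\<bar> * \<bar>?u * ?v - X j * Y j\<bar> \<le> \<bar>c j\<bar> * (3 * ?r)"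
      by (intro mult_left_mono) auto
    then show ?thesis by (simp add: abs_mult[symmetric] right_diff_distrib mult.commute)
  qed
  then have "\<bar>\<Sum>j\<in>J. c j * (wave (d1 j) (\<gamma> j) a x * wave (d2 j) (\<delta> j) b y) - c j * (X j * Y j)\<bar>
      \<le> (\<Sum>j\<in>J. 3 * ?r * \<bar>c j\<bar>)"
    by (intro order_trans[OF sum_abs sum_mono])
  ultimately show ?thesis by (simp only: sum_subtractf sum_distrib_left)
qed

lemma sum_exp_terms_le:
  fixes R :: real
  assumes "R \<ge> 0"
  shows "(\<Sum>m<T. R ^ m / fact m) \<le> exp R"
proof -
  have "(\<Sum>m<T. inverse (fact m) * R ^ m) \<le> (\<Sum>m. inverse (fact m) * R ^ m)"
    using assms by (intro sum_le_suminf summable_exp) auto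
  then show ?thesis by (simp add: exp_def divide_inverse mult.commute)
qed

text \<open>In a tuple (a, b, m, n), a and b are orders of differentiation and m and n are Taylor
  degrees.\<close>

definition taylor_indices :: "nat \<Rightarrow> nat \<Rightarrow> (nat \<times> nat \<times> nat \<times> nat) set" where
  "taylor_indices k T = {..k} \<times> {..k} \<times> {..<T} \<times> {..<T}"

definition taylor_weight :: "real \<Rightarrow> nat \<times> nat \<times> nat \<times> nat \<Rightarrow> real" where
  "taylor_weight R = (\<lambda>(a, b, m, n). R ^ m / fact m * (R ^ n / fact n))"

lemma taylor_weight_nonneg: "R \<ge> 0 \<Longrightarrow> taylor_weight R i \<ge> 0"
  by (simp add: taylor_weight_def case_prod_unfold)

text \<open>The factor 1 + a + m + b + n is the growth of the error in the choice of phases. It is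
  absorbed by 2^m 2^n, which doubles R in both exponential sums. The bound is free of T, so T can be
  fixed after the circle.\<close>

lemma taylor_weight_sum_le:
  assumes "R \<ge> 0"
  shows "(\<Sum>(a, b, m, n)\<in>taylor_indices k T. taylor_weight R (a, b, m, n) * (1 + real (a + m + (b + n))))
     \<le> (2 * real k + 2) * (real k + 1)\<^sup>2 * exp (4 * R)"
proof -
  have "(\<Sum>(a, b, m, n)\<in>taylor_indices k T. taylor_weight R (a, b, m, n) * (1 + real (a + m + (b + n))))
      \<le> (\<Sum>(a, b, m, n)\<in>taylor_indices k T. (2 * real k + 2) * ((2 * R) ^ m / fact m * ((2 * R) ^ n / fact n)))"
  proof (rule sum_mono, clarify)
    fix a b m n assume "(a, b, m, n) \<in> taylor_indices k T"
    then have ab: "a \<le> k" "b \<le> k" by (auto simp: taylor_indices_def)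
    have mn: "real m + real n \<le> 2 ^ m * 2 ^ n"
    proof -
      have "m + n < 2 ^ (m + n)" by (rule less_exp)
      then have "real (m + n) \<le> real (2 ^ (m + n))" by (simp only: of_nat_le_iff)
      then show ?thesis by (simp add: power_add)
    qed
    have p1: "(1::real) \<le> 2 ^ m * 2 ^ n" by (simp flip: power_add)
    have "1 + real (a + m + (b + n)) \<le> (2 * real k + 1) * 1 + (real m + real n)" using ab by simp
    also have "\<dots> \<le> (2 * real k + 1) * (2 ^ m * 2 ^ n) + 2 ^ m * 2 ^ n"
      using mn p1 by (intro add_mono mult_left_mono) auto
    finally have "1 + real (a + m + (b + n)) \<le> (2 * real k + 2) * (2 ^ m * 2 ^ n)" by (simp add: algebra_simps)
    then have "taylor_weight R (a, b, m, n) * (1 + real (a + m + (b + n))) \<le>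
        taylor_weight R (a, b, m, n) * ((2 * real k + 2) * (2 ^ m * 2 ^ n))"
      using taylor_weight_nonneg[OF assms] by (intro mult_left_mono)
    then show "taylor_weight R (a, b, m, n) * (1 + real (a + m + (b + n))) \<le>
        (2 * real k + 2) * ((2 * R) ^ m / fact m * ((2 * R) ^ n / fact n))"
      by (simp add: taylor_weight_def power_mult_distrib mult_ac)
  qed
  also have "\<dots> = (2 * real k + 2) * (real k + 1)\<^sup>2 * ((\<Sum>m<T. (2 * R) ^ m / fact m) * (\<Sum>n<T. (2 * R) ^ n / fact n))"
  proof -
    have "(\<Sum>(a, b, m, n)\<in>taylor_indices k T. (2 * real k + 2) * ((2 * R) ^ m / fact m * ((2 * R) ^ n / fact n)))
      = (\<Sum>a\<le>k. \<Sum>b\<le>k. \<Sum>m<T. \<Sum>n<T. (2 * real k + 2) * ((2 * R) ^ m / fact m * ((2 * R) ^ n / fact n)))"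
      unfolding taylor_indices_def by (simp only: sum.cartesian_product)
    also have "\<dots> = (real k + 1) * ((real k + 1) * (\<Sum>m<T. \<Sum>n<T. (2 * real k + 2) * ((2 * R) ^ m / fact m * ((2 * R) ^ n / fact n))))"
      by (simp add: add.commute[of 1])
    also have "(\<Sum>m<T. \<Sum>n<T. (2 * real k + 2) * ((2 * R) ^ m / fact m * ((2 * R) ^ n / fact n)))
      = (2 * real k + 2) * ((\<Sum>m<T. (2 * R) ^ m / fact m) * (\<Sum>n<T. (2 * R) ^ n / fact n))"
      by (simp only: sum_product) (simp only: sum_distrib_left)
    finally show ?thesis by (simp only: power2_eq_square mult_ac)
  qed
  also have "\<dots> \<le> (2 * real k + 2) * (real k + 1)\<^sup>2 * (exp (2 * R) * exp (2 * R))"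
    using assms by (intro mult_left_mono mult_mono sum_exp_terms_le sum_nonneg) auto
  also have "exp (2 * R) * exp (2 * R) = exp (4 * R)" by (simp flip: exp_add)
  finally show ?thesis .
qed

text \<open>Two sums of waves are compared on a square through their derivatives at 0. The
  right-hand side sums over all a, b up to k, so a single quantity controls every derivative at
  once.\<close>

lemma wave_sums_close:
  fixes c d1 d2 \<gamma> \<delta> :: "'i \<Rightarrow> real" and c' d1' d2' \<gamma>' \<delta>' :: "'j \<Rightarrow> real"
  assumes J: "\<And>j. j \<in> J \<Longrightarrow> 0 \<le> d1 j \<and> d1 j \<le> 1 \<and> 0 \<le> d2 j \<and> d2 j \<le> 1"
    and J': "\<And>j. j \<in> J' \<Longrightarrow> 0 \<le> d1' j \<and> d1' j \<le> 1 \<and> 0 \<le> d2' j \<and> d2' j \<le> 1"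
    and xy: "\<bar>x\<bar> \<le> R" "\<bar>y\<bar> \<le> R" and T: "R ^ T / fact T \<le> 1" and ab: "a \<le> k" "b \<le> k"
  shows "\<bar>(\<Sum>j\<in>J. c j * (wave (d1 j) (\<gamma> j) a x * wave (d2 j) (\<delta> j) b y))
        - (\<Sum>j\<in>J'. c' j * (wave (d1' j) (\<gamma>' j) a x * wave (d2' j) (\<delta>' j) b y))\<bar>
    \<le> (\<Sum>(a, b, m, n)\<in>taylor_indices k T. taylor_weight R (a, b, m, n) *
        \<bar>(\<Sum>j\<in>J. c j * (wave (d1 j) (\<gamma> j) (a + m) 0 * wave (d2 j) (\<delta> j) (b + n) 0))
         - (\<Sum>j\<in>J'. c' j * (wave (d1' j) (\<gamma>' j) (a + m) 0 * wave (d2' j) (\<delta>' j) (b + n) 0))\<bar>)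
      + 3 * (R ^ T / fact T) * ((\<Sum>j\<in>J. \<bar>c j\<bar>) + (\<Sum>j\<in>J'. \<bar>c' j\<bar>))"
proof -
  define X where "X = (\<lambda>s t. \<Sum>j\<in>J. c j * (wave (d1 j) (\<gamma> j) s 0 * wave (d2 j) (\<delta> j) t 0))"
  define X' where "X' = (\<lambda>s t. \<Sum>j\<in>J'. c' j * (wave (d1' j) (\<gamma>' j) s 0 * wave (d2' j) (\<delta>' j) t 0))"
  let ?V = "\<Sum>j\<in>J. c j * (wave (d1 j) (\<gamma> j) a x * wave (d2 j) (\<delta> j) b y)"
  let ?V' = "\<Sum>j\<in>J'. c' j * (wave (d1' j) (\<gamma>' j) a x * wave (d2' j) (\<delta>' j) b y)"
  let ?p = "\<lambda>m n. x ^ m / fact m * (y ^ n / fact n)"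
  have R0: "R \<ge> 0" using xy by simp
  have 1: "\<bar>?V - (\<Sum>m<T. \<Sum>n<T. ?p m n * X (a + m) (b + n))\<bar> \<le> 3 * (R ^ T / fact T) * (\<Sum>j\<in>J. \<bar>c j\<bar>)"
    unfolding X_def by (rule wave_sum_taylor[OF J xy T])
  have 2: "\<bar>?V' - (\<Sum>m<T. \<Sum>n<T. ?p m n * X' (a + m) (b + n))\<bar> \<le> 3 * (R ^ T / fact T) * (\<Sum>j\<in>J'. \<bar>c' j\<bar>)"
    unfolding X'_def by (rule wave_sum_taylor[OF J' xy T])
  let ?g = "\<lambda>a b m n. taylor_weight R (a, b, m, n) * \<bar>X (a + m) (b + n) - X' (a + m) (b + n)\<bar>"
  have g0: "?g a b m n \<ge> 0" for a b m n using taylor_weight_nonneg[OF R0] by simp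
  have "\<bar>(\<Sum>m<T. \<Sum>n<T. ?p m n * X (a + m) (b + n)) - (\<Sum>m<T. \<Sum>n<T. ?p m n * X' (a + m) (b + n))\<bar>
     = \<bar>\<Sum>m<T. \<Sum>n<T. ?p m n * (X (a + m) (b + n) - X' (a + m) (b + n))\<bar>"
    by (simp only: sum_subtractf right_diff_distrib)
  also have "\<dots> \<le> (\<Sum>m<T. \<Sum>n<T. \<bar>?p m n * (X (a + m) (b + n) - X' (a + m) (b + n))\<bar>)"
    by (intro order_trans[OF sum_abs sum_mono] sum_abs)
  also have "\<dots> \<le> (\<Sum>m<T. \<Sum>n<T. ?g a b m n)"
  proof (intro sum_mono)
    fix m n
    have "\<bar>?p m n\<bar> \<le> taylor_weight R (a, b, m, n)"
      unfolding taylor_weight_def abs_mult using xy R0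
      by (auto simp: power_abs intro!: mult_mono divide_right_mono power_mono)
    then show "\<bar>?p m n * (X (a + m) (b + n) - X' (a + m) (b + n))\<bar> \<le> ?g a b m n"
      unfolding abs_mult[of "?p m n"] by (intro mult_right_mono) auto
  qed
  also have "\<dots> \<le> (\<Sum>b\<le>k. \<Sum>m<T. \<Sum>n<T. ?g a b m n)"
    using ab g0 by (intro member_le_sum sum_nonneg) auto
  also have "\<dots> \<le> (\<Sum>a\<le>k. \<Sum>b\<le>k. \<Sum>m<T. \<Sum>n<T. ?g a b m n)"
    using ab g0 by (intro member_le_sum[of a "{..k}" "\<lambda>a. \<Sum>b\<le>k. \<Sum>m<T. \<Sum>n<T. ?g a b m n"] sum_nonneg) auto
  also have "\<dots> = (\<Sum>(a, b, m, n)\<in>taylor_indices k T. ?g a b m n)"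
    unfolding taylor_indices_def by (simp only: sum.cartesian_product)
  finally have 3: "\<bar>(\<Sum>m<T. \<Sum>n<T. ?p m n * X (a + m) (b + n)) - (\<Sum>m<T. \<Sum>n<T. ?p m n * X' (a + m) (b + n))\<bar>
     \<le> (\<Sum>(a, b, m, n)\<in>taylor_indices k T. ?g a b m n)" .
  have "\<bar>?V - ?V'\<bar> \<le> (\<Sum>(a, b, m, n)\<in>taylor_indices k T. ?g a b m n) + (3 * (R ^ T / fact T) * (\<Sum>j\<in>J. \<bar>c j\<bar>) + 3 * (R ^ T / fact T) * (\<Sum>j\<in>J'. \<bar>c' j\<bar>))"
    using 1 2 3 by (simp only: abs_le_iff) linarith
  then show ?thesis unfolding X_def X'_def by (simp only: distrib_left)
qed

section \<open>The approximation on one circle\<close>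

lemma no_relations_circle_points:
  assumes p: "prime p" "p > 2" "p > 2 * (D + 2)\<^sup>2"
  shows "no_relations (int D + 2) (fst ` circle_points p b)"
  unfolding no_relations_def
proof (intro allI impI)
  fix k assume "\<forall>m\<in>fst ` circle_points p b. \<bar>k m\<bar> \<le> int D + 2" "(\<Sum>m\<in>fst ` circle_points p b. k m * int m) = 0"
  moreover have "int p > 2 * (int D + 2)\<^sup>2"
  proof -
    have "int p > int (2 * (D + 2)\<^sup>2)" using p(3) by (simp only: of_nat_less_iff)
    then show ?thesis by (simp add: add.commute)
  qed
  ultimately show "\<forall>m\<in>fst ` circle_points p b. k m = 0"
    using circle_points_no_relation[OF p(1) _ p(2), of "int D + 2" b k] by blast
qed

lemma circle_points_nonempty:
  assumes p: "prime p" "p = A\<^sup>2 + B\<^sup>2" and J: "J \<ge> 1"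
  shows "circle_points p (2 * J - 1) \<noteq> {}"
proof -
  have sq: "p \<noteq> x\<^sup>2" for x using p(1) prime_power_iff[of x 2] by auto
  have "A > 0" "B > 0" using sq[of A] sq[of B] p(2) by (auto intro!: gr0I)
  then have "(A, B) \<in> circle_points p 1" using p(2) by (simp add: circle_points_def)
  from circle_points_scale[OF prime_gt_0_nat[OF p(1)] this, of "J - 1"]
  have "(p ^ (J - 1) * A, p ^ (J - 1) * B) \<in> circle_points p (1 + 2 * (J - 1))" .
  moreover have "1 + 2 * (J - 1) = 2 * J - 1" using J by simp
  ultimately show ?thesis by (metis empty_iff)
qed

definition weight_bound :: "nat \<Rightarrow> real \<Rightarrow> real" where
  "weight_bound k R = (2 * real k + 2) * (real k + 1)\<^sup>2 * exp (4 * R)"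

text \<open>The deviation from Y is a fluctuation plus the error of the mean. The fluctuation F is
  known only in weighted square mean, and |F| \<le> \<nu>/2 + F^2/(2 \<nu>) turns this into a sum of
  absolute values. The mean carries one factor \<kappa> for each variable. The 32 is twice the bound
  16 for the sum of the squared coefficients, each at most 4 / sqrt N.\<close>

lemma fluctuation_taylor_sum_le:
  fixes P :: "(nat \<times> nat) set" and \<rho> :: real and Y :: "nat \<Rightarrow> nat \<Rightarrow> real"
  assumes P: "finite P" "\<rho> > 0" "\<And>q. q \<in> P \<Longrightarrow> (real (fst q))\<^sup>2 + (real (snd q))\<^sup>2 = \<rho>\<^sup>2" and N: "card P > 0"
    and S: "finite S" "fst ` P \<subseteq> S" "snd ` P \<subseteq> S" "no_relations (int D + 2) S"
    and D: "D \<ge> 1" "32 / real (D + 1) \<le> \<nu>\<^sup>2" and \<nu>: "\<nu> > 0" and R: "R \<ge> 0"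
  defines "\<kappa> \<equiv> real D / real (D + 1)"
  assumes mean: "\<And>s t. \<bar>4 * \<kappa>\<^sup>2 / sqrt (real (card P)) *
        (\<Sum>q\<in>P. wave (real (fst q) / \<rho>) (\<alpha> q) s 0 * wave (real (snd q) / \<rho>) (\<beta> q) t 0) - Y s t\<bar> \<le> \<nu> * (1 + real (s + t))"
  shows "\<exists>x y. 0 \<le> x \<and> x < 1 \<and> 0 \<le> y \<and> y < 1 \<and>
    (\<Sum>(a, b, m, n)\<in>taylor_indices k T. taylor_weight R (a, b, m, n) *
      \<bar>(\<Sum>q\<in>P. 4 / sqrt (real (card P)) * (wave (real (fst q) / \<rho>) (2 * pi * real (fst q) * x + \<mu>) (a + m) 0 *
          wave (real (snd q) / \<rho>) (2 * pi * real (snd q) * y + \<mu>) (b + n) 0)) - Y (a + m) (b + n)\<bar>)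
    \<le> 2 * \<nu> * weight_bound k R"
proof -
  define Rt where "Rt = sqrt (real (card P))"
  have Rt: "Rt > 0" "Rt\<^sup>2 = real (card P)" using N by (auto simp: Rt_def)
  have sq: "fst q = fst q' \<longleftrightarrow> snd q = snd q'" if "q \<in> P" "q' \<in> P" for q q'
  proof -
    have "(real (fst q))\<^sup>2 + (real (snd q))\<^sup>2 = (real (fst q'))\<^sup>2 + (real (snd q'))\<^sup>2"
      using P(3)[OF that(1)] P(3)[OF that(2)] by simp
    then show ?thesis
      by (metis add_left_cancel add_right_cancel of_nat_0_le_iff of_nat_eq_iff power2_eq_imp_eq)
  qed
  have inj1: "inj_on fst P" and inj2: "inj_on snd P"
    using sq by (auto intro!: inj_onI simp: prod_eq_iff)
  \<comment> \<open>The given phases are indexed by points, those of the weight by coordinates. The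
    shift \<mu> is already present in every wave and is therefore subtracted.\<close>
  define \<alpha>' where "\<alpha>' = (\<lambda>m. \<alpha> (inv_into P fst m) - \<mu>)"
  define \<beta>' where "\<beta>' = (\<lambda>n. \<beta> (inv_into P snd n) - \<mu>)"
  define xi where "xi = (\<lambda>q::nat \<times> nat. real (fst q) / \<rho>)"
  define yi where "yi = (\<lambda>q::nat \<times> nat. real (snd q) / \<rho>)"
  have x01: "0 \<le> xi q \<and> xi q \<le> 1 \<and> 0 \<le> yi q \<and> yi q \<le> 1" if "q \<in> P" for q
    using circle_coordinates_le_1[OF P(3)[OF that] P(2)] by (simp only: xi_def yi_def)
  define c where "c = (\<lambda>(a, b, m, n). \<lambda>q. 4 / Rt * (xi q ^ (a + m) * yi q ^ (b + n)))"
  define \<sigma> where "\<sigma> = (\<lambda>(a::nat, b::nat, m::nat, n::nat). \<mu> + real (a + m) * (pi / 2))"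
  define \<tau> where "\<tau> = (\<lambda>(a::nat, b::nat, m::nat, n::nat). \<mu> + real (b + n) * (pi / 2))"
  have cV: "(\<Sum>q\<in>P. (c i q)\<^sup>2) \<le> 16" for i
  proof -
    obtain a b m n where i: "i = (a, b, m, n)" by (cases i)
    have "(c i q)\<^sup>2 \<le> 16 / real (card P)" if "q \<in> P" for q
    proof -
      have "\<bar>xi q ^ (a + m) * yi q ^ (b + n)\<bar> \<le> 1"
        using x01[OF that] by (simp add: abs_mult power_le_one mult_le_one)
      then have "(xi q ^ (a + m) * yi q ^ (b + n))\<^sup>2 \<le> 1" by (simp add: abs_square_le_1)
      then have "(4 / Rt)\<^sup>2 * (xi q ^ (a + m) * yi q ^ (b + n))\<^sup>2 \<le> (4 / Rt)\<^sup>2 * 1" by (intro mult_left_mono) auto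
      then show ?thesis by (simp add: i c_def power_mult_distrib power_divide Rt(2))
    qed
    then have "(\<Sum>q\<in>P. (c i q)\<^sup>2) \<le> (\<Sum>q\<in>P. 16 / real (card P))" by (intro sum_mono)
    also have "\<dots> = 16" using N by simp
    finally show ?thesis .
  qed
  let ?I = "taylor_indices k T"
  define Fl where "Fl = (\<lambda>x y i. \<Sum>q\<in>P. c i q * (cos (2 * pi * real (fst q) * x + \<sigma> i) * cos (2 * pi * real (snd q) * y + \<tau> i)
       - (\<kappa> * cos (\<alpha>' (fst q) + \<sigma> i)) * (\<kappa> * cos (\<beta>' (snd q) + \<tau> i))))"
  obtain x y where xy: "0 \<le> x" "x < 1" "0 \<le> y" "y < 1"
    and fl: "(\<Sum>i\<in>?I. taylor_weight R i * (Fl x y i)\<^sup>2) \<le> 2 * 16 / real (D + 1) * (\<Sum>i\<in>?I. taylor_weight R i)"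
    using ex_small_fluctuation[OF P(1) inj1 inj2 S D(1), where I = ?I and c = c and V = 16 and \<rho> = "taylor_weight R"
        and \<sigma> = \<sigma> and \<tau> = \<tau> and \<alpha> = \<alpha>' and \<beta> = \<beta>', OF cV taylor_weight_nonneg[OF R], folded \<kappa>_def Fl_def]
    by (elim exE conjE) (rule that[unfolded Fl_def])
  define X where "X = (\<lambda>s t. \<Sum>q\<in>P. 4 / Rt * (wave (xi q) (2 * pi * real (fst q) * x + \<mu>) s 0 * wave (yi q) (2 * pi * real (snd q) * y + \<mu>) t 0))"
  define M where "M = (\<lambda>s t. 4 * \<kappa>\<^sup>2 / Rt * (\<Sum>q\<in>P. wave (xi q) (\<alpha> q) s 0 * wave (yi q) (\<beta> q) t 0))"
  have FlXM: "Fl x y (a, b, m, n) = X (a + m) (b + n) - M (a + m) (b + n)" for a b m n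
  proof -
    have "c (a, b, m, n) q * (cos (2 * pi * real (fst q) * x + \<sigma> (a, b, m, n)) * cos (2 * pi * real (snd q) * y + \<tau> (a, b, m, n))
       - (\<kappa> * cos (\<alpha>' (fst q) + \<sigma> (a, b, m, n))) * (\<kappa> * cos (\<beta>' (snd q) + \<tau> (a, b, m, n))))
      = 4 / Rt * (wave (xi q) (2 * pi * real (fst q) * x + \<mu>) (a + m) 0 * wave (yi q) (2 * pi * real (snd q) * y + \<mu>) (b + n) 0)
        - 4 * \<kappa>\<^sup>2 / Rt * (wave (xi q) (\<alpha> q) (a + m) 0 * wave (yi q) (\<beta> q) (b + n) 0)" if "q \<in> P" for q
      unfolding wave_0 c_def \<sigma>_def \<tau>_def \<alpha>'_def \<beta>'_def
      using inv_into_f_f[OF inj1 that] inv_into_f_f[OF inj2 that]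
      by (simp add: algebra_simps power2_eq_square)
    then show ?thesis
      unfolding Fl_def X_def M_def sum_distrib_left sum_subtractf[symmetric] by (intro sum.cong refl)
  qed
  have W: "(\<Sum>(a, b, m, n)\<in>?I. taylor_weight R (a, b, m, n) * (1 + real (a + m + (b + n)))) \<le> weight_bound k R"
    unfolding weight_bound_def by (rule taylor_weight_sum_le[OF R])
  have W1: "(\<Sum>i\<in>?I. taylor_weight R i) \<le> weight_bound k R"
  proof (rule order_trans[OF sum_mono W])
    fix i show "taylor_weight R i \<le> (case i of (a, b, m, n) \<Rightarrow> taylor_weight R (a, b, m, n) * (1 + real (a + m + (b + n))))"
      using taylor_weight_nonneg[OF R, of i] by (cases i) (auto simp: algebra_simps)
  qed
  have W0: "(\<Sum>i\<in>?I. taylor_weight R i) \<ge> 0" by (intro sum_nonneg taylor_weight_nonneg R)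
  have fl2: "(\<Sum>i\<in>?I. taylor_weight R i * (Fl x y i)\<^sup>2) \<le> \<nu>\<^sup>2 * weight_bound k R"
  proof -
    have "2 * 16 / real (D + 1) * (\<Sum>i\<in>?I. taylor_weight R i) \<le> \<nu>\<^sup>2 * weight_bound k R"
      using D(2) W1 W0 by (intro mult_mono) auto
    then show ?thesis using fl by linarith
  qed
  have "(\<Sum>(a, b, m, n)\<in>?I. taylor_weight R (a, b, m, n) * \<bar>X (a + m) (b + n) - Y (a + m) (b + n)\<bar>)
    \<le> (\<Sum>(a, b, m, n)\<in>?I. taylor_weight R (a, b, m, n) * (1 + real (a + m + (b + n))) * \<nu>
        + (taylor_weight R (a, b, m, n) * (\<nu> / 2) + taylor_weight R (a, b, m, n) * (Fl x y (a, b, m, n))\<^sup>2 * (1 / (2 * \<nu>))))"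
  proof (rule sum_mono, clarify)
    fix a b m n
    have amgm: "\<bar>F\<bar> \<le> \<nu> / 2 + F\<^sup>2 * (1 / (2 * \<nu>))" for F
    proof -
      have "0 \<le> (\<bar>F\<bar> - \<nu>)\<^sup>2" by simp
      then have "2 * \<nu> * \<bar>F\<bar> \<le> \<nu>\<^sup>2 + F\<^sup>2" by (simp add: power2_eq_square algebra_simps)
      then show ?thesis using \<nu> by (simp add: field_simps power2_eq_square)
    qed
    have mY: "\<bar>M (a + m) (b + n) - Y (a + m) (b + n)\<bar> \<le> \<nu> * (1 + real (a + m + (b + n)))"
      using mean[of "a + m" "b + n"] by (simp only: M_def xi_def yi_def Rt_def)
    have "\<bar>X (a + m) (b + n) - Y (a + m) (b + n)\<bar> \<le> \<nu> * (1 + real (a + m + (b + n))) + (\<nu> / 2 + (Fl x y (a, b, m, n))\<^sup>2 * (1 / (2 * \<nu>)))"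
      by (rule abs_le_add[OF _ mY amgm]) (simp add: FlXM)
    from mult_left_mono[OF this taylor_weight_nonneg[OF R, of "(a, b, m, n)"]]
    show "taylor_weight R (a, b, m, n) * \<bar>X (a + m) (b + n) - Y (a + m) (b + n)\<bar> \<le>
       taylor_weight R (a, b, m, n) * (1 + real (a + m + (b + n))) * \<nu>
        + (taylor_weight R (a, b, m, n) * (\<nu> / 2) + taylor_weight R (a, b, m, n) * (Fl x y (a, b, m, n))\<^sup>2 * (1 / (2 * \<nu>)))"
      by (simp only: distrib_left mult_ac)
  qed
  also have "\<dots> = (\<Sum>(a, b, m, n)\<in>?I. taylor_weight R (a, b, m, n) * (1 + real (a + m + (b + n)))) * \<nu>
      + ((\<Sum>i\<in>?I. taylor_weight R i) * (\<nu> / 2) + (\<Sum>i\<in>?I. taylor_weight R i * (Fl x y i)\<^sup>2) * (1 / (2 * \<nu>)))"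
    by (simp only: case_prod_unfold sum.distrib sum_distrib_right prod.collapse)
  also have "\<dots> \<le> weight_bound k R * \<nu> + (weight_bound k R * (\<nu> / 2) + \<nu>\<^sup>2 * weight_bound k R * (1 / (2 * \<nu>)))"
    using W W1 fl2 \<nu> by (intro add_mono mult_right_mono) auto
  also have "\<dots> = 2 * \<nu> * weight_bound k R" using \<nu> by (simp add: power2_eq_square)
  finally show ?thesis
    using xy unfolding X_def Rt_def xi_def yi_def by blast
qed

text \<open>The quantifier over T stands after p and e because the Taylor remainder still to be
  beaten is multiplied by 4 sqrt N, which is known only once the circle is.\<close>

lemma ex_circle_approximation:
  fixes A d1 d2 \<gamma> \<delta> :: "'i \<Rightarrow> real"
  assumes I: "finite I" "\<forall>i\<in>I. A i \<ge> 0 \<and> d1 i \<ge> 0 \<and> d2 i \<ge> 0 \<and> (d1 i)\<^sup>2 + (d2 i)\<^sup>2 = 1"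
    and \<nu>: "\<nu> > 0" and R: "R \<ge> 0"
  shows "\<exists>p e. prime p \<and> p > 2 \<and> odd e \<and> circle_points p e \<noteq> {} \<and> (\<forall>T \<mu>. \<exists>x y. 0 \<le> x \<and> x < 1 \<and> 0 \<le> y \<and> y < 1 \<and>
    (\<Sum>(a, b, m, n)\<in>taylor_indices k T. taylor_weight R (a, b, m, n) *
      \<bar>(\<Sum>q\<in>circle_points p e. 4 / sqrt (real (card (circle_points p e))) *
          (wave (real (fst q) / sqrt (real p ^ e)) (2 * pi * real (fst q) * x + \<mu>) (a + m) 0 *
           wave (real (snd q) / sqrt (real p ^ e)) (2 * pi * real (snd q) * y + \<mu>) (b + n) 0))
       - (\<Sum>i\<in>I. A i * (wave (d1 i) (\<gamma> i) (a + m) 0 * wave (d2 i) (\<delta> i) (b + n) 0))\<bar>)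
    \<le> 2 * \<nu> * weight_bound k R)"
proof -
  obtain D0 :: nat where D0: "real D0 > 32 / \<nu>\<^sup>2" using reals_Archimedean2 by blast
  define D where "D = D0 + 1"
  have D: "D \<ge> 1" "32 / real (D + 1) \<le> \<nu>\<^sup>2"
  proof -
    have "32 < real D0 * \<nu>\<^sup>2" using D0 \<nu> by (simp add: pos_divide_less_eq)
    also have "\<dots> \<le> real (D + 1) * \<nu>\<^sup>2" by (intro mult_right_mono) (auto simp: D_def)
    finally show "32 / real (D + 1) \<le> \<nu>\<^sup>2" by (simp add: pos_divide_le_eq mult.commute)
  qed (simp add: D_def)
  \<comment> \<open>Large enough to exclude relations with coefficients up to D + 2; the final
    summand 2 ensures p > 2.\<close>
  obtain p A0 B0 :: nat where p: "prime p" "p > 2 * (D + 2)\<^sup>2 + 2" "p = A0\<^sup>2 + B0\<^sup>2"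
    using ex_prime_sum_squares_gt by blast
  have p2: "p > 2" "p > 2 * (D + 2)\<^sup>2" using p(2) by auto
  have pint: "int p = (int A0)\<^sup>2 + (int B0)\<^sup>2" using p(3) by simp
  define \<kappa> where "\<kappa> = real D / real (D + 1)"
  \<comment> \<open>The amplitude 4 of the eigenfunction, damped by \<kappa> in each variable; D
    \<ge> 1 keeps it at least 1.\<close>
  define K where "K = 4 * \<kappa>\<^sup>2"
  have \<kappa>: "1 / 2 \<le> \<kappa>" "\<kappa> \<le> 1" using D(1) by (auto simp: \<kappa>_def field_simps)
  have K: "1 \<le> K" "K \<le> 4"
    using power_mono[OF \<kappa>(1), of 2] power_mono[OF \<kappa>(2), of 2] \<kappa> by (auto simp: K_def power2_eq_square)
  define SA where "SA = (\<Sum>i\<in>I. A i)"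
  have SA: "SA \<ge> 0" unfolding SA_def using I(2) by (intro sum_nonneg) auto
  define \<eta> where "\<eta> = \<nu> / (SA + 1)"
  have \<eta>: "\<eta> > 0" "SA * \<eta> \<le> \<nu>" using \<nu> SA by (auto simp: \<eta>_def field_simps)
  \<comment> \<open>The summand SA covers the points demanded near each direction; the second
    summand makes the error (card I + 3) K / sqrt N at most \<nu>, once sqrt N \<ge> C.\<close>
  define C where "C = SA + (real (card I) + 3) * 4 / \<nu> + 1"
  have C: "C > 0" "SA \<le> C" "(real (card I) + 3) * 4 / \<nu> \<le> C"
    using SA \<nu> by (auto simp: C_def add_nonneg_pos add_pos_pos)
  obtain J0 where J0: "\<forall>J\<ge>J0. \<forall>d1 d2. d1 \<ge> 0 \<longrightarrow> d2 \<ge> 0 \<longrightarrow> d1\<^sup>2 + d2\<^sup>2 = 1 \<longrightarrow>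
     C * sqrt (real (card (circle_points p (2 * J - 1)))) \<le>
     real (card {q \<in> circle_points p (2 * J - 1).
       \<bar>real (fst q) / sqrt (real p ^ (2 * J - 1)) - d1\<bar> < \<eta> \<and>
       \<bar>real (snd q) / sqrt (real p ^ (2 * J - 1)) - d2\<bar> < \<eta>})"
    using circle_points_many_near[OF p(1) p2(1) pint C(1) \<eta>(1)] by (elim exE) (rule that)
  define J where "J = max J0 1"
  define e where "e = 2 * J - 1"
  define P where "P = circle_points p e"
  define \<rho> where "\<rho> = sqrt (real p ^ e)"
  have J: "J \<ge> J0" "J \<ge> 1" by (auto simp: J_def)
  have oe: "odd e" using J(2) by (simp add: e_def)
  have near: "C * sqrt (real (card P)) \<le> real (card {q \<in> P. \<bar>real (fst q) / \<rho> - u\<bar> < \<eta> \<and> \<bar>real (snd q) / \<rho> - v\<bar> < \<eta>})"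
    if "u \<ge> 0" "v \<ge> 0" "u\<^sup>2 + v\<^sup>2 = 1" for u v
    using J0[rule_format, OF J(1) that] unfolding P_def e_def \<rho>_def .
  have P0: "P \<noteq> {}" unfolding P_def e_def by (rule circle_points_nonempty[OF p(1,3) J(2)])
  have fP: "finite P" by (simp add: P_def)
  have N: "card P > 0" using P0 fP by (simp add: card_gt_0_iff)
  have \<rho>0: "\<rho> > 0" using p2 by (simp add: \<rho>_def)
  have P\<rho>: "(real (fst q))\<^sup>2 + (real (snd q))\<^sup>2 = \<rho>\<^sup>2" if "q \<in> P" for q
  proof -
    have "(fst q)\<^sup>2 + (snd q)\<^sup>2 = p ^ e" using that by (auto simp: P_def circle_points_def)
    then have "real ((fst q)\<^sup>2 + (snd q)\<^sup>2) = real (p ^ e)" by (simp only:)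
    then show ?thesis by (simp add: \<rho>_def)
  qed
  \<comment> \<open>The lower bound on N comes from the same count: near the direction (1, 0) alone
    there are at least C sqrt N points.\<close>
  have sN: "C \<le> sqrt (real (card P))"
  proof -
    have "C * sqrt (real (card P)) \<le> real (card {q \<in> P. \<bar>real (fst q) / \<rho> - 1\<bar> < \<eta> \<and> \<bar>real (snd q) / \<rho> - 0\<bar> < \<eta>})"
      by (rule near) auto
    also have "\<dots> \<le> real (card P)" using fP by (intro of_nat_mono card_mono) auto
    also have "\<dots> = sqrt (real (card P)) * sqrt (real (card P))" by simp
    finally show ?thesis by (rule mult_right_le_imp_le) (use N in simp)
  qed
  have "\<exists>\<alpha> \<beta>. \<forall>s t. \<bar>K / sqrt (real (card P)) * (\<Sum>q\<in>P. wave (real (fst q) / \<rho>) (\<alpha> q) s 0 * wave (real (snd q) / \<rho>) (\<beta> q) t 0)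
      - (\<Sum>i\<in>I. A i * (wave (d1 i) (\<gamma> i) s 0 * wave (d2 i) (\<delta> i) t 0))\<bar>
    \<le> (\<Sum>i\<in>I. A i) * (real (s + t) * \<eta>) + (real (card I) + 3) * (K / sqrt (real (card P)))"
  proof (rule ex_phases[OF fP \<rho>0 P\<rho> I(1) _ _ \<eta>(1) N])
    show "0 < K" using K by simp
    fix i assume i: "i \<in> I"
    have "(d1 i)\<^sup>2 \<le> 1\<^sup>2" "(d2 i)\<^sup>2 \<le> 1\<^sup>2"
      using I(2)[rule_format, OF i] zero_le_power2[of "d1 i"] zero_le_power2[of "d2 i"] unfolding one_power2 by linarith+
    then show "A i \<ge> 0 \<and> 0 \<le> d1 i \<and> d1 i \<le> 1 \<and> 0 \<le> d2 i \<and> d2 i \<le> 1"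
      using I(2)[rule_format, OF i] power2_le_imp_le[of "d1 i" 1] power2_le_imp_le[of "d2 i" 1] by auto
    have "SA / K \<le> C"
    proof -
      have "SA / K \<le> SA / 1" using K SA by (intro divide_left_mono) auto
      then show ?thesis using C(2) by simp
    qed
    then have "SA / K * sqrt (real (card P)) \<le> C * sqrt (real (card P))" by (intro mult_right_mono) auto
    also have "\<dots> \<le> real (card {q \<in> P. \<bar>real (fst q) / \<rho> - d1 i\<bar> < \<eta> \<and> \<bar>real (snd q) / \<rho> - d2 i\<bar> < \<eta>})"
      using I(2)[rule_format, OF i] by (intro near) auto
    finally show "(\<Sum>j\<in>I. A j) / K * sqrt (real (card P)) \<le> real (card {q \<in> P. \<bar>real (fst q) / \<rho> - d1 i\<bar> < \<eta> \<and> \<bar>real (snd q) / \<rho> - d2 i\<bar> < \<eta>})"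
      by (simp only: SA_def)
  qed
  then obtain \<alpha> \<beta> where ab: "\<forall>s t. \<bar>K / sqrt (real (card P)) * (\<Sum>q\<in>P. wave (real (fst q) / \<rho>) (\<alpha> q) s 0 * wave (real (snd q) / \<rho>) (\<beta> q) t 0)
      - (\<Sum>i\<in>I. A i * (wave (d1 i) (\<gamma> i) s 0 * wave (d2 i) (\<delta> i) t 0))\<bar>
    \<le> SA * (real (s + t) * \<eta>) + (real (card I) + 3) * (K / sqrt (real (card P)))"
    unfolding SA_def[symmetric] by (elim exE) (rule that)
  have small: "SA * (real (s + t) * \<eta>) + (real (card I) + 3) * (K / sqrt (real (card P))) \<le> \<nu> * (1 + real (s + t))" for s t
  proof -
    have "SA * (real (s + t) * \<eta>) \<le> real (s + t) * \<nu>"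
      using mult_left_mono[OF \<eta>(2), of "real (s + t)"] by (simp add: mult_ac)
    moreover have "(real (card I) + 3) * (K / sqrt (real (card P))) \<le> \<nu>"
    proof -
      have "(real (card I) + 3) * K \<le> (real (card I) + 3) * 4" using K by (intro mult_left_mono) auto
      also have "\<dots> \<le> C * \<nu>" using C(3) \<nu> by (simp add: pos_divide_le_eq)
      also have "\<dots> \<le> sqrt (real (card P)) * \<nu>" using sN \<nu> by (intro mult_right_mono) auto
      finally show ?thesis using N by (simp add: pos_divide_le_eq mult.commute)
    qed
    ultimately show ?thesis by (simp add: algebra_simps)
  qed
  have snd_sub: "snd ` P \<subseteq> fst ` P"
    using circle_points_swap by (force simp: P_def)
  have "\<exists>x y. 0 \<le> x \<and> x < 1 \<and> 0 \<le> y \<and> y < 1 \<and>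
    (\<Sum>(a, b, m, n)\<in>taylor_indices k T. taylor_weight R (a, b, m, n) *
      \<bar>(\<Sum>q\<in>P. 4 / sqrt (real (card P)) * (wave (real (fst q) / \<rho>) (2 * pi * real (fst q) * x + \<mu>) (a + m) 0 *
          wave (real (snd q) / \<rho>) (2 * pi * real (snd q) * y + \<mu>) (b + n) 0))
        - (\<Sum>i\<in>I. A i * (wave (d1 i) (\<gamma> i) (a + m) 0 * wave (d2 i) (\<delta> i) (b + n) 0))\<bar>)
    \<le> 2 * \<nu> * weight_bound k R" for T \<mu>
  proof (rule fluctuation_taylor_sum_le[OF fP \<rho>0 P\<rho> N _ _ snd_sub _ D \<nu> R,
        where Y = "\<lambda>s t. \<Sum>i\<in>I. A i * (wave (d1 i) (\<gamma> i) s 0 * wave (d2 i) (\<delta> i) t 0)" and \<alpha> = \<alpha> and \<beta> = \<beta>])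
    show "finite (fst ` P)" using fP by simp
    show "fst ` P \<subseteq> fst ` P" by simp
    show "no_relations (int D + 2) (fst ` P)" unfolding P_def by (rule no_relations_circle_points[OF p(1) p2])
    show "\<bar>4 * (real D / real (D + 1))\<^sup>2 / sqrt (real (card P)) * (\<Sum>q\<in>P. wave (real (fst q) / \<rho>) (\<alpha> q) s 0 * wave (real (snd q) / \<rho>) (\<beta> q) t 0)
      - (\<Sum>i\<in>I. A i * (wave (d1 i) (\<gamma> i) s 0 * wave (d2 i) (\<delta> i) t 0))\<bar> \<le> \<nu> * (1 + real (s + t))" for s t
      using order_trans[OF ab[rule_format] small] unfolding K_def \<kappa>_def .
  qed
  then show ?thesis
    using p(1) p2(1) oe P0 unfolding P_def \<rho>_def
    by (intro exI[of _ p] exI[of _ e] conjI allI) simp_all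
qed

section \<open>Rescaled eigenfunctions\<close>

lemma not_square_odd_prime_power:
  fixes p n :: nat
  assumes "prime p" "odd e"
  shows "n\<^sup>2 \<noteq> p ^ e"
proof
  assume eq: "n\<^sup>2 = p ^ e"
  have "p ^ e \<noteq> 0" using assms(1) by simp
  then have "n \<noteq> 0" using eq by (intro notI) simp
  then have "multiplicity p (n\<^sup>2) = 2 * multiplicity p n"
    using assms(1) by (simp add: prime_elem_multiplicity_power_distrib)
  moreover have "multiplicity p (p ^ e) = e" using assms(1) by (simp add: multiplicity_same_power prime_elem_not_zeroI)
  ultimately show False using eq assms(2) by simp
qed

lemma sum_squares_mod_4_eq_0:
  fixes m n :: nat
  assumes "m\<^sup>2 + n\<^sup>2 = 4 * x"
  shows "even m \<and> even n"
proof (rule ccontr)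
  assume "\<not> ?thesis"
  moreover have "even (m\<^sup>2 + n\<^sup>2)" unfolding assms by simp
  ultimately have "odd m" "odd n" by auto
  then obtain a b where "m = 2 * a + 1" "n = 2 * b + 1" by (auto elim!: oddE)
  then have "4 * (a\<^sup>2 + a + b\<^sup>2 + b) + 2 = 4 * x"
    using assms by (simp add: power2_eq_square algebra_simps)
  then show False by presburger
qed

text \<open>The set is the same for both boundary conditions, since a point with a zero coordinate
  would make p^e a square.\<close>

lemma Nset_circle_points:
  assumes p: "prime p" "odd e"
  shows "Nset bc (pi\<^sup>2 * (4 * real p ^ e)) = (\<lambda>(m, n). (2 * m, 2 * n)) ` circle_points p e"
proof -
  have "real (m\<^sup>2 + n\<^sup>2) = pi\<^sup>2 * (4 * real p ^ e) / pi\<^sup>2 \<longleftrightarrow> m\<^sup>2 + n\<^sup>2 = 4 * p ^ e" for m n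
  proof -
    have "pi\<^sup>2 * (4 * real p ^ e) / pi\<^sup>2 = real (4 * p ^ e)" by simp
    then show ?thesis by (simp only: of_nat_eq_iff)
  qed
  then have N: "Nset bc (pi\<^sup>2 * (4 * real p ^ e)) = {(m, n). admissible bc (m, n) \<and> m\<^sup>2 + n\<^sup>2 = 4 * p ^ e}"
    unfolding Nset_def by simp
  show ?thesis
  proof (intro equalityI subsetI)
    fix q assume "q \<in> Nset bc (pi\<^sup>2 * (4 * real p ^ e))"
    then obtain m n where q: "q = (m, n)" and e: "m\<^sup>2 + n\<^sup>2 = 4 * p ^ e" unfolding N by auto
    obtain m' n' where mn: "m = 2 * m'" "n = 2 * n'"
      using sum_squares_mod_4_eq_0[OF e] by (auto elim!: evenE)
    have e': "m'\<^sup>2 + n'\<^sup>2 = p ^ e" using e unfolding mn by (simp add: power_mult_distrib)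
    have "m' > 0" "n' > 0"
      using e' not_square_odd_prime_power[OF p, of m'] not_square_odd_prime_power[OF p, of n'] by (auto intro!: gr0I)
    then have "(m', n') \<in> circle_points p e" using e' by (simp add: circle_points_def)
    then show "q \<in> (\<lambda>(m, n). (2 * m, 2 * n)) ` circle_points p e" using q mn by force
  next
    fix q assume "q \<in> (\<lambda>(m, n). (2 * m, 2 * n)) ` circle_points p e"
    then obtain m n where q: "q = (2 * m, 2 * n)" and mn: "(m, n) \<in> circle_points p e" by auto
    have "(2 * m)\<^sup>2 + (2 * n)\<^sup>2 = 4 * p ^ e" "m > 0" "n > 0"
      using mn by (auto simp: circle_points_def power_mult_distrib simp flip: distrib_left)
    then show "q \<in> Nset bc (pi\<^sup>2 * (4 * real p ^ e))"
      unfolding N q admissible_def by (cases bc) auto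
  qed
qed

text \<open>As sin u = cos(u - pi/2), both boundary conditions become products of cosines with a
  common shift.\<close>

definition bc_phase :: "BC \<Rightarrow> real" where
  "bc_phase bc = (case bc of Dirichlet \<Rightarrow> - (pi / 2) | Neumann \<Rightarrow> 0)"

lemma bc_product:
  "(case bc of Dirichlet \<Rightarrow> sin u * sin v | Neumann \<Rightarrow> cos u * cos v) = cos (u + bc_phase bc) * cos (v + bc_phase bc)"
  by (cases bc) (simp_all add: bc_phase_def cos_add cos_diff)

text \<open>The derivatives in w of the rescaled eigenfunction; the base point z enters only through
  the phases.\<close>

definition wave_jet :: "(nat \<times> nat) set \<Rightarrow> real \<Rightarrow> real \<Rightarrow> real \<times> real \<Rightarrow> nat \<Rightarrow> nat \<Rightarrow> real \<times> real \<Rightarrow> real" where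
  "wave_jet P \<rho> \<mu> z a b w = (\<Sum>q\<in>P. 4 / sqrt (real (card P)) *
     (wave (real (fst q) / \<rho>) (2 * pi * real (fst q) * fst z + \<mu>) a (fst w) *
      wave (real (snd q) / \<rho>) (2 * pi * real (snd q) * snd z + \<mu>) b (snd w)))"

lemma jet_wave_jet: "jet (wave_jet P \<rho> \<mu> z)"
  unfolding jet_def wave_jet_def
proof (intro allI conjI)
  fix a b x y
  show "((\<lambda>t. \<Sum>q\<in>P. 4 / sqrt (real (card P)) * (wave (real (fst q) / \<rho>) (2 * pi * real (fst q) * fst z + \<mu>) a (fst (t, y)) *
      wave (real (snd q) / \<rho>) (2 * pi * real (snd q) * snd z + \<mu>) b (snd (t, y)))) has_real_derivative
     (\<Sum>q\<in>P. 4 / sqrt (real (card P)) * (wave (real (fst q) / \<rho>) (2 * pi * real (fst q) * fst z + \<mu>) (Suc a) (fst (x, y)) *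
      wave (real (snd q) / \<rho>) (2 * pi * real (snd q) * snd z + \<mu>) b (snd (x, y))))) (at x)"
    unfolding fst_conv snd_conv by (intro DERIV_sum DERIV_cmult DERIV_cmult_right wave_deriv)
  show "((\<lambda>t. \<Sum>q\<in>P. 4 / sqrt (real (card P)) * (wave (real (fst q) / \<rho>) (2 * pi * real (fst q) * fst z + \<mu>) a (fst (x, t)) *
      wave (real (snd q) / \<rho>) (2 * pi * real (snd q) * snd z + \<mu>) b (snd (x, t)))) has_real_derivative
     (\<Sum>q\<in>P. 4 / sqrt (real (card P)) * (wave (real (fst q) / \<rho>) (2 * pi * real (fst q) * fst z + \<mu>) a (fst (x, y)) *
      wave (real (snd q) / \<rho>) (2 * pi * real (snd q) * snd z + \<mu>) (Suc b) (snd (x, y))))) (at y)"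
    unfolding fst_conv snd_conv by (intro DERIV_sum DERIV_cmult wave_deriv)
qed

text \<open>Here sqrt lv = 2 pi \<rho>, so the frequency 2 m pi becomes m / \<rho> in the rescaled
  variable, a coordinate of a unit vector, while the base point contributes the phase 2 pi m
  x.\<close>

lemma ufun_rescaled:
  assumes p: "prime p" "odd e"
  defines "lv \<equiv> pi\<^sup>2 * (4 * real p ^ e)"
  shows "ufun bc lv (z + (1 / sqrt lv) *\<^sub>R w) = wave_jet (circle_points p e) (sqrt (real p ^ e)) (bc_phase bc) z 0 0 w"
proof -
  let ?P = "circle_points p e" and ?\<rho> = "sqrt (real p ^ e)"
  let ?D = "\<lambda>(m, n). (2 * m, 2 * n) :: nat \<times> nat"
  have inj: "inj_on ?D ?P" by (auto simp: inj_on_def)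
  have N: "Nset bc lv = ?D ` ?P" unfolding lv_def by (rule Nset_circle_points[OF p])
  have card: "card (Nset bc lv) = card ?P" unfolding N by (rule card_image[OF inj])
  have sq: "sqrt lv = 2 * pi * ?\<rho>" by (simp add: lv_def real_sqrt_mult)
  have arg: "real (2 * m) * pi * (x + 1 / sqrt lv * t) = real m / ?\<rho> * t + 2 * pi * real m * x" for m x t
    unfolding sq using p prime_gt_0_nat[of p] by (simp add: field_simps)
  have "ufun bc lv (z + (1 / sqrt lv) *\<^sub>R w) = 4 / sqrt (real (card ?P)) *
     (\<Sum>(m, n)\<in>?P. cos (real (2 * m) * pi * (fst z + 1 / sqrt lv * fst w) + bc_phase bc) *
        cos (real (2 * n) * pi * (snd z + 1 / sqrt lv * snd w) + bc_phase bc))"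
    unfolding ufun_def card unfolding N sum.reindex[OF inj] by (simp add: case_prod_unfold bc_product)
  also have "\<dots> = wave_jet ?P ?\<rho> (bc_phase bc) z 0 0 w"
    unfolding arg wave_jet_def sum_distrib_left by (simp add: case_prod_unfold wave_def add.assoc)
  finally show ?thesis .
qed

lemma Ck_norm_jet_le:
  assumes j: "jet F" and g: "g = F 0 0" and r: "r > 0"
    and le: "\<And>a b w. a + b \<le> k \<Longrightarrow> w \<in> ball c r \<Longrightarrow> \<bar>F a b w\<bar> \<le> C"
  shows "Ck_norm k (ball c r) g \<le> C"
  unfolding Ck_norm_def g jet_pd[OF j]
proof (rule cSup_least)
  have "c \<in> ball c r" using r by simp
  then have "\<bar>F 0 0 c\<bar> \<in> {\<bar>F a b z\<bar> |a b z. a + b \<le> k \<and> z \<in> ball c r}"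
    by (intro CollectI exI[of _ 0] exI[of _ c]) simp
  then show "{\<bar>F a b z\<bar> |a b z. a + b \<le> k \<and> z \<in> ball c r} \<noteq> {}" by blast
qed (use le in auto)

text \<open>A base point found on the grid may have x = 0 or y = 0 and so miss the open square. It
  lies in the closure, so a strict inequality for a continuous function holds on a nonempty open
  part of the square itself.\<close>

lemma open_subset_Q1:
  fixes H :: "real \<times> real \<Rightarrow> real"
  assumes "continuous_on UNIV H" "0 \<le> x" "x < 1" "0 \<le> y" "y < 1" "H (x, y) < \<epsilon>"
  defines "M \<equiv> {z. H z < \<epsilon>} \<inter> Q1"
  shows "M \<in> sets lebesgue" "emeasure lebesgue M > 0"
proof -
  have oH: "open {z. H z < \<epsilon>}" using assms(1) by (intro open_Collect_less continuous_on_const)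
  have oQ: "open Q1" unfolding Q1_def by (intro open_Times) auto
  have oM: "open M" unfolding M_def using oH oQ by (rule open_Int)
  have "(x, y) \<in> closure Q1" unfolding Q1_def closure_Times using assms(2-5) by simp
  then have "{z. H z < \<epsilon>} \<inter> Q1 \<noteq> {}"
    using open_Int_closure_eq_empty[OF oH, of Q1] assms(6) by blast
  then have ne: "M \<noteq> {}" by (simp add: M_def)
  have b: "M \<in> sets borel" using oM by (rule borel_open)
  then show "M \<in> sets lebesgue" by (simp add: sets_completionI_sets)
  have "emeasure lebesgue M = emeasure lborel M" using b by simp
  moreover have "emeasure lborel M \<noteq> 0"
  proof
    assume "emeasure lborel M = 0"
    then have "negligible M"
      unfolding negligible_iff_null_sets using b by (intro null_setsI) auto
    then show False using open_not_negligible[OF oM ne] by blast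
  qed
  ultimately show "emeasure lebesgue M > 0" by (simp add: zero_less_iff_neq_zero)
qed

text \<open>One quarter of \<epsilon> each pays for the approximation of \<phi> by waves, for the
  Taylor coefficients at 0 and for the Taylor remainder; the last quarter keeps the inequality
  strict.\<close>

lemma MW_approximation:
  assumes phi: "\<phi> \<in> MW" and eps: "\<epsilon> > 0" and r: "r > 0"
  shows "\<exists>lv\<in>eigenvalues bc. \<exists>M. M \<subseteq> Q1 \<and> M \<in> sets lebesgue \<and> emeasure lebesgue M > 0 \<and>
     (\<forall>z0\<in>M. Ck_norm k (ball c r) (\<lambda>w. ufun bc lv (z0 + (1 / sqrt lv) *\<^sub>R w) - \<phi> w) < \<epsilon>)"
proof -
  define R where "R = \<bar>fst c\<bar> + \<bar>snd c\<bar> + r"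
  have R0: "R \<ge> 0" using r by (simp add: R_def)
  have bR: "\<bar>fst w\<bar> \<le> R \<and> \<bar>snd w\<bar> \<le> R" if "w \<in> ball c r" for w
  proof -
    have "dist (fst c) (fst w) < r" "dist (snd c) (snd w) < r"
      using that dist_fst_le[of c w] dist_snd_le[of c w] by auto
    then show ?thesis unfolding R_def dist_real_def by linarith
  qed
  define e4 where "e4 = \<epsilon> / 4"
  have e4: "e4 > 0" using eps by (simp add: e4_def)
  obtain I :: "(nat \<times> bool) set" and A d1 d2 \<gamma> \<delta> where I: "finite I"
    and Ad: "\<forall>i\<in>I. A i \<ge> (0::real) \<and> d1 i \<ge> 0 \<and> d2 i \<ge> 0 \<and> (d1 i)\<^sup>2 + (d2 i)\<^sup>2 = 1"
    and ap: "\<forall>a b x y. a + b \<le> k \<longrightarrow> \<bar>x\<bar> \<le> R \<longrightarrow> \<bar>y\<bar> \<le> R \<longrightarrow>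
      \<bar>(pd1 ^^ a) ((pd2 ^^ b) \<phi>) (x, y) - (\<Sum>i\<in>I. A i * (wave (d1 i) (\<gamma> i) a x * wave (d2 i) (\<delta> i) b y))\<bar> \<le> e4"
    using MW_approx_waves[OF phi e4, of k R] by (elim exE conjE) (rule that)
  define G where "G = weight_bound k R"
  have G: "G \<ge> 0" by (simp add: G_def weight_bound_def)
  define \<nu> where "\<nu> = e4 / (2 * G + 1)"
  have \<nu>: "\<nu> > 0" "2 * \<nu> * G < e4" using e4 G by (auto simp: \<nu>_def field_simps)
  let ?Y = "\<lambda>s t. \<Sum>i\<in>I. A i * (wave (d1 i) (\<gamma> i) s 0 * wave (d2 i) (\<delta> i) t 0)"
  obtain p e where p: "prime p" "p > 2" "odd e" and ne: "circle_points p e \<noteq> {}"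
    and circ: "\<forall>T \<mu>. \<exists>x y. 0 \<le> x \<and> x < 1 \<and> 0 \<le> y \<and> y < 1 \<and>
    (\<Sum>(a, b, m, n)\<in>taylor_indices k T. taylor_weight R (a, b, m, n) *
      \<bar>(\<Sum>q\<in>circle_points p e. 4 / sqrt (real (card (circle_points p e))) *
          (wave (real (fst q) / sqrt (real p ^ e)) (2 * pi * real (fst q) * x + \<mu>) (a + m) 0 *
           wave (real (snd q) / sqrt (real p ^ e)) (2 * pi * real (snd q) * y + \<mu>) (b + n) 0))
       - ?Y (a + m) (b + n)\<bar>) \<le> 2 * \<nu> * weight_bound k R"
    using ex_circle_approximation[OF I Ad \<nu>(1) R0, where k = k and \<gamma> = \<gamma> and \<delta> = \<delta>] by (elim exE conjE) (rule that)
  define P where "P = circle_points p e"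
  define \<rho> where "\<rho> = sqrt (real p ^ e)"
  define \<mu> where "\<mu> = bc_phase bc"
  define lv where "lv = pi\<^sup>2 * (4 * real p ^ e)"
  \<comment> \<open>The total amplitude of the two sums compared, by which the Taylor remainder is
    multiplied. It depends on the circle, so T is chosen after it.\<close>
  define Mt where "Mt = (\<Sum>q\<in>P. \<bar>4 / sqrt (real (card P))\<bar>) + (\<Sum>i\<in>I. \<bar>A i\<bar>)"
  have Mt: "Mt \<ge> 0" unfolding Mt_def by (intro add_nonneg_nonneg sum_nonneg) auto
  have "(\<lambda>T. R ^ T / fact T) \<longlonglongrightarrow> 0"
    using summable_LIMSEQ_zero[OF summable_exp[of R]] by (simp add: divide_inverse mult.commute)
  then have "\<forall>\<^sub>F T in sequentially. R ^ T / fact T < min 1 (e4 / (3 * (Mt + 1)))"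
    using e4 Mt by (intro order_tendstoD(2)[where a = "min 1 (e4 / (3 * (Mt + 1)))"]) auto
  then obtain T where T: "R ^ T / fact T < min 1 (e4 / (3 * (Mt + 1)))"
    unfolding eventually_sequentially by blast
  have T1: "R ^ T / fact T \<le> 1" using T by simp
  have T2: "3 * (R ^ T / fact T) * Mt \<le> e4"
  proof -
    have "3 * (R ^ T / fact T) * Mt \<le> 3 * (e4 / (3 * (Mt + 1))) * Mt"
      using T Mt by (intro mult_right_mono mult_left_mono) auto
    also have "\<dots> \<le> e4" using Mt e4 by (simp add: field_simps)
    finally show ?thesis .
  qed
  \<comment> \<open>A single continuous function of the base point bounds all derivatives on the
    ball, so the condition defining the good base points is open.\<close>
  define H where "H = (\<lambda>z. \<Sum>(a, b, m, n)\<in>taylor_indices k T. taylor_weight R (a, b, m, n) *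
      \<bar>wave_jet P \<rho> \<mu> z (a + m) (b + n) (0, 0) - ?Y (a + m) (b + n)\<bar>)"
  have cH: "continuous_on UNIV H"
    unfolding H_def wave_jet_def wave_def case_prod_unfold
    by (intro continuous_on_sum continuous_on_mult continuous_on_rabs continuous_on_diff continuous_on_const
        continuous_on_cos continuous_on_add continuous_on_fst continuous_on_snd continuous_on_id)
  obtain x y where xy: "0 \<le> x" "x < 1" "0 \<le> y" "y < 1" and "H (x, y) \<le> 2 * \<nu> * weight_bound k R"
    using circ[THEN spec[of _ T], THEN spec[of _ \<mu>]]
    by (elim exE conjE) (rule that[unfolded H_def wave_jet_def P_def \<rho>_def fst_conv snd_conv])
  then have Hxy: "H (x, y) < e4" using \<nu>(2) by (simp add: G_def)
  define M where "M = {z. H z < e4} \<inter> Q1"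
  have x01: "0 \<le> real (fst q) / \<rho> \<and> real (fst q) / \<rho> \<le> 1 \<and> 0 \<le> real (snd q) / \<rho> \<and> real (snd q) / \<rho> \<le> 1" if "q \<in> P" for q
  proof -
    have "(fst q)\<^sup>2 + (snd q)\<^sup>2 = p ^ e" using that by (auto simp: P_def circle_points_def)
    then have "real ((fst q)\<^sup>2 + (snd q)\<^sup>2) = real (p ^ e)" by (simp only:)
    then have "(real (fst q))\<^sup>2 + (real (snd q))\<^sup>2 = \<rho>\<^sup>2" "\<rho> > 0" using p by (simp_all add: \<rho>_def)
    then show ?thesis by (rule circle_coordinates_le_1)
  qed
  have d01: "0 \<le> d1 i \<and> d1 i \<le> 1 \<and> 0 \<le> d2 i \<and> d2 i \<le> 1" if "i \<in> I" for i
  proof -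
    have "(d1 i)\<^sup>2 \<le> 1\<^sup>2" "(d2 i)\<^sup>2 \<le> 1\<^sup>2"
      using Ad[rule_format, OF that] zero_le_power2[of "d1 i"] zero_le_power2[of "d2 i"] unfolding one_power2 by linarith+
    then show ?thesis
      using Ad[rule_format, OF that] power2_le_imp_le[of "d1 i" 1] power2_le_imp_le[of "d2 i" 1] by auto
  qed
  have "Ck_norm k (ball c r) (\<lambda>w. ufun bc lv (z + (1 / sqrt lv) *\<^sub>R w) - \<phi> w) \<le> e4 + e4 + e4" if z: "z \<in> M" for z
  proof (rule Ck_norm_jet_le[OF _ _ r])
    have "smooth2 \<phi>" using phi by (simp add: MW_def)
    then show "jet (\<lambda>a b w. wave_jet P \<rho> \<mu> z a b w - (pd1 ^^ a) ((pd2 ^^ b) \<phi>) w)"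
      by (intro jet_diff jet_wave_jet smooth2_jet)
    show "(\<lambda>w. ufun bc lv (z + (1 / sqrt lv) *\<^sub>R w) - \<phi> w) = (\<lambda>w. wave_jet P \<rho> \<mu> z 0 0 w - (pd1 ^^ 0) ((pd2 ^^ 0) \<phi>) w)"
      unfolding lv_def ufun_rescaled[OF p(1,3)] P_def \<rho>_def \<mu>_def by simp
    fix a b w assume ab: "a + b \<le> k" and w: "w \<in> ball c r"
    obtain x y where wxy: "w = (x, y)" by (cases w)
    have xy: "\<bar>x\<bar> \<le> R" "\<bar>y\<bar> \<le> R" using bR[OF w] by (auto simp: wxy)
    have "a \<le> k" "b \<le> k" using ab by auto
    from wave_sums_close[where J = P and J' = I and k = k and T = T, OF x01 d01 xy T1 this,
        where c = "\<lambda>_. 4 / sqrt (real (card P))" and c' = A and \<gamma>' = \<gamma> and \<delta>' = \<delta>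
        and \<gamma> = "\<lambda>q. 2 * pi * real (fst q) * fst z + \<mu>" and \<delta> = "\<lambda>q. 2 * pi * real (snd q) * snd z + \<mu>"]
    have "\<bar>wave_jet P \<rho> \<mu> z a b (x, y) - (\<Sum>i\<in>I. A i * (wave (d1 i) (\<gamma> i) a x * wave (d2 i) (\<delta> i) b y))\<bar>
        \<le> H z + 3 * (R ^ T / fact T) * Mt"
      unfolding wave_jet_def H_def Mt_def fst_conv snd_conv .
    moreover have "H z < e4" using z by (simp add: M_def)
    moreover note T2 ap[rule_format, OF ab xy]
    ultimately show "\<bar>wave_jet P \<rho> \<mu> z a b w - (pd1 ^^ a) ((pd2 ^^ b) \<phi>) w\<bar> \<le> e4 + e4 + e4"
      unfolding wxy by linarith
  qed
  moreover have "e4 + e4 + e4 < \<epsilon>" using eps by (simp add: e4_def)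
  ultimately have "\<forall>z\<in>M. Ck_norm k (ball c r) (\<lambda>w. ufun bc lv (z + (1 / sqrt lv) *\<^sub>R w) - \<phi> w) < \<epsilon>"
    by (meson order_le_less_trans)
  moreover have "M \<in> sets lebesgue" "emeasure lebesgue M > 0"
    unfolding M_def by (rule open_subset_Q1[OF cH xy Hxy])+
  moreover have "M \<subseteq> Q1" by (simp add: M_def)
  moreover have "lv \<in> eigenvalues bc"
  proof -
    have "Nset bc lv \<noteq> {}" unfolding lv_def Nset_circle_points[OF p(1,3)] using ne by simp
    then obtain m n where "admissible bc (m, n)" "real (m\<^sup>2 + n\<^sup>2) = lv / pi\<^sup>2" by (auto simp: Nset_def)
    then have "lv = pi\<^sup>2 * real (m\<^sup>2 + n\<^sup>2) \<and> admissible bc (m, n)" by simp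
    then show ?thesis unfolding eigenvalues_def by blast
  qed
  ultimately show ?thesis by blast
qed

theorem theoremA1:
  fixes bc :: BC and lam :: "nat \<Rightarrow> real"
  assumes "strict_mono lam" and "range lam = eigenvalues bc"
  shows "\<exists>nj :: nat \<Rightarrow> nat. strict_mono nj \<and> density_one (range nj) \<and>
    (\<forall>\<phi>\<in>MW. \<forall>\<epsilon>>0. \<forall>(c :: real \<times> real) (r :: real). r > 0 \<longrightarrow> (\<forall>k :: nat.
      \<exists>J :: nat. \<exists>M. M \<subseteq> Q1 \<and> M \<in> sets lebesgue \<and> emeasure lebesgue M > 0 \<and>
        (\<forall>z0\<in>M. Ck_norm k (ball c r)
           (\<lambda>w. ufun bc (lam (nj J)) (z0 + (1 / sqrt (lam (nj J))) *\<^sub>R w) - \<phi> w) < \<epsilon>)))"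
proof (rule exI[of _ "\<lambda>n. n"], intro conjI ballI allI impI)
  show "strict_mono (\<lambda>n::nat. n)" by (simp add: strict_mono_def)
  have "(\<lambda>N. real (card ({..<N} :: nat set)) / real N) \<longlonglongrightarrow> 1"
    by (rule tendsto_eventually) (auto simp: eventually_sequentially intro!: exI[of _ 1])
  then show "density_one (range (\<lambda>n. n))" by (simp add: density_one_def)
  fix \<phi> and \<epsilon> :: real and c :: "real \<times> real" and r :: real and k
  assume "\<phi> \<in> MW" "\<epsilon> > 0" "r > 0"
  from MW_approximation[OF this, of bc k c] obtain lv where lv: "lv \<in> eigenvalues bc"
    and M: "\<exists>M. M \<subseteq> Q1 \<and> M \<in> sets lebesgue \<and> emeasure lebesgue M > 0 \<and>
     (\<forall>z0\<in>M. Ck_norm k (ball c r) (\<lambda>w. ufun bc lv (z0 + (1 / sqrt lv) *\<^sub>R w) - \<phi> w) < \<epsilon>)"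
    by (elim bexE) (rule that)
  obtain J where "lv = lam J" using lv assms(2) by (metis rangeE)
  with M show "\<exists>J M. M \<subseteq> Q1 \<and> M \<in> sets lebesgue \<and> emeasure lebesgue M > 0 \<and>
     (\<forall>z0\<in>M. Ck_norm k (ball c r) (\<lambda>w. ufun bc (lam J) (z0 + (1 / sqrt (lam J)) *\<^sub>R w) - \<phi> w) < \<epsilon>)"
    by blast
qed

end
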